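(* Weighted Terminal Monitoring Set (defined in the context) admits an FPT algorithm when parameterized by the vertex cover number $t$ of the input graph $G$; i.e., it can be decided in time $f(t)\cdot |I|^{O(1)}$ for some computable function $f$, where $|I|$ is the instance size.
   Context: Weighted Terminal Monitoring Set: the input is $(G,\mathcal{T},k)$ where $G=(V,E)$ is a finite simple undirected graph with a positive weight on each edge, $\mathcal{T}$ is a collection of pairs $\{u,v\}$ of vertices of $G$ (terminal pairs, each at finite distance), and $k\in\mathbb{N}$. Let $d$ denote the weighted shortest-path distance in $G$. The question is whether there is $S\subseteq V$ with $|S|\le k$ such that for every $\{u,v\}\in\mathcal{T}$ there is $w\in S$ with $d(u,w)+d(w,v)=d(u,v)$. The vertex cover number of $G$ is the minimum size of a set $C\subseteq V$ such that every edge has an endpoint in $C$. *)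

theory Defs
  imports "Graph_Theory.Graph_Theory" "HOL-Library.Log_Nat"
begin

section \<open>Model of computation\<close>

text \<open>
  Random access machines with natural number cells, unit cost, and the operations addition,
  truncated subtraction and halving, presented as structured programs. The memory consists of
  named unbounded arrays (a program mentions only finitely many of them), which may be read and
  written at computed addresses. There is no unit-cost multiplication: an operation lengthens
  the numbers that occur by at most one bit, so running times are polynomially related to those
  of Turing machines.
\<close>

datatype aexp =
    N nat
  | Cell string aexp
  | Plus aexp aexp
  | Minus aexp aexp
  | Half aexp

datatype com =
    Skip
  | Assign string aexp aexp
  | Seq com com
  | If aexp com com
  | While aexp com

type_synonym state = "string \<Rightarrow> nat \<Rightarrow> nat"

primrec aval :: "aexp \<Rightarrow> state \<Rightarrow> nat" where
  "aval (N n) s = n"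
| "aval (Cell x a) s = s x (aval a s)"
| "aval (Plus a b) s = aval a s + aval b s"
| "aval (Minus a b) s = aval a s - aval b s"
| "aval (Half a) s = aval a s div 2"

primrec acost :: "aexp \<Rightarrow> nat" where
  "acost (N n) = 1"
| "acost (Cell x a) = 1 + acost a"
| "acost (Plus a b) = 1 + acost a + acost b"
| "acost (Minus a b) = 1 + acost a + acost b"
| "acost (Half a) = 1 + acost a"

text \<open>
  \<open>exec c s t s'\<close>: started in \<open>s\<close>, the program \<open>c\<close> halts in \<open>s'\<close> after exactly \<open>t\<close> steps.
  Guards are true iff they evaluate to a nonzero number; \<open>Assign x a b\<close> is \<open>x[a] := b\<close>.
\<close>

inductive exec :: "com \<Rightarrow> state \<Rightarrow> nat \<Rightarrow> state \<Rightarrow> bool" where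
  Skip: "exec Skip s 1 s"
| Assign: "exec (Assign x a b) s (1 + acost a + acost b)
             (s(x := (s x)(aval a s := aval b s)))"
| Seq: "exec c1 s t1 s' \<Longrightarrow> exec c2 s' t2 s'' \<Longrightarrow> exec (Seq c1 c2) s (t1 + t2) s''"
| IfTrue: "aval b s \<noteq> 0 \<Longrightarrow> exec c1 s t s' \<Longrightarrow> exec (If b c1 c2) s (1 + acost b + t) s'"
| IfFalse: "aval b s = 0 \<Longrightarrow> exec c2 s t s' \<Longrightarrow> exec (If b c1 c2) s (1 + acost b + t) s'"
| WhileFalse: "aval b s = 0 \<Longrightarrow> exec (While b c) s (1 + acost b) s"
| WhileTrue: "aval b s \<noteq> 0 \<Longrightarrow> exec c s t1 s' \<Longrightarrow> exec (While b c) s' t2 s'' \<Longrightarrow>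
    exec (While b c) s (1 + acost b + t1 + t2) s''"

inductive_cases exec_SkipE: "exec Skip s t s'"
inductive_cases exec_AssignE: "exec (Assign x a b) s t s'"
inductive_cases exec_SeqE: "exec (Seq c1 c2) s t s'"
inductive_cases exec_IfE: "exec (If b c1 c2) s t s'"
inductive_cases exec_WhileE: "exec (While b c) s t s'"

lemma exec_deterministic:
  "exec c s t s' \<Longrightarrow> exec c s u s'' \<Longrightarrow> u = t \<and> s'' = s'"
proof (induction arbitrary: u s'' rule: exec.induct)
  case (Skip s)
  from Skip.prems show ?case by (rule exec_SkipE) simp
next
  case (Assign x a b s)
  from Assign.prems show ?case by (rule exec_AssignE) simp
next
  case (Seq c1 s t1 s1 c2 t2 s2)
  from Seq.prems obtain u1 u2 r where u: "u = u1 + u2"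
    and r: "exec c1 s u1 r" "exec c2 r u2 s''"
    by (rule exec_SeqE)
  from Seq.IH(1)[OF r(1)] have "u1 = t1" "r = s1" by simp_all
  moreover from Seq.IH(2) r(2) \<open>r = s1\<close> have "u2 = t2 \<and> s'' = s2" by blast
  ultimately show ?case using u by simp
next
  case (IfTrue b s c1 t s' c2)
  from IfTrue.prems IfTrue.hyps(1) obtain t' where "u = 1 + acost b + t'" "exec c1 s t' s''"
    by (auto elim!: exec_IfE)
  then show ?case using IfTrue.IH[of t' s''] by simp
next
  case (IfFalse b s c2 t s' c1)
  from IfFalse.prems IfFalse.hyps(1) obtain t' where "u = 1 + acost b + t'" "exec c2 s t' s''"
    by (auto elim!: exec_IfE)
  then show ?case using IfFalse.IH[of t' s''] by simp
next
  case (WhileFalse b s c)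
  from WhileFalse.prems show ?case
    by (rule exec_WhileE) (use WhileFalse.hyps in simp_all)
next
  case (WhileTrue b s c t1 s1 t2 s2)
  from WhileTrue.prems WhileTrue.hyps(1) obtain u1 r u2
    where u: "u = 1 + acost b + u1 + u2" and r: "exec c s u1 r" "exec (While b c) r u2 s''"
    by (auto elim: exec_WhileE[where b = b and c = c and s = s])
  from WhileTrue.IH(1)[OF r(1)] have *: "u1 = t1" "r = s1" by simp_all
  with WhileTrue.IH(2)[of u2 s''] r(2) have "u2 = t2 \<and> s'' = s2" by simp
  with u * show ?case by simp
qed

text \<open>
  The input list is stored in the array \<open>in\<close>, preceded by its length; the result is read off
  cell 0 of the array \<open>out\<close>.
\<close>

definition input_state :: "nat list \<Rightarrow> state" where
  "input_state xs = (\<lambda>_ _. 0)(''in'' :=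
     (\<lambda>i. case i of 0 \<Rightarrow> length xs | Suc j \<Rightarrow> if j < length xs then xs ! j else 0))"

definition computes_in :: "com \<Rightarrow> nat list \<Rightarrow> nat \<Rightarrow> nat \<Rightarrow> bool" where
  "computes_in P xs y t \<longleftrightarrow> (\<exists>s. exec P (input_state xs) t s \<and> s ''out'' 0 = y)"

definition computable :: "(nat \<Rightarrow> nat) \<Rightarrow> bool" where
  "computable f \<longleftrightarrow> (\<exists>P. \<forall>n. \<exists>t. computes_in P [n] (f n) t)"

text \<open>Number of bits of the input, with one extra symbol to terminate each entry.\<close>

definition input_size :: "nat list \<Rightarrow> nat" where
  "input_size xs = (\<Sum>x\<leftarrow>xs. 1 + floorlog 2 x)"


section \<open>Fixed-parameter tractability\<close>

text \<open>
  \<open>encodes I xs\<close> says that \<open>xs\<close> is an input representing the instance \<open>I\<close>; the running time is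
  measured in the size of that input. The parameter is not part of the input.
\<close>

definition fixed_parameter_tractable ::
  "('i \<Rightarrow> bool) \<Rightarrow> ('i \<Rightarrow> nat list \<Rightarrow> bool) \<Rightarrow> ('i \<Rightarrow> bool) \<Rightarrow> ('i \<Rightarrow> nat) \<Rightarrow> bool" where
  "fixed_parameter_tractable inst encodes yes \<kappa> \<longleftrightarrow>
     (\<exists>P f c. computable f \<and>
       (\<forall>I xs. inst I \<longrightarrow> encodes I xs \<longrightarrow>
         (\<exists>t. computes_in P xs (if yes I then 1 else 0) t \<and>
              t \<le> f (\<kappa> I) * input_size xs ^ c)))"


section \<open>Weighted Terminal Monitoring Set\<close>

text \<open>
  A simple undirected graph is a finite, loop-free, symmetric digraph whose arcs are pairs of
  vertices (locale \<open>pair_graph\<close>); an edge weight is a function on arcs that agrees on the two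
  arcs of an edge.
\<close>

definition vertex_cover :: "'a pair_pre_digraph \<Rightarrow> 'a set \<Rightarrow> bool" where
  "vertex_cover G C \<longleftrightarrow> C \<subseteq> pverts G \<and> (\<forall>(u, v) \<in> parcs G. u \<in> C \<or> v \<in> C)"

definition vertex_cover_number :: "'a pair_pre_digraph \<Rightarrow> nat" where
  "vertex_cover_number G = Min (card ` {C. vertex_cover G C})"

record 'a wtms =
  network :: "'a pair_pre_digraph"
  weight :: "'a \<times> 'a \<Rightarrow> real"
  terminals :: "'a set set"
  budget :: nat

definition distance :: "'a wtms \<Rightarrow> 'a \<Rightarrow> 'a \<Rightarrow> ereal" where
  "distance I u v = wf_digraph.\<mu> (with_proj (network I)) (weight I) u v"

definition wtms_instance :: "'a wtms \<Rightarrow> bool" where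
  "wtms_instance I \<longleftrightarrow>
     pair_graph (network I) \<and>
     (\<forall>(u, v) \<in> parcs (network I). weight I (u, v) > 0 \<and> weight I (u, v) = weight I (v, u)) \<and>
     (\<forall>p \<in> terminals I. \<exists>u v. p = {u, v} \<and> u \<noteq> v \<and>
        u \<in> pverts (network I) \<and> v \<in> pverts (network I) \<and> distance I u v < \<infinity>)"

definition wtms_yes :: "'a wtms \<Rightarrow> bool" where
  "wtms_yes I \<longleftrightarrow>
     (\<exists>S \<subseteq> pverts (network I). card S \<le> budget I \<and>
        (\<forall>u v. {u, v} \<in> terminals I \<longrightarrow>
           (\<exists>w \<in> S. distance I u w + distance I w v = distance I u v)))"

text \<open>
  An instance is presented, with respect to an arbitrary enumeration \<open>vs\<close> of its vertices, by
  the number \<open>n\<close> of vertices, the budget, the number of terminal pairs, the rows of the weighted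
  adjacency matrix, and the list of terminal pairs (as pairs of indices). A matrix entry is a
  fraction, given by numerator and denominator, and is zero where there is no edge; thus exactly
  the instances with rational weights have a presentation. The matrix makes the input size at
  least \<open>n\<^sup>2\<close>, even if there are few edges.
\<close>

definition wtms_encodes :: "'a wtms \<Rightarrow> nat list \<Rightarrow> bool" where
  "wtms_encodes I xs \<longleftrightarrow>
     (\<exists>vs num den ts.
        distinct vs \<and> set vs = pverts (network I) \<and>
        (\<forall>i < length vs. \<forall>j < length vs. den i j > 0 \<and>
           real (num i j) / real (den i j) =
             (if (vs ! i, vs ! j) \<in> parcs (network I) then weight I (vs ! i, vs ! j) else 0)) \<and>
        (\<forall>(i, j) \<in> set ts. i < length vs \<and> j < length vs) \<and>
        (\<lambda>(i, j). {vs ! i, vs ! j}) ` set ts = terminals I \<and>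
        xs = [length vs, budget I, length ts]
             @ concat [[num i j, den i j]. i \<leftarrow> [0..<length vs], j \<leftarrow> [0..<length vs]]
             @ concat [[i, j]. (i, j) \<leftarrow> ts])"

end

(*
  A vertex cover C meets every path with an edge, so C itself solves the instance if the budget k is
  at least |C|, and k can be lowered to |C|. A greedy matching yields such a C of size at most 2t.

  Let the type of a vertex outside C be the set of pairs (x, y) of cover vertices for which it lies on
  a shortest path from x to y. The neighbours on a path of an inner vertex outside C belong to C;
  hence two vertices of the same type hit the same terminal pairs, apart from the pairs that contain
  one of them. Let every vertex of C be a type of its own. There are at most 2t + 2^(4t^2) types.

  The algorithm guesses the set Z of types of a solution and drops the pairs that are hit by an inner
  vertex whose type is in Z. A remaining pair can only be hit by one of its two ends, so it is
  branched on which end to take. In the end every type of Z that is not present among the chosen ends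
  costs one more vertex. All guesses together are the bits of a number below 2^(4t + 16^(t^2)), and
  the program tries all of them.

  The program clears denominators, so that distances are natural numbers, and computes them with the
  Floyd-Warshall algorithm.
*)

theory Submission
  imports Defs
begin

section \<open>Total correctness with running times\<close>

text \<open>The combinatorial part does without paths. It needs a matrix with a triangle inequality
  and one more fact: if \<open>j\<close> is at finite distance from \<open>i \<noteq> j\<close>,
  some neighbour of \<open>j\<close> lies on a shortest way from \<open>i\<close> to
  \<open>j\<close>. The Floyd-Warshall recursion alone yields this; walks enter only when the matrix
  is compared with \<open>distance\<close>.

  Tokens are needed because of an asymmetry: a vertex hits every pair that contains it, whatever its
  type, so vertices of one type cannot be exchanged at the ends of a pair.

  Any accepted bit string yields a solution, so only completeness has to bound its length. One bit
  per type and one per branching suffice. Each branching enlarges the set of chosen ends, so there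
  are at most min(k, |C|) of them, and |C| \<le> 2t leads to 2t + 2^(4t^2) + 2t bits. The program is
  not given t and computes the number of trials from the types it has found.

  The lack of a multiplication shapes the program: row offsets of matrices are tabulated, and
  denominators are multiplied in bit by bit.\<close>

definition runs :: "com \<Rightarrow> state \<Rightarrow> nat \<Rightarrow> (state \<Rightarrow> bool) \<Rightarrow> bool" where
  "runs c s T Q \<longleftrightarrow> (\<exists>t s'. exec c s t s' \<and> t \<le> T \<and> Q s')"

primrec mods :: "com \<Rightarrow> string set" where
  "mods Skip = {}"
| "mods (Assign x a b) = {x}"
| "mods (Seq c1 c2) = mods c1 \<union> mods c2"
| "mods (If b c1 c2) = mods c1 \<union> mods c2"
| "mods (While b c) = mods c"

lemma exec_mods: "exec c s t s' \<Longrightarrow> x \<notin> mods c \<Longrightarrow> s' x = s x"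
  by (induction rule: exec.induct) auto

text \<open>Consequence and frame rule in one: arrays that \<open>c\<close> never assigns are
  carried over, so invariants need not mention them.\<close>

lemma runs_frame:
  assumes "runs c s T Q" "T \<le> T'"
    and "\<And>s'. Q s' \<Longrightarrow> (\<And>x. x \<notin> mods c \<Longrightarrow> s' x = s x) \<Longrightarrow> Q' s'"
  shows "runs c s T' Q'"
  using assms exec_mods unfolding runs_def by (meson le_trans)

lemma runs_Seq:
  assumes "runs c1 s T1 R" and "\<And>s'. R s' \<Longrightarrow> (\<And>x. x \<notin> mods c1 \<Longrightarrow> s' x = s x) \<Longrightarrow> runs c2 s' T2 Q"
    and "T1 + T2 \<le> T"
  shows "runs (Seq c1 c2) s T Q"
proof -
  from assms(1) obtain t1 s1 where 1: "exec c1 s t1 s1" "t1 \<le> T1" "R s1"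
    unfolding runs_def by blast
  with assms(2) exec_mods[OF 1(1)] have "runs c2 s1 T2 Q" by blast
  then obtain t2 s2 where 2: "exec c2 s1 t2 s2" "t2 \<le> T2" "Q s2"
    unfolding runs_def by blast
  have "exec (Seq c1 c2) s (t1 + t2) s2" using 1 2 by (blast intro: exec.Seq)
  moreover have "t1 + t2 \<le> T" using 1 2 assms(3) by linarith
  ultimately show ?thesis using 2 unfolding runs_def by blast
qed

primrec loop_free :: "com \<Rightarrow> bool" where
  "loop_free Skip = True"
| "loop_free (Assign x a b) = True"
| "loop_free (Seq c1 c2) = (loop_free c1 \<and> loop_free c2)"
| "loop_free (If b c1 c2) = (loop_free c1 \<and> loop_free c2)"
| "loop_free (While b c) = False"

text \<open>For loop-free programs the semantics is a function that the simplifier can evaluate. The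
  value at \<open>While\<close> is a dummy, as \<open>denot\<close> is applied to loop-free programs
  only.\<close>

primrec denot :: "com \<Rightarrow> state \<Rightarrow> state" where
  "denot Skip s = s"
| "denot (Assign x a b) s = s(x := (s x)(aval a s := aval b s))"
| "denot (Seq c1 c2) s = denot c2 (denot c1 s)"
| "denot (If b c1 c2) s = (if aval b s \<noteq> 0 then denot c1 s else denot c2 s)"
| "denot (While b c) s = s"

text \<open>Both branches of an \<open>If\<close> are added, so that the bound is a constant of the
  program and does not depend on the state.\<close>

primrec csize :: "com \<Rightarrow> nat" where
  "csize Skip = 1"
| "csize (Assign x a b) = 1 + acost a + acost b"
| "csize (Seq c1 c2) = csize c1 + csize c2"
| "csize (If b c1 c2) = 1 + acost b + csize c1 + csize c2"
| "csize (While b c) = 0"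

lemma loop_free_exec: "loop_free c \<Longrightarrow> \<exists>t. exec c s t (denot c s) \<and> t \<le> csize c"
proof (induction c arbitrary: s)
  case (Seq c1 c2)
  then obtain t1 t2 where 1: "exec c1 s t1 (denot c1 s)" "t1 \<le> csize c1"
    and 2: "exec c2 (denot c1 s) t2 (denot c2 (denot c1 s))" "t2 \<le> csize c2"
    by (metis loop_free.simps(3))
  have "exec (Seq c1 c2) s (t1 + t2) (denot c2 (denot c1 s))"
    using 1 2 by (blast intro: exec.Seq)
  then show ?case using 1 2 by (auto intro!: exI[of _ "t1 + t2"])
next
  case (If b c1 c2)
  then obtain t1 t2 where 1: "exec c1 s t1 (denot c1 s)" "t1 \<le> csize c1"
    and 2: "exec c2 s t2 (denot c2 s)" "t2 \<le> csize c2"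
    by (metis loop_free.simps(4))
  show ?case
  proof (cases "aval b s = 0")
    case True
    then have "exec (If b c1 c2) s (1 + acost b + t2) (denot c2 s)"
      using 2 by (blast intro: exec.IfFalse)
    then show ?thesis using True 2 by (auto intro!: exI[of _ "1 + acost b + t2"])
  next
    case False
    then have "exec (If b c1 c2) s (1 + acost b + t1) (denot c1 s)"
      using 1 by (blast intro: exec.IfTrue)
    then show ?thesis using False 1 by (auto intro!: exI[of _ "1 + acost b + t1"])
  qed
qed (auto intro: exec.intros)

lemma runs_denot:
  assumes "loop_free c" "Q (denot c s)" "csize c \<le> T"
  shows "runs c s T Q"
  using loop_free_exec[OF assms(1), of s] assms(2,3) le_trans unfolding runs_def by blast

abbreviation Var :: "string \<Rightarrow> aexp" where
  "Var x \<equiv> Cell x (N 0)"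

text \<open>Subtraction is truncated, so the guard is nonzero exactly while the counter is below the
  bound.\<close>

definition For :: "string \<Rightarrow> string \<Rightarrow> com \<Rightarrow> com" where
  "For i x c = Seq (Assign i (N 0) (N 0))
     (While (Minus (Var x) (Var i)) (Seq c (Assign i (N 0) (Plus (Var i) (N 1)))))"

lemma mods_For [simp]: "mods (For i x c) = insert i (mods c)"
  by (auto simp: For_def)

text \<open>The invariant is claimed after the counter has been increased, hence the update of
  \<open>i\<close> in the premise for the body. Per round, guard and increment cost 6 each, which
  gives 12; the initial assignment costs 3 and the last guard 6, which gives 9.\<close>

lemma runs_For:
  assumes fresh: "i \<notin> mods c" "x \<notin> mods c" "x \<noteq> i"
    and init: "I 0 (s(i := (s i)(0 := 0)))"
    and step: "\<And>j s'. j < s x 0 \<Longrightarrow> I j s' \<Longrightarrow> s' i 0 = j \<Longrightarrow>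
      (\<And>y. y \<noteq> i \<Longrightarrow> y \<notin> mods c \<Longrightarrow> s' y = s y) \<Longrightarrow>
      runs c s' T (\<lambda>s''. I (Suc j) (s''(i := (s'' i)(0 := Suc j))))"
    and post: "\<And>s'. I (s x 0) s' \<Longrightarrow> (\<And>y. y \<noteq> i \<Longrightarrow> y \<notin> mods c \<Longrightarrow> s' y = s y) \<Longrightarrow> Q s'"
    and time: "s x 0 * (T + 12) + 9 \<le> T'"
  shows "runs (For i x c) s T' Q"
proof -
  define b where "b = Minus (Var x) (Var i)"
  define c' where "c' = Seq c (Assign i (N 0) (Plus (Var i) (N 1)))"
  have loop: "\<exists>t r'. exec (While b c') r t r' \<and> t \<le> (s x 0 - j) * (T + 12) + 6 \<and>
      I (s x 0) r' \<and> (\<forall>y. y \<noteq> i \<longrightarrow> y \<notin> mods c \<longrightarrow> r' y = s y)"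
    if "j \<le> s x 0" "I j r" "r i 0 = j" "\<And>y. y \<noteq> i \<Longrightarrow> y \<notin> mods c \<Longrightarrow> r y = s y" for j r
    using that
  proof (induction "s x 0 - j" arbitrary: j r)
    case 0
    have "r x 0 = s x 0" using 0(5)[of x] fresh by simp
    with 0 have "aval b r = 0" "j = s x 0" by (simp_all add: b_def)
    then have "exec (While b c') r 6 r"
      using exec.WhileFalse[of b r c'] by (simp add: b_def numeral_eq_Suc)
    then show ?case using 0 \<open>j = s x 0\<close> by (intro exI[of _ 6] exI[of _ r]) auto
  next
    case (Suc m)
    have "r x 0 = s x 0" using Suc.prems(4)[of x] fresh by simp
    with Suc have b: "aval b r \<noteq> 0" "j < s x 0" by (simp_all add: b_def)
    from step[OF b(2) Suc.prems(2,3,4)] obtain t1 r1 where 1: "exec c r t1 r1" "t1 \<le> T"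
      "I (Suc j) (r1(i := (r1 i)(0 := Suc j)))"
      unfolding runs_def by blast
    have fr: "r1 y = r y" if "y \<notin> mods c" for y using exec_mods 1(1) that by blast
    define r2 where "r2 = r1(i := (r1 i)(0 := Suc j))"
    have "exec (Assign i (N 0) (Plus (Var i) (N 1))) r1 6 r2"
      using exec.Assign[of i "N 0" "Plus (Var i) (N 1)" r1] fr[OF fresh(1)] Suc.prems(3)
      by (simp add: r2_def numeral_eq_Suc)
    then have c': "exec c' r (t1 + 6) r2"
      unfolding c'_def using 1 exec.Seq by blast
    have "m = s x 0 - Suc j" using Suc.hyps(2) by simp
    moreover have "r2 y = s y" if "y \<noteq> i" "y \<notin> mods c" for y
      using that fr Suc.prems(4) by (simp add: r2_def numeral_eq_Suc)
    ultimately obtain t2 r3 where 3: "exec (While b c') r2 t2 r3"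
      "t2 \<le> (s x 0 - Suc j) * (T + 12) + 6" "I (s x 0) r3"
      "\<forall>y. y \<noteq> i \<longrightarrow> y \<notin> mods c \<longrightarrow> r3 y = s y"
      using Suc.hyps(1)[of "Suc j" r2] b(2) 1(3) by (auto simp: r2_def)
    have "exec (While b c') r (1 + acost b + (t1 + 6) + t2) r3"
      using exec.WhileTrue[OF b(1) c' 3(1)] .
    moreover have "s x 0 - j = Suc (s x 0 - Suc j)" using b(2) by simp
    then have "1 + acost b + (t1 + 6) + t2 \<le> (s x 0 - j) * (T + 12) + 6"
      using 1(2) 3(2) by (simp add: b_def algebra_simps)
    ultimately show ?case using 3 by blast
  qed
  define s0 where "s0 = s(i := (s i)(0 := 0))"
  have "exec (Assign i (N 0) (N 0)) s 3 s0"
    using exec.Assign[of i "N 0" "N 0" s] by (simp add: s0_def numeral_eq_Suc)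
  moreover obtain t r where r: "exec (While b c') s0 t r" "t \<le> s x 0 * (T + 12) + 6"
    "I (s x 0) r" "\<forall>y. y \<noteq> i \<longrightarrow> y \<notin> mods c \<longrightarrow> r y = s y"
    using loop[of 0 s0] init by (auto simp: s0_def)
  ultimately have "exec (For i x c) s (3 + t) r"
    unfolding For_def b_def c'_def using exec.Seq by blast
  moreover have "Q r" using post r by blast
  ultimately show ?thesis using r(2) time unfolding runs_def
    by (intro exI[of _ "3 + t"] exI[of _ r]) auto
qed

text \<open>Turns time bounds into plain powers of one number \<open>M\<close>: every loop raises
  the exponent by 2, and \<open>M \<ge> 100\<close> absorbs the constant 50 + 12 + 9 = 71.\<close>

lemma loop_time:
  fixes M :: nat
  assumes "m \<le> M" "100 \<le> M" "T \<le> 50 * M ^ a"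
  shows "m * (T + 12) + 9 \<le> M ^ (a + 2)"
proof -
  have "1 \<le> M ^ a" "1 \<le> M" using assms(2) by auto
  have "m * (T + 12) + 9 \<le> M * (50 * M ^ a + 12 * M ^ a) + 9 * (M * M ^ a)"
    using assms \<open>1 \<le> M ^ a\<close> \<open>1 \<le> M\<close>
    by (intro add_mono mult_mono) (auto simp: Suc_le_eq)
  also have "\<dots> = 71 * (M * M ^ a)" by (simp add: algebra_simps)
  also have "\<dots> \<le> M * (M * M ^ a)" using assms(2) by simp
  finally show ?thesis by (simp add: power_add power2_eq_square ac_simps)
qed

lemma add_time_le:
  fixes M :: nat
  assumes "100 \<le> M" "c \<le> 99"
  shows "c + M ^ a \<le> M ^ Suc a"
proof -
  have "c * 1 + M ^ a \<le> 99 * M ^ a + M ^ a"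
    using assms by (intro add_mono mult_mono) auto
  also have "\<dots> \<le> M * M ^ a" using assms by simp
  finally show ?thesis by simp
qed

lemmas runs_For_poly = runs_For[OF _ _ _ _ _ _ loop_time]

lemma runs_Seq_denot:
  assumes "loop_free c1" "runs c2 (denot c1 s) U Q" "csize c1 + U \<le> T"
  shows "runs (Seq c1 c2) s T Q"
proof (rule runs_Seq[where R = "\<lambda>s'. s' = denot c1 s"])
  show "runs c1 s (csize c1) (\<lambda>s'. s' = denot c1 s)"
    using assms(1) by (rule runs_denot) simp_all
qed (use assms in simp_all)

lemma runs_If:
  assumes "aval b s \<noteq> 0 \<Longrightarrow> runs c1 s T Q" "aval b s = 0 \<Longrightarrow> runs c2 s T Q" "1 + acost b + T \<le> T'"
  shows "runs (If b c1 c2) s T' Q"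
proof (cases "aval b s = 0")
  case True
  with assms(2) obtain t r where r: "exec c2 s t r" "t \<le> T" "Q r" unfolding runs_def by blast
  with True have "exec (If b c1 c2) s (1 + acost b + t) r" by (intro exec.IfFalse)
  then show ?thesis using r assms(3) unfolding runs_def by (meson add_le_mono le_refl le_trans)
next
  case False
  with assms(1) obtain t r where r: "exec c1 s t r" "t \<le> T" "Q r" unfolding runs_def by blast
  with False have "exec (If b c1 c2) s (1 + acost b + t) r" by (intro exec.IfTrue)
  then show ?thesis using r assms(3) unfolding runs_def by (meson add_le_mono le_refl le_trans)
qed

text \<open>For passes over a matrix: \<open>I a b\<close> is to say that the entries before
  \<open>(a, b)\<close> in row-major order are done. \<open>line\<close> moves from the end of a row
  to the start of the next, and \<open>indep\<close> lets the loops change their counters without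
  disturbing \<open>I\<close>.\<close>

lemma runs_For2:
  assumes fresh: "i \<notin> mods c" "j \<notin> mods c" "x \<notin> mods c" "x \<noteq> i" "x \<noteq> j" "i \<noteq> j"
    and indep: "\<And>a b s f. I a b s \<Longrightarrow> I a b (s(i := f))" "\<And>a b s f. I a b s \<Longrightarrow> I a b (s(j := f))"
    and init: "I 0 0 s"
    and line: "\<And>a s'. a < s x 0 \<Longrightarrow> I a (s x 0) s' \<Longrightarrow> I (Suc a) 0 s'"
    and step: "\<And>a b s'. a < s x 0 \<Longrightarrow> b < s x 0 \<Longrightarrow> I a b s' \<Longrightarrow> s' i 0 = a \<Longrightarrow> s' j 0 = b \<Longrightarrow>
      (\<And>y. y \<noteq> i \<Longrightarrow> y \<noteq> j \<Longrightarrow> y \<notin> mods c \<Longrightarrow> s' y = s y) \<Longrightarrow> runs c s' T (I a (Suc b))"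
    and post: "\<And>s'. I (s x 0) 0 s' \<Longrightarrow> (\<And>y. y \<noteq> i \<Longrightarrow> y \<noteq> j \<Longrightarrow> y \<notin> mods c \<Longrightarrow> s' y = s y) \<Longrightarrow> Q s'"
    and time: "s x 0 \<le> M" "100 \<le> M" "T \<le> 50 * M ^ l"
  shows "runs (For i x (For j x c)) s (M ^ (l + 4)) Q"
proof (rule runs_For[where I = "\<lambda>a. I a 0" and T = "M ^ (l + 2)"])
  show "i \<notin> mods (For j x c)" "x \<notin> mods (For j x c)" "x \<noteq> i" "I 0 0 (s(i := (s i)(0 := 0)))"
    using fresh indep init by simp_all
  show "s x 0 * (M ^ (l + 2) + 12) + 9 \<le> M ^ (l + 4)"
    using loop_time[OF time(1,2), of "M ^ (l + 2)" "l + 2"] by (simp only: add.commute add.left_commute) simp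
  show "Q s'" if "I (s x 0) 0 s'" "\<And>y. y \<noteq> i \<Longrightarrow> y \<notin> mods (For j x c) \<Longrightarrow> s' y = s y" for s'
    using that by (intro post) simp_all
next
  fix a s'
  assume a: "a < s x 0" "I a 0 s'" "s' i 0 = a"
    and fr: "\<And>y. y \<noteq> i \<Longrightarrow> y \<notin> mods (For j x c) \<Longrightarrow> s' y = s y"
  have x: "s' x = s x" using fr fresh by simp
  show "runs (For j x c) s' (M ^ (l + 2))
    (\<lambda>s''. I (Suc a) 0 (s''(i := (s'' i)(0 := Suc a))))"
  proof (rule runs_For_poly[where I = "I a"])
    show "s' x 0 \<le> M" "100 \<le> M" "T \<le> 50 * M ^ l" using time x by simp_all
    show "runs c s'' T (\<lambda>r. I a (Suc b) (r(j := (r j)(0 := Suc b))))"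
      if "b < s' x 0" "I a b s''" "s'' j 0 = b" "\<And>y. y \<noteq> j \<Longrightarrow> y \<notin> mods c \<Longrightarrow> s'' y = s' y" for b s''
    proof (rule runs_frame[OF step order_refl])
      show "a < s x 0" "b < s x 0" "I a b s''" "s'' i 0 = a" "s'' j 0 = b"
        using a that x fresh by simp_all
      show "s'' y = s y" if "y \<noteq> i" "y \<noteq> j" "y \<notin> mods c" for y
        using that fr \<open>\<And>y. y \<noteq> j \<Longrightarrow> y \<notin> mods c \<Longrightarrow> s'' y = s' y\<close> by simp
    qed (rule indep)
  qed (use fresh indep a x line in simp_all)
qed

section \<open>Shortest path matrices\<close>

text \<open>The textbook recursion with a fresh matrix for every \<open>k\<close>. The program
  updates a single matrix in place and is compared with this recursion later.\<close>

fun fw :: "(nat \<Rightarrow> nat \<Rightarrow> nat) \<Rightarrow> nat \<Rightarrow> nat \<Rightarrow> nat \<Rightarrow> nat" where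
  "fw w 0 i j = w i j"
| "fw w (Suc k) i j = min (fw w k i j) (fw w k i k + fw w k k j)"

lemma fw_diag: "(\<And>i. w i i = 0) \<Longrightarrow> fw w k i i = 0"
  by (induction k) auto

lemma fw_sym:
  assumes "\<And>i j. i < n \<Longrightarrow> j < n \<Longrightarrow> w i j = w j i" "k \<le> n" "i < n" "j < n"
  shows "fw w k i j = fw w k j i"
  using assms(2-)
proof (induction k arbitrary: i j)
  case 0
  then show ?case using assms(1) by simp
next
  case (Suc k)
  then have "fw w k i j = fw w k j i" "fw w k i k = fw w k k i" "fw w k k j = fw w k j k" by simp_all
  then show ?case by (simp add: add.commute)
qed

lemma fw_antimono: "k \<le> l \<Longrightarrow> fw w l i j \<le> fw w k i j"
  by (induction rule: dec_induct) auto

text \<open>Induction on the recursion, without paths: for \<open>m = k\<close> the detour through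
  \<open>k\<close> is one of the arguments of \<open>min\<close>, and for smaller \<open>m\<close>
  the claims for \<open>(i, j)\<close>, \<open>(i, k)\<close> and \<open>(k, j)\<close>
  combine.\<close>

lemma fw_triangle:
  assumes diag: "\<And>i. w i i = 0" and "m < k"
  shows "fw w k i j \<le> fw w k i m + fw w k m j"
  using assms(2)
proof (induction k arbitrary: i j m)
  case (Suc k)
  show ?case
  proof (cases "m = k")
    case True
    then show ?thesis using fw_diag[of w k k, OF diag] by (simp add: min_def)
  next
    case False
    then have "fw w k i j \<le> fw w k i m + fw w k m j" "fw w k i k \<le> fw w k i m + fw w k m k"
      "fw w k k j \<le> fw w k k m + fw w k m j"
      using Suc by simp_all
    then show ?thesis by (simp add: min_def)
  qed
qed simp

text \<open>A value made by a detour through \<open>k\<close> ends with the piece from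
  \<open>k\<close> to \<open>j\<close>, so the last edge of that piece can be taken. Values from
  \<open>B\<close> on stand for missing connections. The sum is formed in the final matrix, where
  the triangle inequality holds for all \<open>x < n\<close>.\<close>

lemma fw_last_edge:
  assumes diag: "\<And>i. w i i = 0"
    and edge: "\<And>i j. i < n \<Longrightarrow> j < n \<Longrightarrow> i \<noteq> j \<Longrightarrow> w i j < B \<Longrightarrow> E i j"
    and "k \<le> n" "i < n" "j < n" "i \<noteq> j" "fw w k i j < B"
  shows "\<exists>x<n. E x j \<and> fw w n i x + fw w n x j \<le> fw w k i j"
  using assms(3-)
proof (induction k arbitrary: i j)
  case 0
  have "fw w n i i + fw w n i j \<le> w i j"
    using fw_diag[of w n i, OF diag] fw_antimono[of 0 n w i j] by simp
  then show ?case using 0 edge[of i j] by (intro exI[of _ i]) auto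
next
  case (Suc k)
  show ?case
  proof (cases "fw w k i j \<le> fw w k i k + fw w k k j")
    case True
    then show ?thesis using Suc by (simp add: min_def)
  next
    case False
    then have eq: "fw w (Suc k) i j = fw w k i k + fw w k k j" by simp
    have "k \<noteq> j" using False fw_diag[of w k k, OF diag] by auto
    moreover have "fw w k k j < B" using eq Suc.prems by simp
    ultimately obtain x where x: "x < n" "E x j" "fw w n k x + fw w n x j \<le> fw w k k j"
      using Suc.IH[of k j] Suc.prems by auto
    have "fw w n i x \<le> fw w n i k + fw w n k x"
      using Suc.prems by (intro fw_triangle diag) simp
    moreover have "fw w n i k \<le> fw w k i k" using Suc.prems by (intro fw_antimono) simp
    ultimately show ?thesis using x eq by (intro exI[of _ x]) simp
  qed
qed

section \<open>The search\<close>

text \<open>The disjunct \<open>i = j\<close> makes every cover vertex a class of its own and keeps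
  the relation reflexive.\<close>

definition same_type :: "nat set \<Rightarrow> (nat \<Rightarrow> nat \<Rightarrow> nat) \<Rightarrow> nat \<Rightarrow> nat \<Rightarrow> bool" where
  "same_type C d i j \<longleftrightarrow> i = j \<or> (i \<notin> C \<and> j \<notin> C \<and>
     (\<forall>x\<in>C. \<forall>y\<in>C. d x i + d i y = d x y \<longleftrightarrow> d x j + d j y = d x y))"

text \<open>Naming a class by its least member turns a set of classes into a set of vertices, which
  fits into a 0/1 array.\<close>

definition rep :: "nat set \<Rightarrow> (nat \<Rightarrow> nat \<Rightarrow> nat) \<Rightarrow> nat \<Rightarrow> nat" where
  "rep C d i = (LEAST r. same_type C d i r)"

definition reps :: "nat set \<Rightarrow> (nat \<Rightarrow> nat \<Rightarrow> nat) \<Rightarrow> nat \<Rightarrow> nat set" where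
  "reps C d n = {i. i < n \<and> rep C d i = i}"

lemma same_type_refl: "same_type C d i i"
  and same_type_sym: "same_type C d i j \<Longrightarrow> same_type C d j i"
  and same_type_trans: "same_type C d i j \<Longrightarrow> same_type C d j l \<Longrightarrow> same_type C d i l"
  by (auto simp: same_type_def)

lemma same_type_rep: "same_type C d i (rep C d i)"
  unfolding rep_def by (rule LeastI) (rule same_type_refl)

lemma rep_le: "rep C d i \<le> i"
  unfolding rep_def by (rule Least_le) (rule same_type_refl)

lemma rep_eq_iff: "rep C d i = rep C d j \<longleftrightarrow> same_type C d i j"
proof
  assume "rep C d i = rep C d j"
  then show "same_type C d i j"
    by (metis same_type_rep same_type_sym same_type_trans)
next
  assume "same_type C d i j"
  then have "same_type C d i r \<longleftrightarrow> same_type C d j r" for r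
    using same_type_sym same_type_trans by blast
  then show "rep C d i = rep C d j" by (simp add: rep_def)
qed

lemma rep_rep [simp]: "rep C d (rep C d i) = rep C d i"
  by (simp add: rep_eq_iff same_type_rep same_type_sym)

lemma rep_in_reps: "i < n \<Longrightarrow> rep C d i \<in> reps C d n"
  using rep_le[of C d i] by (simp add: reps_def)

lemma finite_reps [simp]: "finite (reps C d n)"
  by (simp add: reps_def)

text \<open>Outside \<open>C\<close>, a representative is determined by the pairs of cover vertices
  between which it lies, a subset of \<open>C \<times> C\<close>. Those inside \<open>C\<close> are
  counted one by one.\<close>

lemma card_reps_le:
  assumes "finite C"
  shows "card (reps C d n) \<le> card C + 2 ^ (card C * card C)"
proof -
  define f where "f i = {(x, y) \<in> C \<times> C. d x i + d i y = d x y}" for i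
  have "inj_on f (reps C d n - C)"
  proof (rule inj_onI)
    fix i j assume ij: "i \<in> reps C d n - C" "j \<in> reps C d n - C" "f i = f j"
    then have "same_type C d i j" by (auto simp: same_type_def f_def set_eq_iff)
    then have "rep C d i = rep C d j" by (simp add: rep_eq_iff)
    with ij show "i = j" by (simp add: reps_def)
  qed
  moreover have "f ` (reps C d n - C) \<subseteq> Pow (C \<times> C)" by (auto simp: f_def)
  ultimately have "card (reps C d n - C) \<le> card (Pow (C \<times> C))"
    using assms by (meson card_inj_on_le finite_Pow_iff finite_SigmaI)
  moreover have "card (reps C d n) \<le> card (C \<union> (reps C d n - C))"
    using assms by (intro card_mono) auto
  moreover have "\<dots> \<le> card C + card (reps C d n - C)" by (rule card_Un_le)
  ultimately show ?thesis using assms by (simp add: card_Pow card_cartesian_product)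
qed

text \<open>
  A token \<open>r \<in> Z\<close> stands for some chosen vertex with representative \<open>r\<close>. As it is not known which
  one, a token counts only for inner vertices of a path.
\<close>

definition token_hit :: "nat set \<Rightarrow> (nat \<Rightarrow> nat \<Rightarrow> nat) \<Rightarrow> nat \<Rightarrow> nat set \<Rightarrow> nat \<Rightarrow> nat \<Rightarrow> bool" where
  "token_hit C d n Z u v \<longleftrightarrow>
     (\<exists>w<n. w \<noteq> u \<and> w \<noteq> v \<and> d u w + d w v = d u v \<and> rep C d w \<in> Z)"

text \<open>The bits of a number encode the nondeterministic choices, the next one being the lowest.\<close>

definition token_step :: "nat set \<Rightarrow> (nat \<Rightarrow> nat \<Rightarrow> nat) \<Rightarrow> nat \<Rightarrow> nat set \<times> nat \<Rightarrow> nat set \<times> nat" where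
  "token_step C d i = (\<lambda>(Z, h).
     if rep C d i = i then (if odd h then insert i Z else Z, h div 2) else (Z, h))"

text \<open>A bit is consumed only when neither end is in \<open>X\<close>, so each consumed bit
  makes \<open>X\<close> strictly larger. This bounds the number of bits by the budget.\<close>

definition branch_step ::
  "nat set \<Rightarrow> (nat \<Rightarrow> nat \<Rightarrow> nat) \<Rightarrow> nat \<Rightarrow> nat set \<Rightarrow> nat \<times> nat \<Rightarrow> nat set \<times> nat \<Rightarrow> nat set \<times> nat" where
  "branch_step C d n Z = (\<lambda>(u, v) (X, h).
     if token_hit C d n Z u v \<or> u \<in> X \<or> v \<in> X then (X, h)
     else (insert (if odd h then v else u) X, h div 2))"

definition tokens :: "nat set \<Rightarrow> (nat \<Rightarrow> nat \<Rightarrow> nat) \<Rightarrow> nat \<Rightarrow> nat \<Rightarrow> nat set \<times> nat" where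
  "tokens C d n g = fold (token_step C d) [0..<n] ({}, g)"

definition accepts :: "nat set \<Rightarrow> (nat \<Rightarrow> nat \<Rightarrow> nat) \<Rightarrow> nat \<Rightarrow> (nat \<times> nat) list \<Rightarrow> nat \<Rightarrow> nat \<Rightarrow> bool" where
  "accepts C d n ts b g =
     (let (Z, h) = tokens C d n g; X = fst (fold (branch_step C d n Z) ts ({}, h))
      in card X + card (Z - rep C d ` X) \<le> b)"

lemma fold_token_step_subset:
  "fst (fold (token_step C d) xs (Z, g)) \<subseteq> Z \<union> {i \<in> set xs. rep C d i = i}"
proof (induction xs arbitrary: Z g)
  case (Cons i xs)
  show ?case
    using Cons.IH[of "fst (token_step C d i (Z, g))" "snd (token_step C d i (Z, g))"]
    by (auto simp: token_step_def split: if_splits)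
qed simp

lemma tokens_subset: "fst (tokens C d n g) \<subseteq> reps C d n"
  using fold_token_step_subset[of C d "[0..<n]" "{}" g] by (auto simp: tokens_def reps_def)

text \<open>The guess is composed backwards: \<open>h\<close> is what the tokens leave over for the
  branching, and each representative in the list puts one more bit below it.\<close>

lemma fold_token_step_complete:
  assumes "h < B" "distinct xs"
  shows "\<exists>g < 2 ^ card {i \<in> set xs. rep C d i = i} * B.
    fold (token_step C d) xs (Z, g) = (Z \<union> {i \<in> set xs. rep C d i = i \<and> i \<in> T}, h)"
  using assms(2)
proof (induction xs arbitrary: Z)
  case Nil
  then show ?case using assms(1) by auto
next
  case (Cons i xs)
  let ?R = "{i \<in> set xs. rep C d i = i}"
  let ?Z = "if rep C d i = i \<and> i \<in> T then insert i Z else Z"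
  obtain g where g: "g < 2 ^ card ?R * B"
    "fold (token_step C d) xs (?Z, g) = (?Z \<union> {i \<in> set xs. rep C d i = i \<and> i \<in> T}, h)"
    using Cons.IH[of ?Z] Cons.prems by auto
  have Z: "?Z \<union> {i \<in> set xs. rep C d i = i \<and> i \<in> T}
      = Z \<union> {j \<in> set (i # xs). rep C d j = j \<and> j \<in> T}" by auto
  show ?case
  proof (cases "rep C d i = i")
    case False
    then have "{j \<in> set (i # xs). rep C d j = j} = ?R" by auto
    moreover have "token_step C d i (Z, g) = (?Z, g)" using False by (simp add: token_step_def)
    ultimately show ?thesis using g Z by (intro exI[of _ g]) simp
  next
    case True
    then have "{j \<in> set (i # xs). rep C d j = j} = insert i ?R" by auto
    then have card: "card {j \<in> set (i # xs). rep C d j = j} = Suc (card ?R)"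
      using Cons.prems by simp
    define g' where "g' = 2 * g + (if i \<in> T then 1 else 0)"
    have "token_step C d i (Z, g') = (?Z, g)" using True by (simp add: token_step_def g'_def)
    moreover have "g' < 2 ^ Suc (card ?R) * B" using g(1) by (simp add: g'_def)
    ultimately show ?thesis using g(2) Z card by (intro exI[of _ g']) auto
  qed
qed

text \<open>All that the search has to know about the graph. \<open>E\<close> is adjacency, values
  of \<open>d\<close> from \<open>B\<close> on mean infinite distance, and
  \<open>d_last_edge\<close> takes the place of shortest paths.\<close>

locale hitting =
  fixes n :: nat and d :: "nat \<Rightarrow> nat \<Rightarrow> nat" and E :: "nat \<Rightarrow> nat \<Rightarrow> bool" and B :: nat
    and C :: "nat set" and ts :: "(nat \<times> nat) list"
  assumes d_diag: "d i i = 0"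
    and d_sym: "i < n \<Longrightarrow> j < n \<Longrightarrow> d i j = d j i"
    and d_triangle: "x < n \<Longrightarrow> d i j \<le> d i x + d x j"
    and d_last_edge: "i < n \<Longrightarrow> j < n \<Longrightarrow> i \<noteq> j \<Longrightarrow> d i j < B \<Longrightarrow> \<exists>x<n. E x j \<and> d i x + d x j \<le> d i j"
    and C_subset: "C \<subseteq> {..<n}"
    and C_cover: "x < n \<Longrightarrow> y < n \<Longrightarrow> E x y \<Longrightarrow> x \<in> C \<or> y \<in> C"
    and ts_valid: "(u, v) \<in> set ts \<Longrightarrow> u < n \<and> v < n \<and> u \<noteq> v \<and> d u v < B"
begin

definition hits :: "nat set \<Rightarrow> nat \<Rightarrow> nat \<Rightarrow> bool" where
  "hits S u v \<longleftrightarrow> (\<exists>w\<in>S. d u w + d w v = d u v)"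

definition solvable :: "nat \<Rightarrow> bool" where
  "solvable b \<longleftrightarrow> (\<exists>S \<subseteq> {..<n}. card S \<le> b \<and> (\<forall>(u, v) \<in> set ts. hits S u v))"

text \<open>Let \<open>x\<close> be the predecessor of \<open>v\<close> on a shortest path from
  \<open>u\<close>. The cover contains \<open>x\<close> or \<open>v\<close>, and both lie on that
  path.\<close>

lemma C_hits: "(u, v) \<in> set ts \<Longrightarrow> hits C u v"
proof -
  assume "(u, v) \<in> set ts"
  with ts_valid have uv: "u < n" "v < n" "u \<noteq> v" "d u v < B" by auto
  then obtain x where x: "x < n" "E x v" "d u x + d x v \<le> d u v" using d_last_edge by blast
  then have "d u x + d x v = d u v" using d_triangle[of x u v] by simp
  moreover have "d u v + d v v = d u v" by (simp add: d_diag)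
  ultimately show ?thesis using C_cover[OF x(1) uv(2) x(2)] unfolding hits_def by blast
qed

text \<open>Keeps the number of branching bits within the parameter, although the budget in the
  input may be arbitrarily large.\<close>

lemma solvable_min: "solvable (min b (card C)) \<longleftrightarrow> solvable b"
proof (cases "b \<le> card C")
  case False
  have "\<forall>(u, v) \<in> set ts. hits C u v" using C_hits by blast
  then have "solvable b'" if "card C \<le> b'" for b'
    unfolding solvable_def using C_subset that by blast
  then have "solvable b" "solvable (card C)" using False by simp_all
  then show ?thesis by (simp add: min_def)
qed (simp add: min_def)

text \<open>The neighbours of \<open>w\<close> on a shortest path lie in the cover, so only the type of \<open>w\<close> matters.\<close>

lemma same_type_hits:
  assumes uv: "u < n" "v < n" "d u v < B" and w: "w < n" "w \<noteq> u" "w \<noteq> v" "d u w + d w v = d u v"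
    and w': "w' < n" "same_type C d w w'"
  shows "hits {w'} u v"
\<comment> \<open>The case \<open>w = w'\<close> is trivial, and an end of a pair always hits it,
  because the diagonal is zero.\<close>
proof (cases "w = w' \<or> w' = u \<or> w' = v")
  case True
  then show ?thesis using w by (auto simp: hits_def d_diag)
next
  case False
  then have nC: "w \<notin> C" "w' \<notin> C"
    and ty: "\<And>x y. x \<in> C \<Longrightarrow> y \<in> C \<Longrightarrow> d x w + d w y = d x y \<longleftrightarrow> d x w' + d w' y = d x y"
    using w'(2) by (auto simp: same_type_def)
  \<comment> \<open>\<open>x\<close> and \<open>y\<close> are the neighbours of \<open>w\<close>
    towards \<open>u\<close> and towards \<open>v\<close>. As \<open>w\<close> is not in
    \<open>C\<close>, the cover contains both.\<close>
  obtain x where x: "x < n" "E x w" "d u x + d x w \<le> d u w"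
    using d_last_edge[of u w] w uv by auto
  obtain y where y: "y < n" "E y w" "d v y + d y w \<le> d v w"
    using d_last_edge[of v w] w uv d_sym[of w v] by auto
  have C: "x \<in> C" "y \<in> C" using C_cover w(1) x y nC by blast+
  \<comment> \<open>The way from \<open>u\<close> over \<open>x\<close>, \<open>w\<close> and
    \<open>y\<close> to \<open>v\<close> has length \<open>d u v\<close>, so none of the triangle
    inequalities along it can be strict.\<close>
  have "d u v \<le> d u x + d x v" "d x v \<le> d x y + d y v" "d x y \<le> d x w + d w y"
    using d_triangle w x y by simp_all
  moreover have "d v y = d y v" "d y w = d w y" "d v w = d w v" using d_sym uv w y by simp_all
  ultimately have "d x w + d w y = d x y" "d u x + d x y + d y v = d u v"
    using x y w(4) by linarith+
  then have "d x w' + d w' y = d x y" using ty C by blast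
  moreover have "d u w' \<le> d u x + d x w'" "d w' v \<le> d w' y + d y v" "d u v \<le> d u w' + d w' v"
    using d_triangle x y w' by simp_all
  ultimately have "d u w' + d w' v = d u v" using \<open>d u x + d x y + d y v = d u v\<close> by linarith
  then show ?thesis by (simp add: hits_def)
qed

text \<open>Let a pair be hit neither by a token nor by \<open>X\<close>. An inner vertex of
  \<open>S\<close> on it would have provided a token, so an end of the pair lies in
  \<open>S\<close>, and the next bit points to it. Each bit moves one vertex of \<open>S\<close>
  into \<open>X\<close>, which explains the exponent.\<close>

lemma fold_branch_step_complete:
  assumes "set us \<subseteq> set ts" "finite S" "X \<subseteq> S"
    and "\<And>u v. (u, v) \<in> set us \<Longrightarrow> hits S u v" "S \<subseteq> {..<n}"
  shows "\<exists>h < 2 ^ card (S - X). fst (fold (branch_step C d n (rep C d ` S)) us (X, h)) \<subseteq> S"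
  using assms(1,3,4)
proof (induction us arbitrary: X)
  case (Cons p us)
  obtain u v where p: "p = (u, v)" by fastforce
  let ?Z = "rep C d ` S"
  show ?case
  proof (cases "token_hit C d n ?Z u v \<or> u \<in> X \<or> v \<in> X")
    case True
    then show ?thesis using Cons p by (auto simp: branch_step_def)
  next
    case False
    obtain w where w: "w \<in> S" "d u w + d w v = d u v"
      using Cons.prems(3)[of u v] p by (auto simp: hits_def)
    then have "w < n" using assms(5) by blast
    with False w have wuv: "w = u \<or> w = v" by (auto simp: token_hit_def)
    with False have "w \<notin> X" by auto
    obtain h where h: "h < 2 ^ card (S - insert w X)"
      "fst (fold (branch_step C d n ?Z) us (insert w X, h)) \<subseteq> S"
      using Cons.IH[of "insert w X"] Cons.prems w(1) by auto
    define h' where "h' = 2 * h + (if w = v then 1 else 0)"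
    have "branch_step C d n ?Z p (X, h') = (insert w X, h)"
      using False p wuv by (auto simp: branch_step_def h'_def)
    moreover have "S - X = insert w (S - insert w X)" using \<open>w \<notin> X\<close> w(1) by blast
    then have "card (S - X) = Suc (card (S - insert w X))"
      using assms(2) by (metis Diff_iff card_insert_disjoint finite_Diff insertI1)
    then have "h' < 2 ^ card (S - X)" using h(1) unfolding h'_def by auto
    ultimately show ?thesis using h(2) by (intro exI[of _ h']) simp
  qed
qed (auto intro: exI[of _ 0])

lemma fold_branch_step_sound:
  assumes "set us \<subseteq> set ts" "fold (branch_step C d n Z) us (X, h) = (X', h')"
  shows "X \<subseteq> X'" "X' \<subseteq> X \<union> (fst ` set us \<union> snd ` set us)"
    "\<And>u v. (u, v) \<in> set us \<Longrightarrow> token_hit C d n Z u v \<or> u \<in> X' \<or> v \<in> X'"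
proof -
  have "X \<subseteq> X' \<and> X' \<subseteq> X \<union> (fst ` set us \<union> snd ` set us) \<and>
    (\<forall>(u, v) \<in> set us. token_hit C d n Z u v \<or> u \<in> X' \<or> v \<in> X')"
    using assms
  proof (induction us arbitrary: X h)
    case (Cons p us)
    obtain u v where p: "p = (u, v)" by fastforce
    obtain X1 h1 where 1: "branch_step C d n Z p (X, h) = (X1, h1)" by fastforce
    then have "X \<subseteq> X1" "X1 \<subseteq> X \<union> {u, v}" "token_hit C d n Z u v \<or> u \<in> X1 \<or> v \<in> X1"
      by (auto simp: p branch_step_def split: if_splits)
    moreover have "X1 \<subseteq> X'" "X' \<subseteq> X1 \<union> (fst ` set us \<union> snd ` set us)"
      "\<forall>(u, v) \<in> set us. token_hit C d n Z u v \<or> u \<in> X' \<or> v \<in> X'"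
      using Cons.IH[of X1 h1] Cons.prems 1 by simp_all
    ultimately show ?case unfolding p by auto
  qed simp
  then show "X \<subseteq> X'" "X' \<subseteq> X \<union> (fst ` set us \<union> snd ` set us)"
    "\<And>u v. (u, v) \<in> set us \<Longrightarrow> token_hit C d n Z u v \<or> u \<in> X' \<or> v \<in> X'"
    by blast+
qed

lemma accepts_sound:
  assumes "accepts C d n ts b g"
  shows "solvable b"
proof -
  obtain Z h where Z: "tokens C d n g = (Z, h)" by fastforce
  obtain X h' where X: "fold (branch_step C d n Z) ts ({}, h) = (X, h')" by fastforce
  \<comment> \<open>A token that no chosen end accounts for is redeemed by the representative
    itself; any vertex of its class would do.\<close>
  define S where "S = X \<union> (Z - rep C d ` X)"
  have ZR: "Z \<subseteq> reps C d n" using tokens_subset[of C d n g] Z by simp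
  have Xn: "X \<subseteq> {..<n}"
    using fold_branch_step_sound(2)[OF subset_refl X] ts_valid by fastforce
  have "card S \<le> card X + card (Z - rep C d ` X)" unfolding S_def by (rule card_Un_le)
  then have "card S \<le> b" using assms Z X by (simp add: accepts_def)
  moreover have "S \<subseteq> {..<n}" using Xn ZR by (auto simp: S_def reps_def)
  moreover have "hits S u v" if uv: "(u, v) \<in> set ts" for u v
  proof (cases "u \<in> X \<or> v \<in> X")
    case True
    moreover have "d u u + d u v = d u v" "d u v + d v v = d u v" by (simp_all add: d_diag)
    ultimately show ?thesis unfolding hits_def S_def by blast
  next
    case False
    then have "token_hit C d n Z u v" using fold_branch_step_sound(3)[OF subset_refl X uv] by blast
    then obtain w where w: "w < n" "w \<noteq> u" "w \<noteq> v" "d u w + d w v = d u v" "rep C d w \<in> Z"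
      by (auto simp: token_hit_def)
    \<comment> \<open>The class of the inner vertex \<open>w\<close> has a member in
      \<open>S\<close>: either a chosen end or the representative.\<close>
    obtain s where s: "s \<in> S" "rep C d s = rep C d w"
    proof (cases "rep C d w \<in> rep C d ` X")
      case True
      then obtain x where "x \<in> X" "rep C d w = rep C d x" by blast
      then show ?thesis using that[of x] by (simp add: S_def)
    next
      case False
      then show ?thesis using that[of "rep C d w"] w(5) by (simp add: S_def)
    qed
    have "same_type C d w s" using s(2) by (metis rep_eq_iff)
    moreover have "s < n" using s(1) \<open>S \<subseteq> {..<n}\<close> by blast
    ultimately have "hits {s} u v" using same_type_hits w ts_valid[OF uv] by blast
    then show ?thesis using s(1) by (auto simp: hits_def)
  qed
  ultimately show ?thesis unfolding solvable_def by blast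
qed

lemma accepts_complete:
  assumes "solvable b"
  shows "\<exists>g < 2 ^ (card (reps C d n) + b). accepts C d n ts b g"
proof -
  obtain S where S: "S \<subseteq> {..<n}" "card S \<le> b" "\<And>u v. (u, v) \<in> set ts \<Longrightarrow> hits S u v"
    using assms unfolding solvable_def by blast
  have fin: "finite S" using S(1) finite_subset by blast
  \<comment> \<open>The right guess for the tokens consists of all classes that \<open>S\<close>
    meets.\<close>
  let ?Z = "rep C d ` S"
  obtain h where h: "h < 2 ^ card S" "fst (fold (branch_step C d n ?Z) ts ({}, h)) \<subseteq> S"
    using fold_branch_step_complete[of ts S "{}"] S fin by auto
  have "(2::nat) ^ card S \<le> 2 ^ b" using S(2) by (simp add: power_increasing)
  with h(1) have "h < 2 ^ b" by linarith
  have R: "{i \<in> set [0..<n]. rep C d i = i} = reps C d n" by (auto simp: reps_def)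
  have Z: "{} \<union> {i \<in> set [0..<n]. rep C d i = i \<and> i \<in> ?Z} = ?Z"
    using S(1) rep_in_reps[of _ n C d] by (auto simp: reps_def)
  obtain g where g: "g < 2 ^ card (reps C d n) * 2 ^ b" "tokens C d n g = (?Z, h)"
    using fold_token_step_complete[OF \<open>h < 2 ^ b\<close> distinct_upt[of 0 n], of C d "{}" ?Z]
    unfolding R Z tokens_def by blast
  define X where "X = fst (fold (branch_step C d n ?Z) ts ({}, h))"
  have "X \<subseteq> S" using h(2) by (simp add: X_def)
  \<comment> \<open>A class that is left over belongs to some vertex of \<open>S - X\<close>, so the
    extra vertices cost no more than \<open>S\<close> itself does.\<close>
  have "card (?Z - rep C d ` X) \<le> card (rep C d ` (S - X))"
    using fin by (intro card_mono) auto
  also have "\<dots> \<le> card (S - X)" using fin by (intro card_image_le) auto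
  also have "\<dots> = card S - card X" using \<open>X \<subseteq> S\<close> fin by (simp add: card_Diff_subset finite_subset)
  finally have "card X + card (?Z - rep C d ` X) \<le> b"
    using S(2) card_mono[OF fin \<open>X \<subseteq> S\<close>] by linarith
  then have "accepts C d n ts b g" using g(2) by (simp add: accepts_def X_def)
  then show ?thesis using g(1) by (auto simp: power_add)
qed

theorem solvable_iff_accepts:
  "solvable b \<longleftrightarrow> (\<exists>g < 2 ^ (card (reps C d n) + min b (card C)). accepts C d n ts (min b (card C)) g)"
  using accepts_sound accepts_complete solvable_min by blast

end

section \<open>The program\<close>

abbreviation "Set x a \<equiv> Assign x (N 0) a"
abbreviation "Neq a b \<equiv> Plus (Minus a b) (Minus b a)"
abbreviation "Entry x i j \<equiv> Cell x (Plus (Cell ''row'' i) j)"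

text \<open>The multiples of \<open>n\<close> are tabulated in \<open>row\<close> by repeated
  addition, so that \<open>row[n]\<close> is \<open>n * n\<close>. Cell 0 of \<open>in\<close> holds
  the length of the list and cells 1 to 3 the header; hence the matrix starts at 4 and the terminal
  pairs at \<open>off\<close>.\<close>

definition prepare :: com where
  "prepare =
    Seq (Set ''n'' (Cell ''in'' (N 1)))
    (Seq (Set ''m'' (Cell ''in'' (N 3)))
    (Seq (For ''i'' ''n''
       (Assign ''row'' (Plus (Var ''i'') (N 1)) (Plus (Cell ''row'' (Var ''i'')) (Var ''n''))))
    (Seq (Set ''nn'' (Cell ''row'' (Var ''n'')))
         (Set ''off'' (Plus (N 4) (Plus (Var ''nn'') (Var ''nn'')))))))"

text \<open>Shift-and-add multiplication; the condition of the inner \<open>If\<close> is the lowest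
  bit of \<open>mc\<close>.\<close>

definition multiply :: com where
  "multiply =
    While (Var ''mc'')
      (Seq (If (Minus (Var ''mc'') (Plus (Half (Var ''mc'')) (Half (Var ''mc''))))
             (Set ''mr'' (Plus (Var ''mr'') (Var ''ma''))) Skip)
      (Seq (Set ''ma'' (Plus (Var ''ma'') (Var ''ma'')))
           (Set ''mc'' (Half (Var ''mc'')))))"

text \<open>A fraction times the product of all denominators is its numerator times the other
  denominators. Leaving out the factor for \<open>q = p\<close> thus avoids a division.\<close>

definition scale_step :: com where
  "scale_step = If (Neq (Var ''p'') (Var ''q''))
     (Seq (Set ''ma'' (Cell ''w'' (Var ''p'')))
     (Seq (Set ''mc'' (Cell ''in'' (Plus (N 5) (Plus (Var ''q'') (Var ''q'')))))
     (Seq (Set ''mr'' (N 0))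
     (Seq multiply
          (Assign ''w'' (Var ''p'') (Var ''mr''))))))
     Skip"

definition scale :: com where
  "scale = For ''p'' ''nn''
    (Seq (Assign ''w'' (Var ''p'') (Cell ''in'' (Plus (N 4) (Plus (Var ''p'') (Var ''p'')))))
         (For ''q'' ''nn'' scale_step))"

definition sum_weights :: com where
  "sum_weights = Seq (Set ''big'' (N 1))
     (For ''p'' ''nn'' (Set ''big'' (Plus (Var ''big'') (Cell ''w'' (Var ''p'')))))"

lemma mods_multiply [simp]: "mods multiply = {''ma'', ''mc'', ''mr''}"
  by (auto simp: multiply_def)

lemma mods_scale_step [simp]: "mods scale_step = {''w'', ''ma'', ''mc'', ''mr''}"
  by (auto simp: scale_step_def)

lemma mods_prepare [simp]: "mods prepare = {''n'', ''m'', ''i'', ''row'', ''nn'', ''off''}"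
  by (auto simp: prepare_def)

lemma mods_scale [simp]: "mods scale = {''p'', ''q'', ''w'', ''ma'', ''mc'', ''mr''}"
  by (auto simp: scale_def)

text \<open>Strong induction on the multiplier, which loses one bit per round. A round takes at most
  31 steps for the body and 3 for the guard.\<close>

lemma runs_multiply:
  "runs multiply s (40 * floorlog 2 (s ''mc'' 0) + 40)
     (\<lambda>s'. s' ''mr'' 0 = s ''mr'' 0 + s ''ma'' 0 * s ''mc'' 0)"
proof (induction "s ''mc'' 0" arbitrary: s rule: less_induct)
  case less
  define c where "c = s ''mc'' 0"
  define body where "body =
      (Seq (If (Minus (Var ''mc'') (Plus (Half (Var ''mc'')) (Half (Var ''mc''))))
             (Set ''mr'' (Plus (Var ''mr'') (Var ''ma''))) Skip)
      (Seq (Set ''ma'' (Plus (Var ''ma'') (Var ''ma'')))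
           (Set ''mc'' (Half (Var ''mc'')))))"
  have mult: "multiply = While (Var ''mc'') body" by (simp add: multiply_def body_def)
  show ?case
  proof (cases "c = 0")
    case True
    then have "exec multiply s (1 + acost (Var ''mc'')) s"
      unfolding mult by (intro exec.WhileFalse) (simp add: c_def)
    then show ?thesis using True unfolding runs_def c_def
      by (intro exI[of _ "1 + acost (Var ''mc'')"] exI[of _ s]) simp
  next
    case False
    obtain t1 where 1: "exec body s t1 (denot body s)" "t1 \<le> csize body"
      using loop_free_exec[of body s] by (auto simp: body_def)
    define s1 where "s1 = denot body s"
    have s1: "s1 ''mc'' 0 = c div 2" "s1 ''ma'' 0 = 2 * s ''ma'' 0"
      "s1 ''mr'' 0 = s ''mr'' 0 + (c mod 2) * s ''ma'' 0"
      by (auto simp: s1_def body_def c_def) presburger+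
    have "s1 ''mc'' 0 < s ''mc'' 0" using s1(1) False by (simp add: c_def)
    from less[of s1, OF this] obtain t2 s2 where 2: "exec multiply s1 t2 s2"
      "t2 \<le> 40 * floorlog 2 (c div 2) + 40"
      "s2 ''mr'' 0 = s1 ''mr'' 0 + s1 ''ma'' 0 * s1 ''mc'' 0"
      unfolding runs_def s1(1) by blast
    have "exec multiply s (1 + acost (Var ''mc'') + t1 + t2) s2"
      using 1(1) 2(1) False unfolding mult s1_def
      by (intro exec.WhileTrue) (simp_all add: c_def)
    moreover have "floorlog 2 c = floorlog 2 (c div 2) + 1"
      using False compute_floorlog[of 2 c] by simp
    then have "1 + acost (Var ''mc'') + t1 + t2 \<le> 40 * floorlog 2 c + 40"
      using 1(2) 2(2) by (simp add: body_def)
    moreover have "s2 ''mr'' 0 = s ''mr'' 0 + s ''ma'' 0 * c"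
    proof -
      have "s ''ma'' 0 * c = s ''ma'' 0 * (c mod 2 + 2 * (c div 2))" by simp
      also have "\<dots> = c mod 2 * s ''ma'' 0 + 2 * s ''ma'' 0 * (c div 2)"
        by (simp only: distrib_left distrib_right mult_ac)
      finally show ?thesis using 2(3) by (simp only: s1 add.assoc)
    qed
    ultimately show ?thesis unfolding runs_def c_def by blast
  qed
qed

text \<open>\<open>M\<close> bounds at once all quantities that drive the running time. The
  denominators are the multipliers, and the time for a product depends on the bits of its
  multiplier; additions have unit cost.\<close>

locale input =
  fixes inp :: "nat \<Rightarrow> nat" and M :: nat
  assumes M: "100 \<le> M" "inp 1 * inp 1 \<le> M" "inp 3 \<le> M"
    and bits: "p < inp 1 * inp 1 \<Longrightarrow> floorlog 2 (inp (5 + 2 * p)) \<le> M"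
begin

definition n where "n = inp 1"
definition m where "m = inp 3"
definition num where "num p = inp (4 + 2 * p)"
definition den where "den p = inp (5 + 2 * p)"
definition pairs where
  "pairs = map (\<lambda>q. (inp (4 + 2 * (n * n) + 2 * q), inp (5 + 2 * (n * n) + 2 * q))) [0..<m]"
definition weights where "weights p = num p * (\<Prod>q\<in>{..<n * n} - {p}. den q)"
text \<open>\<open>big\<close> exceeds the length of every path and represents an infinite distance.\<close>

definition big where "big = 1 + (\<Sum>p<n * n. weights p)"
definition edge where "edge i j = weights (i * n + j)"
definition edge0 where "edge0 i j = (if i = j then 0 else if edge i j = 0 then big else edge i j)"
definition dist where "dist = fw edge0 n"

lemma M_le: "n * n \<le> M" "n \<le> M" "m \<le> M"
proof -
  show "n * n \<le> M" "m \<le> M" using M by (simp_all add: n_def m_def)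
  then show "n \<le> M" using le_square[of n] le_trans by blast
qed

definition base :: "state \<Rightarrow> bool" where
  "base s \<longleftrightarrow> s ''in'' = inp \<and> s ''n'' 0 = n \<and> s ''m'' 0 = m \<and> s ''nn'' 0 = n * n \<and>
     s ''off'' 0 = 4 + 2 * (n * n) \<and> (\<forall>i\<le>n. s ''row'' i = i * n)"

lemma base_cong:
  assumes "base s" "\<And>y. y \<in> {''in'', ''n'', ''m'', ''nn'', ''off'', ''row''} \<Longrightarrow> s' y = s y"
  shows "base s'"
  using assms by (simp add: base_def)

lemma runs_prepare:
  assumes "s ''in'' = inp" "s ''row'' 0 = 0"
  shows "runs prepare s (M ^ 3) base"
  unfolding prepare_def
proof (rule runs_Seq_denot[where U = "M ^ 2 + 54"], simp, rule runs_Seq_denot[where U = "M ^ 2 + 50"],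
    simp, rule runs_Seq)
  let ?s = "denot (Set ''m'' (Cell ''in'' (N 3))) (denot (Set ''n'' (Cell ''in'' (N 1))) s)"
  let ?loop = "For ''i'' ''n''
       (Assign ''row'' (Plus (Var ''i'') (N 1)) (Plus (Cell ''row'' (Var ''i'')) (Var ''n'')))"
  show "runs ?loop ?s (M ^ (0 + 2)) (\<lambda>s. \<forall>i\<le>n. s ''row'' i = i * n)"
  proof (rule runs_For_poly[where I = "\<lambda>j s. \<forall>i\<le>j. s ''row'' i = i * n" and T = 50 and M = M], goal_cases)
    case (5 j s')
    have "s' ''n'' 0 = n" using 5(4)[of "''n''"] assms(1) by (simp add: n_def)
    then show ?case using 5(2,3) by (intro runs_denot) (simp_all add: le_Suc_eq)
  next
    case (6 s')
    then show ?case using assms(1) by (simp add: n_def)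
  qed (use assms M_le M(1) in \<open>simp_all add: n_def\<close>)
  show "runs (Seq (Set ''nn'' (Cell ''row'' (Var ''n'')))
         (Set ''off'' (Plus (N 4) (Plus (Var ''nn'') (Var ''nn''))))) r 50 base"
    if "\<forall>i\<le>n. r ''row'' i = i * n" "\<And>y. y \<notin> mods ?loop \<Longrightarrow> r y = ?s y" for r
    using that assms by (intro runs_denot) (auto simp: base_def n_def m_def)
qed (use add_time_le[of M 58 2, OF M(1)] in \<open>simp_all add: power3_eq_cube power2_eq_square mult.assoc\<close>)

lemma runs_scale_step:
  assumes "base s" "s ''p'' 0 = p" "s ''q'' 0 = q" "p < n * n" "q < n * n"
  shows "runs scale_step s (50 * M) (\<lambda>s'. s' ''w'' = (if p = q then s ''w'' else
    (s ''w'')(p := s ''w'' p * den q)))"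
proof -
  have q: "inp (5 + 2 * q) = den q" "floorlog 2 (den q) \<le> M" "s ''in'' = inp"
    using assms(1,5) bits by (simp_all add: base_def den_def n_def)
  have "runs (Seq multiply (Assign ''w'' (Var ''p'') (Var ''mr''))) r (40 * floorlog 2 (r ''mc'' 0) + 50)
    (\<lambda>s'. s' ''w'' = (r ''w'')(r ''p'' 0 := r ''mr'' 0 + r ''ma'' 0 * r ''mc'' 0))" for r
    by (rule runs_Seq[OF runs_multiply runs_denot[OF _ _ order_refl]]) simp_all
  note mult = runs_frame[OF this]
  show ?thesis
    unfolding scale_step_def
  proof (rule runs_If)
    show "1 + acost (Neq (Var ''p'') (Var ''q'')) + (50 * M - 20) \<le> 50 * M" using M by simp
  next
    assume "aval (Neq (Var ''p'') (Var ''q'')) s \<noteq> 0"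
    then have "p \<noteq> q" using assms by auto
    show "runs (Seq (Set ''ma'' (Cell ''w'' (Var ''p'')))
     (Seq (Set ''mc'' (Cell ''in'' (Plus (N 5) (Plus (Var ''q'') (Var ''q'')))))
     (Seq (Set ''mr'' (N 0))
     (Seq multiply (Assign ''w'' (Var ''p'') (Var ''mr'')))))) s (50 * M - 20) (\<lambda>s'. s' ''w'' = (if p = q then s ''w'' else
    (s ''w'')(p := s ''w'' p * den q)))"
      by (rule runs_Seq_denot[where U = "44 * M"], simp, rule runs_Seq_denot[where U = "43 * M"], simp,
          rule runs_Seq_denot[where U = "42 * M"], simp, rule mult)
        (use M q assms \<open>p \<noteq> q\<close> in \<open>simp_all add: mult_2[symmetric]\<close>)
  next
    assume "aval (Neq (Var ''p'') (Var ''q'')) s = 0"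
    then have "p = q" using assms by auto
    then show "runs Skip s (50 * M - 20) (\<lambda>s'. s' ''w'' = (if p = q then s ''w'' else
      (s ''w'')(p := s ''w'' p * den q)))"
      using M by (intro runs_denot) simp_all
  qed
qed

lemma runs_scale:
  assumes "base s"
  shows "runs scale s (M ^ 6) (\<lambda>s'. \<forall>p < n * n. s' ''w'' p = weights p)"
proof -
  have nn: "s ''nn'' 0 = n * n" using assms by (simp add: base_def)
  \<comment> \<open>Invariant of the inner loop: the numerator times the denominators met so
    far.\<close>
  define partial where "partial p j = num p * (\<Prod>q\<in>{..<j} - {p}. den q)" for p j
  have partial_Suc: "partial p (Suc j) = (if p = j then partial p j else partial p j * den j)" for p j
  proof (cases "p = j")
    case True
    then show ?thesis by (simp add: partial_def lessThan_Suc)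
  next
    case False
    then have "{..<Suc j} - {p} = insert j ({..<j} - {p})" by auto
    then show ?thesis using False by (simp add: partial_def ac_simps)
  qed
  have row: "runs (Seq (Assign ''w'' (Var ''p'') (Cell ''in'' (Plus (N 4) (Plus (Var ''p'') (Var ''p'')))))
         (For ''q'' ''nn'' scale_step)) r (M ^ 4)
      (\<lambda>s'. s' ''w'' = (r ''w'')(p := weights p))"
    if r: "base r" "r ''p'' 0 = p" "p < n * n" for r p
  proof (rule runs_Seq_denot, simp)
    let ?r = "denot (Assign ''w'' (Var ''p'') (Cell ''in'' (Plus (N 4) (Plus (Var ''p'') (Var ''p''))))) r"
    have br: "base ?r" using r(1) by (rule base_cong) auto
    have q: "r ''in'' = inp" "r ''nn'' 0 = n * n" using r(1) by (simp_all add: base_def)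
    show "runs (For ''q'' ''nn'' scale_step) ?r (M ^ (1 + 2))
       (\<lambda>s'. s' ''w'' = (r ''w'')(p := weights p))"
    proof (rule runs_For_poly[where I = "\<lambda>j s'. s' ''w'' = (r ''w'')(p := partial p j)" and T = "50 * M"])
      show "runs scale_step s' (50 * M) (\<lambda>s''. (s''(''q'' := (s'' ''q'')(0 := Suc j))) ''w'' = (r ''w'')(p := partial p (Suc j)))"
        if j: "j < ?r ''nn'' 0" "s' ''w'' = (r ''w'')(p := partial p j)" "s' ''q'' 0 = j"
          "\<And>y. y \<noteq> ''q'' \<Longrightarrow> y \<notin> mods scale_step \<Longrightarrow> s' y = ?r y" for j s'
      proof -
        have fr: "s' y = r y" if "y \<in> {''in'', ''n'', ''m'', ''nn'', ''off'', ''row'', ''p''}" for y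
          using j(4)[of y] that by auto
        have "base s'" using r(1) by (rule base_cong) (rule fr, blast)
        moreover have "s' ''p'' 0 = p" using fr[of "''p''"] r by simp
        moreover have "j < n * n" using j(1) q by simp
        ultimately have "runs scale_step s' (50 * M) (\<lambda>s''. s'' ''w'' = (if p = j then s' ''w'' else
          (s' ''w'')(p := s' ''w'' p * den j)))"
          using j(3) r(3) by (intro runs_scale_step)
        then show ?thesis
          by (rule runs_frame) (use j(2) partial_Suc[of p j] in simp_all)
      qed
    next
      show "?r ''nn'' 0 \<le> M" "100 \<le> M" "50 * M \<le> 50 * M ^ 1" using q M M_le by simp_all
      show "(?r(''q'' := (?r ''q'')(0 := 0))) ''w'' = (r ''w'')(p := partial p 0)"
        using q r by (simp add: partial_def num_def mult_2[symmetric])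
      show "s' ''w'' = (r ''w'')(p := weights p)"
        if "s' ''w'' = (r ''w'')(p := partial p (?r ''nn'' 0))" for s'
        using that q by (simp add: partial_def weights_def)
    qed simp_all
  next
    show "csize (Assign ''w'' (Var ''p'') (Cell ''in'' (Plus (N 4) (Plus (Var ''p'') (Var ''p'')))))
        + M ^ (1 + 2) \<le> M ^ 4"
      using add_time_le[of M 11 3, OF M(1)] by (simp add: eval_nat_numeral)
  qed
  show ?thesis unfolding scale_def
  proof (rule runs_For[where I = "\<lambda>j s'. \<forall>p<j. s' ''w'' p = weights p" and T = "M ^ 4"])
    show "s ''nn'' 0 * (M ^ 4 + 12) + 9 \<le> M ^ 6"
      using loop_time[of "n * n" M "M ^ 4" 4] nn M M_le by simp
  next
    fix j s'
    assume j: "j < s ''nn'' 0" "\<forall>p<j. s' ''w'' p = weights p" "s' ''p'' 0 = j"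
      and fr: "\<And>y. y \<noteq> ''p'' \<Longrightarrow> y \<notin> mods (Seq (Assign ''w'' (Var ''p'') (Cell ''in'' (Plus (N 4) (Plus (Var ''p'') (Var ''p'')))))
         (For ''q'' ''nn'' scale_step)) \<Longrightarrow> s' y = s y"
    have "base s'" using assms by (rule base_cong) (rule fr, auto)
    moreover have "j < n * n" using j nn by simp
    ultimately show "runs (Seq (Assign ''w'' (Var ''p'') (Cell ''in'' (Plus (N 4) (Plus (Var ''p'') (Var ''p'')))))
         (For ''q'' ''nn'' scale_step)) s' (M ^ 4)
       (\<lambda>s''. \<forall>p<Suc j. (s''(''p'' := (s'' ''p'')(0 := Suc j))) ''w'' p = weights p)"
      by (intro runs_frame[OF row[of s' j, OF _ j(3)] order_refl]) (use j(2) in \<open>simp_all add: less_Suc_eq\<close>)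
  qed (simp_all add: nn)
qed

lemma runs_sum_weights:
  assumes "base s" "\<forall>p < n * n. s ''w'' p = weights p"
  shows "runs sum_weights s (M ^ 3) (\<lambda>s'. s' ''big'' 0 = big)"
proof -
  have nn: "s ''nn'' 0 = n * n" using assms by (simp add: base_def)
  show ?thesis unfolding sum_weights_def
  proof (rule runs_Seq_denot[where U = "M ^ (0 + 2)"])
    show "runs (For ''p'' ''nn'' (Set ''big'' (Plus (Var ''big'') (Cell ''w'' (Var ''p'')))))
      (denot (Set ''big'' (N 1)) s) (M ^ (0 + 2)) (\<lambda>s'. s' ''big'' 0 = big)"
    proof (rule runs_For_poly[where I = "\<lambda>j s'. s' ''big'' 0 = 1 + (\<Sum>p<j. weights p)" and T = 50 and M = M], goal_cases)
      case (5 j s')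
      have "s' ''w'' j = weights j" using 5(1) 5(4)[of "''w''"] nn assms(2) by simp
      then show ?case using 5(2,3) by (intro runs_denot) simp_all
    next
      case (6 s')
      then show ?case using nn by (simp add: big_def)
    qed (use nn M M_le in simp_all)
    show "csize (Set ''big'' (N 1)) + M ^ (0 + 2) \<le> M ^ 3"
      using add_time_le[of M 3 2, OF M(1)] by (simp add: eval_nat_numeral)
  qed simp
qed

end

text \<open>Quotient and remainder by \<open>n\<close> recover the two indices, so writing one
  matrix entry leaves all others alone.\<close>

lemma index_eq_iff:
  fixes n :: nat
  assumes "j < n" "j' < n"
  shows "i * n + j = i' * n + j' \<longleftrightarrow> i = i' \<and> j = j'"
proof -
  have "(i * n + j) div n = i" "(i * n + j) mod n = j"
    "(i' * n + j') div n = i'" "(i' * n + j') mod n = j'"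
    using assms by simp_all
  then show ?thesis by metis
qed

lemma index_less: "i < (n::nat) \<Longrightarrow> j < n \<Longrightarrow> i * n + j < n * n"
  using mult_le_mono1[of "Suc i" n n] by simp

section \<open>Distance matrix and greedy vertex cover\<close>

abbreviation "Put x i j a \<equiv> Assign x (Plus (Cell ''row'' i) j) a"

definition init_dist :: com where
  "init_dist = For ''i'' ''n'' (For ''j'' ''n''
     (If (Neq (Var ''i'') (Var ''j''))
        (If (Entry ''w'' (Var ''i'') (Var ''j''))
           (Put ''d'' (Var ''i'') (Var ''j'') (Entry ''w'' (Var ''i'') (Var ''j'')))
           (Put ''d'' (Var ''i'') (Var ''j'') (Var ''big'')))
        (Put ''d'' (Var ''i'') (Var ''j'') (N 0))))"

definition relax :: com where
  "relax = If (Minus (Entry ''d'' (Var ''i'') (Var ''j''))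
       (Plus (Entry ''d'' (Var ''i'') (Var ''k'')) (Entry ''d'' (Var ''k'') (Var ''j''))))
     (Put ''d'' (Var ''i'') (Var ''j'')
        (Plus (Entry ''d'' (Var ''i'') (Var ''k'')) (Entry ''d'' (Var ''k'') (Var ''j''))))
     Skip"

definition floyd_warshall :: com where
  "floyd_warshall = For ''k'' ''n'' (For ''i'' ''n'' (For ''j'' ''n'' relax))"

definition match_edges :: com where
  "match_edges = For ''i'' ''n'' (For ''j'' ''n''
     (If (Entry ''w'' (Var ''i'') (Var ''j''))
       (If (Plus (Cell ''c'' (Var ''i'')) (Cell ''c'' (Var ''j''))) Skip
         (Seq (Assign ''c'' (Var ''i'') (N 1))
         (Seq (Assign ''c'' (Var ''j'') (N 1))
              (Set ''cc'' (Plus (Var ''cc'') (N 2))))))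
       Skip))"

lemma mods_init_dist [simp]: "mods init_dist = {''i'', ''j'', ''d''}"
  by (auto simp: init_dist_def)

lemma mods_relax [simp]: "mods relax = {''d''}"
  by (auto simp: relax_def)

lemma mods_floyd_warshall [simp]: "mods floyd_warshall = {''i'', ''j'', ''k'', ''d''}"
  by (auto simp: floyd_warshall_def)

lemma mods_match_edges [simp]: "mods match_edges = {''i'', ''j'', ''c'', ''cc''}"
  by (auto simp: match_edges_def)

context input
begin

definition matrix :: "(nat \<Rightarrow> nat) \<Rightarrow> (nat \<Rightarrow> nat \<Rightarrow> nat) \<Rightarrow> bool" where
  "matrix a f \<longleftrightarrow> (\<forall>i<n. \<forall>j<n. a (i * n + j) = f i j)"

lemma base_simps:
  assumes "base s"
  shows "s ''in'' = inp" "s ''n'' 0 = n" "s ''m'' 0 = m" "s ''nn'' 0 = n * n"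
    "s ''off'' 0 = 4 + 2 * (n * n)" "i \<le> n \<Longrightarrow> s ''row'' i = i * n"
  using assms by (simp_all add: base_def)

lemma runs_init_dist:
  assumes "base s" "matrix (s ''w'') edge" "s ''big'' 0 = big"
  shows "runs init_dist s (M ^ 5) (\<lambda>s'. matrix (s' ''d'') edge0)"
proof -
  have "runs init_dist s (M ^ (1 + 4)) (\<lambda>s'. matrix (s' ''d'') edge0)"
    unfolding init_dist_def
  proof (rule runs_For2[where T = "50 * M" and I = "\<lambda>a b s'. \<forall>i<n. \<forall>j<n. i < a \<or> i = a \<and> j < b \<longrightarrow>
      s' ''d'' (i * n + j) = edge0 i j"], goal_cases)
    case (11 a b s')
    have "base s'" using assms(1) by (rule base_cong) (rule 11(6), auto)
    note bs = base_simps[OF this] base_simps[OF assms(1)]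
    have ab: "a < n" "b < n" using 11(1,2) bs by simp_all
    have fr: "s' ''w'' (a * n + b) = edge a b" "s' ''big'' 0 = big"
      using 11(6)[of "''w''"] 11(6)[of "''big''"] assms(2,3) ab by (simp_all add: matrix_def)
    show ?case
      by (rule runs_denot)
        (use 11(3,4,5) bs ab fr M(1) in \<open>auto simp: less_Suc_eq index_eq_iff edge0_def\<close>)
  qed (use base_simps[OF assms(1)] M(1) M_le in \<open>auto simp: matrix_def less_Suc_eq\<close>)
  then show ?thesis by simp
qed

lemma edge0_diag: "edge0 i i = 0" by (simp add: edge0_def)

text \<open>The matrix is overwritten in place, so in round \<open>k\<close> some of the entries
  that are read may already be new. Exact values are therefore not tracked: each entry stays between
  the final \<open>dist\<close> and the value of the recursion, and after the last round the two
  bounds agree.\<close>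

lemma runs_floyd_warshall:
  assumes "base s" "matrix (s ''d'') edge0"
  shows "runs floyd_warshall s (M ^ 7) (\<lambda>s'. matrix (s' ''d'') dist)"
proof -
  define inv where "inv = (\<lambda>k a b s'. \<forall>i<n. \<forall>j<n. dist i j \<le> s' ''d'' (i * n + j) \<and>
    s' ''d'' (i * n + j) \<le> fw edge0 k i j \<and>
    (i < a \<or> i = a \<and> j < b \<longrightarrow> s' ''d'' (i * n + j) \<le> fw edge0 (Suc k) i j))"
  \<comment> \<open>Preserves the lower bound: a sum of two entries is at least the sum of their
    final distances.\<close>
  have tri: "dist i j \<le> dist i k + dist k j" if "k < n" for i j k
    unfolding dist_def using that by (intro fw_triangle edge0_diag)
  have phase: "runs (For ''i'' ''n'' (For ''j'' ''n'' relax)) r (M ^ (1 + 4)) (inv (Suc k) 0 0)"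
    if r: "base r" "inv k 0 0 r" "r ''k'' 0 = k" "k < n" for r k
  proof (rule runs_For2[where T = "50 * M" and I = "inv k"], goal_cases)
    case (11 a b s')
    have "base s'" using r(1) by (rule base_cong) (rule 11(6), auto)
    note bs = base_simps[OF this] base_simps[OF r(1)]
    have ab: "a < n" "b < n" using 11(1,2) bs by simp_all
    have k: "s' ''k'' 0 = k" using 11(6)[of "''k''"] r(3) by simp
    define D where "D i j = s' ''d'' (i * n + j)" for i j
    have D: "dist i j \<le> D i j" "D i j \<le> fw edge0 k i j"
      "i < a \<or> i = a \<and> j < b \<Longrightarrow> D i j \<le> fw edge0 (Suc k) i j" if "i < n" "j < n" for i j
      using 11(3) that unfolding inv_def D_def by blast+
    define x where "x = min (D a b) (D a k + D k b)"
    have x: "dist a b \<le> x" "x \<le> D a b" "x \<le> fw edge0 (Suc k) a b"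
      using D[of a b] D[of a k] D[of k b] tri[of k a b] r(4) ab by (auto simp: x_def)
    have "denot relax s' ''d'' = (s' ''d'')(a * n + b := x)"
      using 11(4,5) bs ab k r(4) by (auto simp: relax_def x_def D_def min_def)
    then have new: "denot relax s' ''d'' (i * n + j) = (if i = a \<and> j = b then x else D i j)"
      if "i < n" "j < n" for i j
      using that ab by (auto simp: index_eq_iff D_def)
    have "inv k a (Suc b) (denot relax s')" unfolding inv_def
    proof (intro allI impI)
      fix i j assume ij: "i < n" "j < n"
      show "dist i j \<le> denot relax s' ''d'' (i * n + j) \<and>
        denot relax s' ''d'' (i * n + j) \<le> fw edge0 k i j \<and>
        (i < a \<or> i = a \<and> j < Suc b \<longrightarrow> denot relax s' ''d'' (i * n + j) \<le> fw edge0 (Suc k) i j)"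
      proof (cases "i = a \<and> j = b")
        case True
        then show ?thesis using x D(2)[OF ab] new[OF ij] by auto
      next
        case False
        then show ?thesis using D[OF ij] new[OF ij] by (auto simp: less_Suc_eq)
      qed
    qed
    then show ?case by (rule runs_denot[rotated]) (use M(1) in \<open>simp_all add: relax_def\<close>)
  next
    case (10 a s')
    then show ?case using base_simps[OF r(1)] unfolding inv_def by (metis less_Suc_eq not_less0)
  next
    case (12 s')
    then show ?case using base_simps[OF r(1)] unfolding inv_def by (metis not_less0)
  qed (use r base_simps[OF r(1)] M(1) M_le in \<open>auto simp: inv_def\<close>)
  have "runs floyd_warshall s (M ^ (5 + 2)) (\<lambda>s'. matrix (s' ''d'') dist)"
    unfolding floyd_warshall_def
  proof (rule runs_For_poly[where I = "\<lambda>k. inv k 0 0" and T = "M ^ 5"], goal_cases)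
    case 4
    have "dist i j \<le> edge0 i j" for i j
      using fw_antimono[of 0 n edge0 i j] by (simp add: dist_def)
    then show ?case using assms by (simp add: inv_def matrix_def)
  next
    case (5 k s')
    have "base s'" using assms(1) by (rule base_cong) (rule 5(4), auto)
    have "runs (For ''i'' ''n'' (For ''j'' ''n'' relax)) s' (M ^ 5) (inv (Suc k) 0 0)"
      using phase[OF \<open>base s'\<close> 5(2,3)] 5(1) base_simps[OF assms(1)] by simp
    then show ?case by (rule runs_frame) (simp_all add: inv_def)
  next
    case (6 s')
    then show ?case using base_simps[OF assms(1)]
      by (auto simp: inv_def matrix_def dist_def intro: antisym)
  qed (use base_simps[OF assms(1)] M(1) M_le in auto)
  then show ?thesis by simp
qed

definition cover :: "nat set \<Rightarrow> bool" where
  "cover X \<longleftrightarrow> (\<forall>i<n. \<forall>j<n. edge i j \<noteq> 0 \<longrightarrow> i \<in> X \<or> j \<in> X)"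

definition small_cover :: "nat set \<Rightarrow> bool" where
  "small_cover X \<longleftrightarrow> X \<subseteq> {..<n} \<and> cover X \<and> (\<forall>Y \<subseteq> {..<n}. cover Y \<longrightarrow> card X \<le> 2 * card Y)"

lemma runs_match_edges:
  assumes "base s" "matrix (s ''w'') edge" "s ''c'' = (\<lambda>_. 0)" "s ''cc'' 0 = 0"
    and loop_free: "\<And>i. i < n \<Longrightarrow> edge i i = 0"
  shows "runs match_edges s (M ^ 5)
    (\<lambda>s'. \<exists>X. small_cover X \<and> s' ''c'' = (\<lambda>i. of_bool (i \<in> X)) \<and> s' ''cc'' 0 = card X)"
proof -
  \<comment> \<open>The bound compares \<open>X\<close> with \<open>X \<inter> Y\<close> to make it
    inductive: a new edge adds two vertices to \<open>X\<close> and, since \<open>Y\<close> covers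
    the edge, at least one to the intersection.\<close>
  define good where "good = (\<lambda>a b s' X. s' ''c'' = (\<lambda>i. of_bool (i \<in> X)) \<and> s' ''cc'' 0 = card X \<and>
    X \<subseteq> {..<n} \<and> (\<forall>i<n. \<forall>j<n. i < a \<or> i = a \<and> j < b \<longrightarrow> edge i j \<noteq> 0 \<longrightarrow> i \<in> X \<or> j \<in> X) \<and>
    (\<forall>Y. cover Y \<longrightarrow> card X \<le> 2 * card (X \<inter> Y)))"
  have "runs match_edges s (M ^ (1 + 4))
    (\<lambda>s'. \<exists>X. small_cover X \<and> s' ''c'' = (\<lambda>i. of_bool (i \<in> X)) \<and> s' ''cc'' 0 = card X)"
    unfolding match_edges_def
  proof (rule runs_For2[where T = "50 * M" and I = "\<lambda>a b s'. \<exists>X. good a b s' X"], goal_cases)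
    case 9
    have "good 0 0 s {}" using assms by (simp add: good_def)
    then show ?case by blast
  next
    case (10 a s')
    then obtain X where "good a n s' X" using base_simps[OF assms(1)] by auto
    then have "good (Suc a) 0 s' X" unfolding good_def by (metis less_Suc_eq not_less0)
    then show ?case by blast
  next
    case (12 s')
    then obtain X where X: "good n 0 s' X" using base_simps[OF assms(1)] by auto
    have "card X \<le> 2 * card Y" if Y: "Y \<subseteq> {..<n}" "cover Y" for Y
    proof -
      have "card (X \<inter> Y) \<le> card Y" using Y(1) finite_subset by (intro card_mono) blast+
      then show ?thesis using X Y unfolding good_def by (meson le_trans mult_le_mono2)
    qed
    then have "small_cover X" using X unfolding good_def small_cover_def cover_def by blast
    then show ?case using X unfolding good_def by blast
  next
    case (11 a b s')
    then obtain X where X: "good a b s' X" by blast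
    have "base s'" using assms(1) by (rule base_cong) (rule 11(6), auto)
    note bs = base_simps[OF this] base_simps[OF assms(1)]
    have ab: "a < n" "b < n" using 11(1,2) bs by simp_all
    have w: "s' ''w'' (a * n + b) = edge a b"
      using 11(6)[of "''w''"] assms(2) ab by (simp add: matrix_def)
    have fin: "finite X" using X finite_subset unfolding good_def by blast
    let ?body = "If (Entry ''w'' (Var ''i'') (Var ''j''))
       (If (Plus (Cell ''c'' (Var ''i'')) (Cell ''c'' (Var ''j''))) Skip
         (Seq (Assign ''c'' (Var ''i'') (N 1))
         (Seq (Assign ''c'' (Var ''j'') (N 1))
              (Set ''cc'' (Plus (Var ''cc'') (N 2))))))
       Skip"
    show ?case
    proof (cases "edge a b \<noteq> 0 \<and> a \<notin> X \<and> b \<notin> X")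
      case False
      have "denot ?body s' = s'"
        using False X 11(4,5) bs ab w by (auto simp: good_def)
      moreover have "good a (Suc b) s' X" using X False by (auto simp: good_def less_Suc_eq)
      ultimately have "\<exists>X. good a (Suc b) (denot ?body s') X" by metis
      then show ?thesis by (rule runs_denot[rotated]) (use M(1) in simp_all)
    next
      case True
      \<comment> \<open>There are no loops, so adding 2 to \<open>cc\<close> counts the new vertices
        correctly.\<close>
      then have "a \<noteq> b" using loop_free ab by auto
      have "good a (Suc b) (denot ?body s') (insert a (insert b X))"
      proof -
        have "denot ?body s' ''c'' = (\<lambda>i. of_bool (i \<in> insert a (insert b X)))"
          "denot ?body s' ''cc'' 0 = card X + 2"
          using True X 11(4,5) bs ab w by (auto simp: good_def fun_eq_iff)
        moreover have "card (insert a (insert b X)) = card X + 2"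
          using fin True \<open>a \<noteq> b\<close> by simp
        moreover have "card X + 2 \<le> 2 * card (insert a (insert b X) \<inter> Y)" if cY: "cover Y" for Y
        proof -
          obtain z where z: "z \<in> Y" "z \<in> {a, b}" using cY True ab unfolding cover_def by blast
          have "card (insert z (X \<inter> Y)) \<le> card (insert a (insert b X) \<inter> Y)"
            using fin z by (intro card_mono) auto
          moreover have "card (insert z (X \<inter> Y)) = Suc (card (X \<inter> Y))"
            using fin z True by auto
          ultimately show ?thesis using X cY unfolding good_def by force
        qed
        ultimately show ?thesis using X ab unfolding good_def by (auto simp: less_Suc_eq)
      qed
      then have "\<exists>X. good a (Suc b) (denot ?body s') X" by blast
      then show ?thesis by (rule runs_denot[rotated]) (use M(1) in simp_all)
    qed
  qed (use base_simps[OF assms(1)] M(1) M_le in \<open>auto simp: good_def\<close>)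
  then show ?thesis by simp
qed

end

section \<open>Classes of equal type and the number of guesses\<close>

definition compare :: com where
  "compare =
    Seq (Set ''ne'' (Plus (Cell ''c'' (Var ''v'')) (Cell ''c'' (Var ''r''))))
    (For ''i'' ''n'' (For ''j'' ''n''
      (If (Cell ''c'' (Var ''i'')) (If (Cell ''c'' (Var ''j''))
        (If (Neq (Plus (Entry ''d'' (Var ''i'') (Var ''v'')) (Entry ''d'' (Var ''v'') (Var ''j'')))
               (Entry ''d'' (Var ''i'') (Var ''j'')))
          (If (Neq (Plus (Entry ''d'' (Var ''i'') (Var ''r'')) (Entry ''d'' (Var ''r'') (Var ''j'')))
                 (Entry ''d'' (Var ''i'') (Var ''j'')))
             Skip (Set ''ne'' (N 1)))
          (If (Neq (Plus (Entry ''d'' (Var ''i'') (Var ''r'')) (Entry ''d'' (Var ''r'') (Var ''j'')))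
                 (Entry ''d'' (Var ''i'') (Var ''j'')))
             (Set ''ne'' (N 1)) Skip))
        Skip) Skip)))"

text \<open>The start value \<open>v\<close> takes care of equal vertices: \<open>compare\<close>
  reports a cover vertex as different even from itself.\<close>

definition classes :: com where
  "classes = For ''v'' ''n''
    (Seq (Assign ''cl'' (Var ''v'') (Var ''v''))
    (For ''r'' ''n'' (Seq compare
      (If (Var ''ne'') Skip
        (If (Minus (Cell ''cl'' (Var ''v'')) (Var ''r'')) (Assign ''cl'' (Var ''v'') (Var ''r'')) Skip)))))"

text \<open>The number of trials is derived from the computed classes and the reduced budget, with
  one doubling for each bit of a guess.\<close>

definition two_power :: com where
  "two_power = Seq (Set ''pw'' (N 1))
    (Seq (For ''i'' ''n'' (If (Neq (Cell ''cl'' (Var ''i'')) (Var ''i'')) Skip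
            (Set ''pw'' (Plus (Var ''pw'') (Var ''pw'')))))
         (For ''i'' ''kk'' (Set ''pw'' (Plus (Var ''pw'') (Var ''pw'')))))"

lemma mods_compare [simp]: "mods compare = {''i'', ''j'', ''ne''}"
  by (auto simp: compare_def)

lemma mods_classes [simp]: "mods classes = {''i'', ''j'', ''v'', ''r'', ''ne'', ''cl''}"
  by (auto simp: classes_def)

lemma mods_two_power [simp]: "mods two_power = {''i'', ''pw''}"
  by (auto simp: two_power_def)

context input
begin

lemma runs_compare:
  assumes "base s" "matrix (s ''d'') dist" "s ''c'' = (\<lambda>i. of_bool (i \<in> C))" "C \<subseteq> {..<n}"
    and v: "s ''v'' 0 = v" "v < n" and r: "s ''r'' 0 = r" "r < n"
  shows "runs compare s (M ^ 6) (\<lambda>s'. s' ''ne'' 0 = 0 \<longleftrightarrow> v \<notin> C \<and> r \<notin> C \<and>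
    (\<forall>x\<in>C. \<forall>y\<in>C. dist x v + dist v y = dist x y \<longleftrightarrow> dist x r + dist r y = dist x y))"
    (is "runs _ _ _ (\<lambda>s'. ?Q s')")
proof -
  define ok where "ok x y \<longleftrightarrow> (x \<in> C \<longrightarrow> y \<in> C \<longrightarrow>
    (dist x v + dist v y = dist x y \<longleftrightarrow> dist x r + dist r y = dist x y))" for x y
  define inv where "inv = (\<lambda>a b s'. s' ''ne'' (0::nat) = (0::nat) \<longleftrightarrow> v \<notin> C \<and> r \<notin> C \<and>
    (\<forall>x<n. \<forall>y<n. x < a \<or> x = a \<and> y < b \<longrightarrow> ok x y))"
  show ?thesis unfolding compare_def
  proof (rule runs_Seq_denot[where U = "M ^ (1 + 4)"])
    show "csize (Set ''ne'' (Plus (Cell ''c'' (Var ''v'')) (Cell ''c'' (Var ''r'')))) + M ^ (1 + 4) \<le> M ^ 6"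
      using add_time_le[of M 9 5, OF M(1)] by simp
  next
    let ?s = "denot (Set ''ne'' (Plus (Cell ''c'' (Var ''v'')) (Cell ''c'' (Var ''r'')))) s"
    show "runs (For ''i'' ''n'' (For ''j'' ''n''
      (If (Cell ''c'' (Var ''i'')) (If (Cell ''c'' (Var ''j''))
        (If (Neq (Plus (Entry ''d'' (Var ''i'') (Var ''v'')) (Entry ''d'' (Var ''v'') (Var ''j'')))
               (Entry ''d'' (Var ''i'') (Var ''j'')))
          (If (Neq (Plus (Entry ''d'' (Var ''i'') (Var ''r'')) (Entry ''d'' (Var ''r'') (Var ''j'')))
                 (Entry ''d'' (Var ''i'') (Var ''j'')))
             Skip (Set ''ne'' (N 1)))
          (If (Neq (Plus (Entry ''d'' (Var ''i'') (Var ''r'')) (Entry ''d'' (Var ''r'') (Var ''j'')))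
                 (Entry ''d'' (Var ''i'') (Var ''j'')))
             (Set ''ne'' (N 1)) Skip))
        Skip) Skip))) ?s (M ^ (1 + 4)) (\<lambda>s'. ?Q s')"
    proof (rule runs_For2[where T = "50 * M" and I = inv], goal_cases)
      case 9
      show ?case using assms by (simp add: inv_def)
    next
      case (10 a s')
      then show ?case using base_simps[OF assms(1)] unfolding inv_def
        by (simp add: less_Suc_eq; blast)
    next
      case (12 s')
      then show ?case using base_simps[OF assms(1)] assms(4) unfolding inv_def ok_def
        by (simp add: subset_iff; blast)
    next
      case (11 a b s')
      have "base ?s" using assms(1) by (simp add: base_def)
      then have "base s'" by (rule base_cong) (rule 11(6), auto)
      note bs = base_simps[OF this] base_simps[OF assms(1)]
      have ab: "a < n" "b < n" using 11(1,2) bs by simp_all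
      have fr: "s' ''d'' = s ''d''" "s' ''c'' = (\<lambda>i. of_bool (i \<in> C))" "s' ''v'' 0 = v" "s' ''r'' 0 = r"
        using 11(6)[of "''d''"] 11(6)[of "''c''"] 11(6)[of "''v''"] 11(6)[of "''r''"] assms by simp_all
      have d: "s ''d'' (i * n + j) = dist i j" if "i < n" "j < n" for i j
        using assms(2) that by (simp add: matrix_def)
      let ?body = "(If (Cell ''c'' (Var ''i'')) (If (Cell ''c'' (Var ''j''))
        (If (Neq (Plus (Entry ''d'' (Var ''i'') (Var ''v'')) (Entry ''d'' (Var ''v'') (Var ''j'')))
               (Entry ''d'' (Var ''i'') (Var ''j'')))
          (If (Neq (Plus (Entry ''d'' (Var ''i'') (Var ''r'')) (Entry ''d'' (Var ''r'') (Var ''j'')))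
                 (Entry ''d'' (Var ''i'') (Var ''j'')))
             Skip (Set ''ne'' (N 1)))
          (If (Neq (Plus (Entry ''d'' (Var ''i'') (Var ''r'')) (Entry ''d'' (Var ''r'') (Var ''j'')))
                 (Entry ''d'' (Var ''i'') (Var ''j'')))
             (Set ''ne'' (N 1)) Skip))
        Skip) Skip)"
      have "denot ?body s' ''ne'' 0 = 0 \<longleftrightarrow> s' ''ne'' 0 = 0 \<and> ok a b"
        using 11(4,5) bs(6-) ab v r fr d by (auto simp: ok_def)
      then have "inv a (Suc b) (denot ?body s')"
        using 11(3) ab unfolding inv_def less_Suc_eq by blast
      then show ?case by (rule runs_denot[rotated]) (use M(1) in simp_all)
    qed (use base_simps[OF assms(1)] M(1) M_le in \<open>simp_all add: inv_def\<close>)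
  qed simp
qed

lemma runs_classes:
  assumes "base s" "matrix (s ''d'') dist" "s ''c'' = (\<lambda>i. of_bool (i \<in> C))" "C \<subseteq> {..<n}"
  shows "runs classes s (M ^ 12) (\<lambda>s'. \<forall>v<n. s' ''cl'' v = rep C dist v)"
proof -
  note bs = base_simps[OF assms(1)]
  let ?test = "If (Var ''ne'') Skip
        (If (Minus (Cell ''cl'' (Var ''v'')) (Var ''r'')) (Assign ''cl'' (Var ''v'') (Var ''r'')) Skip)"
  have row: "runs (Seq (Assign ''cl'' (Var ''v'') (Var ''v''))
     (For ''r'' ''n'' (Seq compare ?test))) t (M ^ 10) (\<lambda>t'. t' ''cl'' = (t ''cl'')(v := rep C dist v))"
    if t: "base t" "t ''d'' = s ''d''" "t ''c'' = s ''c''" "t ''v'' 0 = v" "v < n" for t v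
  proof (rule runs_Seq_denot[where U = "M ^ (7 + 2)"])
    show "csize (Assign ''cl'' (Var ''v'') (Var ''v'')) + M ^ (7 + 2) \<le> M ^ 10"
      using add_time_le[of M 5 9, OF M(1)] by simp
  next
    let ?t = "denot (Assign ''cl'' (Var ''v'') (Var ''v'')) t"
    \<comment> \<open>Once \<open>j\<close> has reached \<open>n\<close>, these conditions force
      \<open>m\<close> to be the representative, as \<open>rep C dist v\<close> is at most
      \<open>v\<close> and hence among the vertices tested.\<close>
    define inv where "inv = (\<lambda>j (t' :: state). \<exists>m. t' ''cl'' = (t ''cl'')(v := m) \<and>
      same_type C dist v m \<and> m \<le> v \<and> (\<forall>r<j. same_type C dist v r \<longrightarrow> m \<le> r))"
    show "runs (For ''r'' ''n'' (Seq compare ?test)) ?t (M ^ (7 + 2))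
      (\<lambda>t'. t' ''cl'' = (t ''cl'')(v := rep C dist v))"
    proof (rule runs_For_poly[where I = inv and T = "M ^ 7"], goal_cases)
      case 4
      show ?case using t(4) same_type_refl by (auto simp: inv_def)
    next
      case (6 t')
      then obtain m where m: "t' ''cl'' = (t ''cl'')(v := m)" "same_type C dist v m" "m \<le> v"
        "\<forall>r<n. same_type C dist v r \<longrightarrow> m \<le> r"
        using base_simps(2)[OF t(1)] by (auto simp: inv_def)
      have "m \<le> rep C dist v" using m(4) same_type_rep rep_le[of C dist v] t(5) le_less_trans by blast
      moreover have "rep C dist v \<le> m" unfolding rep_def using m(2) by (rule Least_le)
      ultimately show ?case using m(1) by simp
    next
      case (5 j t')
      have "base ?t" using t(1) by (simp add: base_def)
      then have "base t'" by (rule base_cong) (rule 5(4), auto)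
      have j: "j < n" using 5(1) base_simps(2)[OF t(1)] by simp
      have fr: "t' ''d'' = s ''d''" "t' ''c'' = s ''c''" "t' ''v'' 0 = v"
        using 5(4)[of "''d''"] 5(4)[of "''c''"] 5(4)[of "''v''"] t by simp_all
      obtain m where m: "t' ''cl'' = (t ''cl'')(v := m)" "same_type C dist v m" "m \<le> v"
        "\<forall>r<j. same_type C dist v r \<longrightarrow> m \<le> r" using 5(2) unfolding inv_def by blast
      show ?case
      proof (rule runs_Seq[OF runs_compare runs_denot])
        show "base t'" by fact
        show "t' ''v'' 0 = v" "t' ''r'' 0 = j" "v < n" "j < n" "C \<subseteq> {..<n}"
          using fr 5(3) t j assms by simp_all
        show "matrix (t' ''d'') dist" "t' ''c'' = (\<lambda>i. of_bool (i \<in> C))" using fr assms by simp_all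
        show "M ^ 6 + 50 \<le> M ^ 7" using add_time_le[of M 50 6, OF M(1)] by simp
      next
        fix t''
        assume ne: "t'' ''ne'' 0 = 0 \<longleftrightarrow> v \<notin> C \<and> j \<notin> C \<and>
          (\<forall>x\<in>C. \<forall>y\<in>C. dist x v + dist v y = dist x y \<longleftrightarrow> dist x j + dist j y = dist x y)"
          and fr2: "\<And>x. x \<notin> mods compare \<Longrightarrow> t'' x = t' x"
        have fr2: "t'' ''cl'' = (t ''cl'')(v := m)" "t'' ''v'' 0 = v" "t'' ''r'' 0 = j"
          using fr2[of "''cl''"] fr2[of "''v''"] fr2[of "''r''"] fr 5(3) m(1) by simp_all
        have same: "same_type C dist v j \<longleftrightarrow> v = j \<or> t'' ''ne'' 0 = 0"
          using ne by (simp add: same_type_def)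
        define m' where "m' = (if t'' ''ne'' 0 = 0 \<and> j < m then j else m)"
        have "denot ?test t'' ''cl'' = (t ''cl'')(v := m')"
          using fr2 by (auto simp: m'_def)
        moreover have "same_type C dist v m'" "m' \<le> v" "\<forall>r<Suc j. same_type C dist v r \<longrightarrow> m' \<le> r"
          using m same by (auto simp: m'_def less_Suc_eq)
        ultimately show "inv (Suc j) ((denot ?test t'')(''r'' := (denot ?test t'' ''r'')(0 := Suc j)))"
          unfolding inv_def by auto
      qed simp_all
    qed (use base_simps[OF t(1)] M(1) M_le in simp_all)
  qed simp
  have "runs classes s (M ^ (10 + 2)) (\<lambda>s'. \<forall>v<n. s' ''cl'' v = rep C dist v)"
    unfolding classes_def
  proof (rule runs_For_poly[where I = "\<lambda>j s'. \<forall>v<j. s' ''cl'' v = rep C dist v" and T = "M ^ 10"], goal_cases)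
    case (5 j s')
    have "base s'" using assms(1) by (rule base_cong) (rule 5(4), auto)
    then show ?case
    proof (rule runs_frame[OF row order_refl])
      show "s' ''d'' = s ''d''" "s' ''c'' = s ''c''" "s' ''v'' 0 = j" "j < n"
        using 5(4)[of "''d''"] 5(4)[of "''c''"] 5(1,3) bs by simp_all
    qed (use 5(2) in \<open>simp_all add: less_Suc_eq\<close>)
  qed (use bs M(1) M_le in simp_all)
  then show ?thesis by simp
qed

lemma runs_two_power:
  assumes "base s" "\<forall>v<n. s ''cl'' v = rep C dist v" "s ''kk'' 0 = b" "b \<le> M"
  shows "runs two_power s (M ^ 4) (\<lambda>s'. s' ''pw'' 0 = 2 ^ (card (reps C dist n) + b))"
  unfolding two_power_def
proof (rule runs_Seq_denot[where U = "M ^ 3"])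
  note bs = base_simps[OF assms(1)]
  let ?s = "denot (Set ''pw'' (N 1)) s"
  let ?l1 = "For ''i'' ''n'' (If (Neq (Cell ''cl'' (Var ''i'')) (Var ''i'')) Skip
            (Set ''pw'' (Plus (Var ''pw'') (Var ''pw''))))"
  let ?l2 = "For ''i'' ''kk'' (Set ''pw'' (Plus (Var ''pw'') (Var ''pw'')))"
  show "csize (Set ''pw'' (N 1)) + M ^ 3 \<le> M ^ 4"
    using add_time_le[of M 3 3, OF M(1)] by simp
  have 1: "runs ?l1 ?s (M ^ (0 + 2)) (\<lambda>s'. s' ''pw'' 0 = 2 ^ card (reps C dist n))"
  proof (rule runs_For_poly[where I = "\<lambda>j s'. s' ''pw'' 0 = 2 ^ card (reps C dist j)" and T = 50], goal_cases)
    case (5 j s')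
    have j: "j < n" "s' ''cl'' j = rep C dist j" using 5(1) 5(4)[of "''cl''"] bs assms(2) by simp_all
    have R: "reps C dist (Suc j) = (if rep C dist j = j then insert j (reps C dist j) else reps C dist j)"
      by (auto simp: reps_def less_Suc_eq)
    have "j \<notin> reps C dist j" by (simp add: reps_def)
    then show ?case using 5(2,3) j by (intro runs_denot) (auto simp: R)
  qed (use bs M(1) M_le in \<open>simp_all add: reps_def\<close>)
  have 2: "runs ?l2 r (M ^ (0 + 2)) (\<lambda>s'. s' ''pw'' 0 = 2 ^ (card (reps C dist n) + b))"
    if r: "r ''pw'' 0 = 2 ^ card (reps C dist n)" "r ''kk'' 0 = b" for r
  proof (rule runs_For_poly[where I = "\<lambda>j s'. s' ''pw'' 0 = 2 ^ (card (reps C dist n) + j)" and T = 50], goal_cases)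
    case (5 j s')
    show ?case using 5(2,3) by (intro runs_denot) simp_all
  qed (use r assms(4) M(1) in simp_all)
  have "M ^ 2 + M ^ 2 = 2 * M ^ 2" by simp
  also have "\<dots> \<le> M * M ^ 2" using M(1) by (intro mult_le_mono1) simp
  also have "\<dots> = M ^ 3" by (simp only: power3_eq_cube power2_eq_square mult.assoc)
  finally have le: "M ^ 2 + M ^ 2 \<le> M ^ 3" .
  show "runs (Seq ?l1 ?l2) ?s (M ^ 3) (\<lambda>s'. s' ''pw'' 0 = 2 ^ (card (reps C dist n) + b))"
  proof (intro runs_Seq[OF 1 2])
    show "r ''kk'' 0 = b" if "\<And>y. y \<notin> mods ?l1 \<Longrightarrow> r y = ?s y" for r
      using that[of "''kk''"] assms(3) by simp
    show "M ^ (0 + 2) + M ^ (0 + 2) \<le> M ^ 3" using le by (simp only: add_0)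
  qed
qed simp

end

section \<open>A single trial of the search\<close>

definition draw_tokens :: com where
  "draw_tokens = For ''i'' ''n''
    (Seq (Assign ''x'' (Var ''i'') (N 0))
    (Seq (Assign ''z'' (Var ''i'') (N 0))
    (If (Neq (Cell ''cl'' (Var ''i'')) (Var ''i'')) Skip
      (Seq (Assign ''z'' (Var ''i'') (Minus (Var ''h'') (Plus (Half (Var ''h'')) (Half (Var ''h'')))))
           (Set ''h'' (Half (Var ''h'')))))))"

definition test_tokens :: com where
  "test_tokens = For ''i'' ''n''
    (If (Cell ''z'' (Cell ''cl'' (Var ''i'')))
      (If (Neq (Var ''i'') (Var ''u'')) (If (Neq (Var ''i'') (Var ''v''))
        (If (Neq (Plus (Entry ''d'' (Var ''u'') (Var ''i'')) (Entry ''d'' (Var ''i'') (Var ''v'')))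
             (Entry ''d'' (Var ''u'') (Var ''v'')))
          Skip (Set ''hit'' (N 1))) Skip) Skip) Skip)"

definition branch :: com where
  "branch =
    Seq (Set ''u'' (Cell ''in'' (Plus (Var ''off'') (Plus (Var ''q'') (Var ''q'')))))
    (Seq (Set ''v'' (Cell ''in'' (Plus (Var ''off'') (Plus (N 1) (Plus (Var ''q'') (Var ''q''))))))
    (Seq (Set ''hit'' (Plus (Cell ''x'' (Var ''u'')) (Cell ''x'' (Var ''v''))))
    (Seq test_tokens
    (If (Var ''hit'') Skip
      (Seq (If (Minus (Var ''h'') (Plus (Half (Var ''h'')) (Half (Var ''h''))))
              (Assign ''x'' (Var ''v'') (N 1)) (Assign ''x'' (Var ''u'') (N 1)))
           (Set ''h'' (Half (Var ''h''))))))))"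

text \<open>The tokens of classes with a chosen end are erased while the ends are counted, so the
  second loop adds up exactly those tokens that cost an extra vertex.\<close>

definition count_cost :: com where
  "count_cost =
    Seq (Set ''cost'' (N 0))
    (Seq (For ''i'' ''n'' (If (Cell ''x'' (Var ''i''))
       (Seq (Set ''cost'' (Plus (Var ''cost'') (N 1))) (Assign ''z'' (Cell ''cl'' (Var ''i'')) (N 0))) Skip))
       (For ''i'' ''n'' (Set ''cost'' (Plus (Var ''cost'') (Cell ''z'' (Var ''i''))))))"

text \<open>\<open>out\<close> is never reset: it stays 1 after a successful guess, so the trials
  together compute a disjunction.\<close>

definition trial :: com where
  "trial =
    Seq (Set ''h'' (Var ''g''))
    (Seq draw_tokens
    (Seq (For ''q'' ''m'' branch)
    (Seq count_cost
    (If (Minus (Var ''cost'') (Var ''kk'')) Skip (Set ''out'' (N 1))))))"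

lemma mods_draw_tokens [simp]: "mods draw_tokens = {''i'', ''x'', ''z'', ''h''}"
  by (auto simp: draw_tokens_def)

lemma mods_test_tokens [simp]: "mods test_tokens = {''i'', ''hit''}"
  by (auto simp: test_tokens_def)

lemma mods_branch [simp]: "mods branch = {''i'', ''u'', ''v'', ''hit'', ''x'', ''h''}"
  by (auto simp: branch_def)

lemma mods_count_cost [simp]: "mods count_cost = {''i'', ''cost'', ''z''}"
  by (auto simp: count_cost_def)

lemma mods_trial [simp]: "mods trial = {''i'', ''x'', ''z'', ''h'', ''q'', ''u'', ''v'', ''hit'', ''cost'', ''out''}"
  by (auto simp: trial_def)

context input
begin

definition ready :: "nat set \<Rightarrow> state \<Rightarrow> bool" where
  "ready C s \<longleftrightarrow> base s \<and> matrix (s ''d'') dist \<and> (\<forall>v<n. s ''cl'' v = rep C dist v)"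

lemma ready_cong:
  assumes "ready C s" "\<And>y. y \<in> {''in'', ''n'', ''m'', ''nn'', ''off'', ''row'', ''d'', ''cl''} \<Longrightarrow> s' y = s y"
  shows "ready C s'"
proof -
  have "base s'" using assms(1) unfolding ready_def by (intro base_cong[of s s'] assms(2)) auto
  then show ?thesis using assms(1) assms(2)[of "''d''"] assms(2)[of "''cl''"] by (simp add: ready_def)
qed

lemma ready_simps:
  assumes "ready C s"
  shows "s ''in'' = inp" "s ''n'' 0 = n" "s ''m'' 0 = m"
    "s ''off'' 0 = 4 + 2 * (n * n)" "i \<le> n \<Longrightarrow> s ''row'' i = i * n"
    "i < n \<Longrightarrow> j < n \<Longrightarrow> s ''d'' (i * n + j) = dist i j" "i < n \<Longrightarrow> s ''cl'' i = rep C dist i"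
  using assms by (simp_all add: ready_def matrix_def base_simps)

definition holds :: "(nat \<Rightarrow> nat) \<Rightarrow> nat set \<Rightarrow> bool" where
  "holds a X \<longleftrightarrow> (\<forall>i<n. a i = of_bool (i \<in> X))"

lemma runs_draw_tokens:
  assumes "ready C s" "s ''h'' 0 = g"
  shows "runs draw_tokens s (M ^ 2) (\<lambda>s'. holds (s' ''x'') {} \<and>
    holds (s' ''z'') (fst (tokens C dist n g)) \<and> s' ''h'' 0 = snd (tokens C dist n g))"
proof -
  note rs = ready_simps[OF assms(1)]
  define tok where "tok j = fold (token_step C dist) [0..<j] ({}, g)" for j
  have tok_Suc: "tok (Suc j) = token_step C dist j (tok j)" for j by (simp add: tok_def)
  \<comment> \<open>\<open>j\<close> cannot have become a token in an earlier round, so resetting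
    \<open>z[j]\<close> to 0 loses nothing.\<close>
  have tok_le: "j \<notin> fst (tok j)" for j
    using fold_token_step_subset[of C dist "[0..<j]" "{}" g] by (auto simp: tok_def)
  let ?body = "Seq (Assign ''x'' (Var ''i'') (N 0))
    (Seq (Assign ''z'' (Var ''i'') (N 0))
    (If (Neq (Cell ''cl'' (Var ''i'')) (Var ''i'')) Skip
      (Seq (Assign ''z'' (Var ''i'') (Minus (Var ''h'') (Plus (Half (Var ''h'')) (Half (Var ''h'')))))
           (Set ''h'' (Half (Var ''h''))))))"
  define inv where "inv = (\<lambda>j (s' :: state). (\<forall>i<j. s' ''x'' i = 0 \<and> s' ''z'' i = of_bool (i \<in> fst (tok j))) \<and>
    s' ''h'' 0 = snd (tok j))"
  have "runs draw_tokens s (M ^ (0 + 2)) (\<lambda>s'. holds (s' ''x'') {} \<and>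
    holds (s' ''z'') (fst (tokens C dist n g)) \<and> s' ''h'' 0 = snd (tokens C dist n g))"
    unfolding draw_tokens_def
  proof (rule runs_For_poly[where I = inv and T = 50], goal_cases)
    case 4
    show ?case using assms(2) by (simp add: inv_def tok_def)
  next
    case (6 s')
    then show ?case using rs(2) by (simp add: inv_def holds_def tok_def tokens_def)
  next
    case (5 j s')
    have j: "j < n" "s' ''cl'' j = rep C dist j" using 5(1) 5(4)[of "''cl''"] rs by simp_all
    obtain Z h where Z: "tok j = (Z, h)" by fastforce
    have jZ: "j \<notin> Z" using tok_le[of j] Z by simp
    have I: "\<forall>i<j. s' ''x'' i = 0 \<and> s' ''z'' i = of_bool (i \<in> Z)" "s' ''h'' 0 = h"
      using 5(2) Z by (simp_all add: inv_def)
    let ?b = "denot ?body s'"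
    \<comment> \<open>The machine obtains the lowest bit as the difference between \<open>h\<close>
      and twice its half.\<close>
    have mod2: "h - (h div 2 + h div 2) = h mod 2" by presburger
    have *: "?b ''x'' = (s' ''x'')(j := 0)"
      "?b ''z'' = (s' ''z'')(j := if rep C dist j = j then h mod 2 else 0)"
      "?b ''h'' 0 = (if rep C dist j = j then h div 2 else h)"
      using 5(3) j I(2) mod2 by auto
    have "inv (Suc j) (?b(''i'' := (?b ''i'')(0 := Suc j)))"
      unfolding inv_def tok_Suc Z using * I(1) jZ
      by (auto simp: token_step_def less_Suc_eq odd_iff_mod_2_eq_one)
    then show ?case by (rule runs_denot[rotated]) simp_all
  qed (use rs M(1) M_le in simp_all)
  then show ?thesis by (simp only: add_0)
qed

lemma rep_less: "i < n \<Longrightarrow> rep C dist i < n"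
  using rep_le[of C dist i] by simp

lemma runs_test_tokens:
  assumes "ready C s" "holds (s ''z'') Z" "s ''u'' 0 = u" "s ''v'' 0 = v" "u < n" "v < n"
  shows "runs test_tokens s (M ^ 3) (\<lambda>s'. s' ''hit'' 0 = 0 \<longleftrightarrow>
    s ''hit'' 0 = 0 \<and> \<not> token_hit C dist n Z u v)"
proof -
  note rs = ready_simps[OF assms(1)]
  let ?body = "If (Cell ''z'' (Cell ''cl'' (Var ''i'')))
      (If (Neq (Var ''i'') (Var ''u'')) (If (Neq (Var ''i'') (Var ''v''))
        (If (Neq (Plus (Entry ''d'' (Var ''u'') (Var ''i'')) (Entry ''d'' (Var ''i'') (Var ''v'')))
             (Entry ''d'' (Var ''u'') (Var ''v'')))
          Skip (Set ''hit'' (N 1))) Skip) Skip) Skip"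
  define P where "P w \<longleftrightarrow> w \<noteq> u \<and> w \<noteq> v \<and> dist u w + dist w v = dist u v \<and> rep C dist w \<in> Z" for w
  have "runs test_tokens s (M ^ (1 + 2)) (\<lambda>s'. s' ''hit'' 0 = 0 \<longleftrightarrow>
    s ''hit'' 0 = 0 \<and> \<not> token_hit C dist n Z u v)"
    unfolding test_tokens_def
  proof (rule runs_For_poly[where T = "50 * M" and
      I = "\<lambda>j s'. s' ''hit'' 0 = 0 \<longleftrightarrow> s ''hit'' 0 = 0 \<and> \<not> (\<exists>w<j. P w)"], goal_cases)
    case (6 s')
    then show ?case using rs(2) by (simp add: token_hit_def P_def)
  next
    case (5 j s')
    have j: "j < n" using 5(1) rs by simp
    have fr: "s' ''d'' = s ''d''" "s' ''row'' = s ''row''" "s' ''cl'' = s ''cl''" "s' ''z'' = s ''z''"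
      "s' ''u'' 0 = u" "s' ''v'' 0 = v"
      using 5(4) assms by simp_all
    have "s ''z'' (rep C dist j) = of_bool (rep C dist j \<in> Z)"
      using assms(2) rep_less[OF j] by (simp add: holds_def)
    then have "denot ?body s' ''hit'' 0 = 0 \<longleftrightarrow> s' ''hit'' 0 = 0 \<and> \<not> P j"
      using 5(3) fr rs(5-) j assms(5,6)
      by (cases "j = u"; cases "j = v"; cases "dist u j + dist j v = dist u v"; simp add: P_def)
    then have "denot ?body s' ''hit'' 0 = 0 \<longleftrightarrow> s ''hit'' 0 = 0 \<and> \<not> (\<exists>w<Suc j. P w)"
      using 5(2) less_Suc_eq by auto
    then show ?case by (intro runs_denot) (use M(1) in simp_all)
  qed (use rs M(1) M_le in simp_all)
  then show ?thesis by (simp only: one_plus_numeral add_num_simps)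
qed

lemma runs_branch:
  assumes "ready C s" "holds (s ''z'') Z" "holds (s ''x'') X" "s ''h'' 0 = h"
    "s ''q'' 0 = q" "q < m" "fst (pairs ! q) < n" "snd (pairs ! q) < n"
  shows "runs branch s (M ^ 4) (\<lambda>s'. holds (s' ''x'') (fst (branch_step C dist n Z (pairs ! q) (X, h))) \<and>
    s' ''h'' 0 = snd (branch_step C dist n Z (pairs ! q) (X, h)))"
proof -
  note rs = ready_simps[OF assms(1)]
  obtain u v where uv: "pairs ! q = (u, v)" by fastforce
  then have uv': "inp (4 + 2 * (n * n) + 2 * q) = u" "inp (5 + 2 * (n * n) + 2 * q) = v"
    using assms(6) by (simp_all add: pairs_def)
  have uvn: "u < n" "v < n" using assms(7,8) uv by simp_all
  let ?c1 = "Set ''u'' (Cell ''in'' (Plus (Var ''off'') (Plus (Var ''q'') (Var ''q''))))"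
  let ?c2 = "Set ''v'' (Cell ''in'' (Plus (Var ''off'') (Plus (N 1) (Plus (Var ''q'') (Var ''q'')))))"
  let ?c3 = "Set ''hit'' (Plus (Cell ''x'' (Var ''u'')) (Cell ''x'' (Var ''v'')))"
  let ?c4 = "If (Var ''hit'') Skip
      (Seq (If (Minus (Var ''h'') (Plus (Half (Var ''h'')) (Half (Var ''h''))))
              (Assign ''x'' (Var ''v'') (N 1)) (Assign ''x'' (Var ''u'') (N 1)))
           (Set ''h'' (Half (Var ''h''))))"
  \<comment> \<open>\<open>hit\<close> starts with the flags of both ends, so a single test after
    the token loop decides all three conditions of \<open>branch_step\<close>.\<close>
  define r where "r = denot ?c3 (denot ?c2 (denot ?c1 s))"
  have r: "r ''u'' 0 = u" "r ''v'' 0 = v" "r ''hit'' 0 = s ''x'' u + s ''x'' v"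
    "r ''h'' = s ''h''" "r ''x'' = s ''x''" "r ''z'' = s ''z''"
    using rs uv' assms(5) by (simp_all add: r_def algebra_simps flip: mult_2)
  have "ready C r" using assms(1) by (rule ready_cong) (auto simp: r_def)
  have x: "s ''x'' u = of_bool (u \<in> X)" "s ''x'' v = of_bool (v \<in> X)"
    using assms(3) uvn by (simp_all add: holds_def)
  have "runs (Seq test_tokens ?c4) r (M ^ 3 + 60)
    (\<lambda>s'. holds (s' ''x'') (fst (branch_step C dist n Z (pairs ! q) (X, h))) \<and>
    s' ''h'' 0 = snd (branch_step C dist n Z (pairs ! q) (X, h)))"
  proof (rule runs_Seq[OF runs_test_tokens])
    show "ready C r" by fact
    show "r ''u'' 0 = u" "r ''v'' 0 = v" "u < n" "v < n" "holds (r ''z'') Z"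
      using r uvn assms(2) by simp_all
  next
    fix t
    assume hit: "t ''hit'' 0 = 0 \<longleftrightarrow> r ''hit'' 0 = 0 \<and> \<not> token_hit C dist n Z u v"
      and fr: "\<And>y. y \<notin> mods test_tokens \<Longrightarrow> t y = r y"
    have t: "t ''h'' 0 = h" "t ''x'' = s ''x''" "t ''u'' 0 = u" "t ''v'' 0 = v"
      using fr r assms(4) by simp_all
    have hit: "t ''hit'' 0 = 0 \<longleftrightarrow> \<not> (token_hit C dist n Z u v \<or> u \<in> X \<or> v \<in> X)"
      using hit r(3) x by auto
    have mod2: "h - (h div 2 + h div 2) = h mod 2" by presburger
    show "runs ?c4 t 60 (\<lambda>s'. holds (s' ''x'') (fst (branch_step C dist n Z (pairs ! q) (X, h))) \<and>
      s' ''h'' 0 = snd (branch_step C dist n Z (pairs ! q) (X, h)))"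
    proof (cases "token_hit C dist n Z u v \<or> u \<in> X \<or> v \<in> X")
      case True
      then show ?thesis using t hit assms(3) uv
        by (intro runs_denot) (simp_all add: branch_step_def)
    next
      case False
      then have "holds (denot ?c4 t ''x'') (insert (if odd h then v else u) X)"
        "denot ?c4 t ''h'' 0 = h div 2"
        using t hit assms(3) uvn mod2 by (auto simp: holds_def odd_iff_mod_2_eq_one)
      then show ?thesis using False uv
        by (intro runs_denot) (simp_all add: branch_step_def)
    qed
  qed simp
  note rest = this[unfolded r_def]
  show ?thesis unfolding branch_def
    by (rule runs_Seq_denot[where U = "M ^ 3 + 86"], simp, rule runs_Seq_denot[where U = "M ^ 3 + 72"],
        simp, rule runs_Seq_denot[where U = "M ^ 3 + 60"], simp, rule rest)
      (use add_time_le[of M 99 3, OF M(1)] in simp_all)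
qed

lemma runs_count_cost:
  assumes "ready C s" "holds (s ''z'') Z" "holds (s ''x'') X" "X \<subseteq> {..<n}" "Z \<subseteq> {..<n}"
  shows "runs count_cost s (M ^ 4) (\<lambda>s'. s' ''cost'' 0 = card X + card (Z - rep C dist ` X))"
proof -
  note rs = ready_simps[OF assms(1)]
  let ?s = "denot (Set ''cost'' (N 0)) s"
  let ?l1 = "For ''i'' ''n'' (If (Cell ''x'' (Var ''i''))
       (Seq (Set ''cost'' (Plus (Var ''cost'') (N 1))) (Assign ''z'' (Cell ''cl'' (Var ''i'')) (N 0))) Skip)"
  let ?l2 = "For ''i'' ''n'' (Set ''cost'' (Plus (Var ''cost'') (Cell ''z'' (Var ''i''))))"
  have Suc_int: "Y \<inter> {..<Suc j} = (if j \<in> Y then insert j (Y \<inter> {..<j}) else Y \<inter> {..<j})" for Y j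
    by (auto simp: less_Suc_eq)
  have full: "Y \<inter> {..<n} = Y" if "Y \<subseteq> {..<n}" for Y using that by blast
  have 1: "runs ?l1 ?s (M ^ (0 + 2)) (\<lambda>s'. s' ''cost'' 0 = card X \<and> holds (s' ''z'') (Z - rep C dist ` X))"
  proof (rule runs_For_poly[where T = 50 and I = "\<lambda>j s'. s' ''cost'' 0 = card (X \<inter> {..<j}) \<and>
      holds (s' ''z'') (Z - rep C dist ` (X \<inter> {..<j}))"], goal_cases)
    case (5 j s')
    have j: "j < n" "s' ''cl'' j = rep C dist j" "s' ''x'' j = of_bool (j \<in> X)"
      using 5(1) 5(4)[of "''cl''"] 5(4)[of "''x''"] rs assms(3) by (simp_all add: holds_def)
    show ?case using 5(2,3) j
      by (intro runs_denot) (auto simp: holds_def Suc_int)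
  qed (use rs assms full M(1) M_le in \<open>simp_all add: holds_def\<close>)
  have 2: "runs ?l2 r (M ^ (0 + 2)) (\<lambda>s'. s' ''cost'' 0 = card X + card (Z - rep C dist ` X))"
    if r: "r ''n'' 0 = n" "r ''cost'' 0 = card X" "holds (r ''z'') (Z - rep C dist ` X)" for r
  proof (rule runs_For_poly[where T = 50 and I = "\<lambda>j s'. s' ''cost'' 0 =
      card X + card ((Z - rep C dist ` X) \<inter> {..<j})"], goal_cases)
    case (5 j s')
    have j: "j < n" "s' ''z'' j = of_bool (j \<in> Z - rep C dist ` X)"
      using 5(1) 5(4)[of "''z''"] r by (simp_all add: holds_def)
    show ?case using 5(2,3) j by (intro runs_denot) (simp_all add: Suc_int)
  next
    case (6 s')
    moreover have "(Z - rep C dist ` X) \<inter> {..<n} = Z - rep C dist ` X" using assms(5) by blast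
    ultimately show ?case using r(1) by simp
  qed (use r M(1) M_le in simp_all)
  have "M ^ 2 + M ^ 2 = 2 * M ^ 2" by simp
  also have "\<dots> \<le> M * M ^ 2" using M(1) by (intro mult_le_mono1) simp
  also have "\<dots> = M ^ 3" by (simp only: power3_eq_cube power2_eq_square mult.assoc)
  finally have le: "M ^ 2 + M ^ 2 \<le> M ^ 3" .
  show ?thesis unfolding count_cost_def
  proof (rule runs_Seq_denot[where U = "M ^ 3"])
    show "csize (Set ''cost'' (N 0)) + M ^ 3 \<le> M ^ 4"
      using add_time_le[of M 3 3, OF M(1)] by simp
    show "runs (Seq ?l1 ?l2) ?s (M ^ 3) (\<lambda>s'. s' ''cost'' 0 = card X + card (Z - rep C dist ` X))"
    proof (intro runs_Seq[OF 1 2])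
      show "r ''n'' 0 = n" if "\<And>y. y \<notin> mods ?l1 \<Longrightarrow> r y = ?s y" for r
        using that[of "''n''"] rs(2) by simp
      show "M ^ (0 + 2) + M ^ (0 + 2) \<le> M ^ 3" using le by (simp only: add_0)
    qed simp_all
  qed simp
qed

end

section \<open>The complete program\<close>

definition solve :: com where
  "solve =
    Seq prepare (Seq scale (Seq sum_weights (Seq init_dist (Seq floyd_warshall (Seq match_edges
    (Seq (Set ''kk'' (Minus (Cell ''in'' (N 2)) (Minus (Cell ''in'' (N 2)) (Var ''cc''))))
    (Seq classes (Seq two_power (For ''g'' ''pw'' trial)))))))))"

text \<open>Stated outside \<open>hitting\<close>: the program is verified from the validity of the
  indices, before anything is known about distances.\<close>

lemma fold_branch_step_less:
  assumes "\<forall>(u, v) \<in> set us. u < n \<and> v < n" "X \<subseteq> {..<n}"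
  shows "fst (fold (branch_step C d n Z) us (X, h)) \<subseteq> {..<n}"
  using assms
proof (induction us arbitrary: X h)
  case (Cons p us)
  obtain X' h' where step: "branch_step C d n Z p (X, h) = (X', h')" by fastforce
  then have "X' \<subseteq> {..<n}" using Cons.prems by (auto simp: branch_step_def split: if_splits)
  then show ?case using Cons.IH[of X' h'] Cons.prems(1) step by simp
qed simp

context input
begin

lemma runs_trial:
  assumes s: "ready C s" "s ''g'' 0 = g" "s ''kk'' 0 = b"
    and pairs: "\<forall>(u, v) \<in> set pairs. u < n \<and> v < n"
  shows "runs trial s (M ^ 7)
    (\<lambda>s'. s' ''out'' 0 = (if accepts C dist n pairs b g then 1 else s ''out'' 0))"
proof -
  obtain Z h where Z: "tokens C dist n g = (Z, h)" by fastforce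
  define st where "st j = fold (branch_step C dist n Z) (take j pairs) ({}, h)" for j
  have len: "length pairs = m" by (simp add: pairs_def)
  have st_Suc: "st (Suc j) = branch_step C dist n Z (pairs ! j) (st j)" if "j < m" for j
    using that len by (simp add: st_def take_Suc_conv_app_nth)
  obtain X h' where X: "st m = (X, h')" by fastforce
  have acc: "accepts C dist n pairs b g \<longleftrightarrow> card X + card (Z - rep C dist ` X) \<le> b"
    using X len by (simp add: accepts_def Z st_def)
  have ZX: "X \<subseteq> {..<n}" "Z \<subseteq> {..<n}"
    using fold_branch_step_less[OF pairs, of "{}" C dist Z h] tokens_subset[of C dist n g] X Z len
    by (auto simp: st_def reps_def)
  define Q where "Q s' \<longleftrightarrow> s' ''out'' 0 = (if accepts C dist n pairs b g then 1 else s ''out'' 0)" for s' :: state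
  define fin where "fin = If (Minus (Var ''cost'') (Var ''kk'')) Skip (Set ''out'' (N 1))"
  have p1: "runs (Seq count_cost fin) r (M ^ 4 + 20) Q"
    if r: "ready C r" "holds (r ''z'') Z" "holds (r ''x'') X" "r ''kk'' 0 = b" "r ''out'' = s ''out''" for r
  proof (rule runs_Seq[OF runs_count_cost[OF r(1,2,3) ZX]])
    fix t
    assume t: "t ''cost'' 0 = card X + card (Z - rep C dist ` X)"
      and fr: "\<And>y. y \<notin> mods count_cost \<Longrightarrow> t y = r y"
    have "t ''kk'' 0 = b" "t ''out'' = s ''out''" using fr r by simp_all
    then show "runs fin t 20 Q" using t
      by (intro runs_denot) (auto simp: fin_def Q_def acc)
  qed simp
  have p2: "runs (Seq (For ''q'' ''m'' branch) (Seq count_cost fin)) r (M ^ 6 + (M ^ 4 + 20)) Q"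
    if r: "ready C r" "holds (r ''z'') Z" "holds (r ''x'') {}" "r ''h'' 0 = h" "r ''kk'' 0 = b"
      "r ''out'' = s ''out''" for r
  proof (rule runs_Seq[OF _ p1])
    show "runs (For ''q'' ''m'' branch) r (M ^ 6) (\<lambda>t. holds (t ''x'') X)"
    proof -
      have "runs (For ''q'' ''m'' branch) r (M ^ (4 + 2)) (\<lambda>t. holds (t ''x'') X)"
      proof (rule runs_For_poly[where T = "M ^ 4" and
          I = "\<lambda>j t. holds (t ''x'') (fst (st j)) \<and> t ''h'' 0 = snd (st j)"], goal_cases)
        case 4
        show ?case using r by (simp add: st_def)
      next
        case (6 t)
        then show ?case using ready_simps(3)[OF r(1)] X by simp
      next
        case (5 j t)
        have j: "j < m" using 5(1) ready_simps(3)[OF r(1)] by simp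
        then have "pairs ! j \<in> set pairs" using len by simp
        then have uv: "fst (pairs ! j) < n" "snd (pairs ! j) < n" using pairs by auto
        have "ready C t" using r(1) by (rule ready_cong) (rule 5(4), auto)
        moreover have "holds (t ''z'') Z" using r(2) 5(4)[of "''z''"] by simp
        ultimately show ?case
          by (rule runs_frame[OF runs_branch[where X = "fst (st j)" and h = "snd (st j)" and q = j] order_refl])
            (use 5(2,3) j uv in \<open>simp_all add: st_Suc\<close>)
      qed (use ready_simps(3)[OF r(1)] M(1) M_le in simp_all)
      then show ?thesis by simp
    qed
  next
    fix t
    assume fr: "\<And>y. y \<notin> mods (For ''q'' ''m'' branch) \<Longrightarrow> t y = r y"
    show "ready C t" using r(1) by (rule ready_cong) (rule fr, auto)
    show "holds (t ''z'') Z" "t ''kk'' 0 = b" "t ''out'' = s ''out''" using fr r by simp_all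
  qed simp_all
  have p3: "runs (Seq draw_tokens (Seq (For ''q'' ''m'' branch) (Seq count_cost fin))) r
      (M ^ 2 + (M ^ 6 + (M ^ 4 + 20))) Q"
    if r: "ready C r" "r ''h'' 0 = g" "r ''kk'' 0 = b" "r ''out'' = s ''out''" for r
  proof (rule runs_Seq[OF runs_draw_tokens[OF r(1,2)] p2])
    fix t
    assume fr: "\<And>y. y \<notin> mods draw_tokens \<Longrightarrow> t y = r y"
    show "ready C t" using r(1) by (rule ready_cong) (rule fr, auto)
    show "t ''kk'' 0 = b" "t ''out'' = s ''out''" using fr r by simp_all
  qed (simp_all add: Z)
  have "M ^ 2 \<le> M ^ 6" "M ^ 4 \<le> M ^ 6" "1 \<le> M ^ 6" using M(1) by (simp_all add: power_increasing)
  then have "4 + (M ^ 2 + (M ^ 6 + (M ^ 4 + 20))) \<le> 100 * M ^ 6" by linarith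
  also have "\<dots> \<le> M * M ^ 6" using M(1) by (rule mult_le_mono1)
  also have "\<dots> = M ^ 7" by (simp flip: power_Suc)
  finally have time: "4 + (M ^ 2 + (M ^ 6 + (M ^ 4 + 20))) \<le> M ^ 7" .
  have "runs trial s (M ^ 7) Q" unfolding trial_def fin_def[symmetric]
  proof (rule runs_Seq_denot[OF _ p3])
    show "ready C (denot (Set ''h'' (Var ''g'')) s)" using s(1) by (rule ready_cong) auto
    show "csize (Set ''h'' (Var ''g'')) + (M ^ 2 + (M ^ 6 + (M ^ 4 + 20))) \<le> M ^ 7"
      using time by simp
  qed (use s in simp_all)
  then show ?thesis unfolding Q_def .
qed

definition answer :: "nat set \<Rightarrow> bool" where
  "answer C \<longleftrightarrow> (\<exists>g < 2 ^ (card (reps C dist n) + min (inp 2) (card C)).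
     accepts C dist n pairs (min (inp 2) (card C)) g)"

text \<open>Which cover is found depends on the order of the edges, hence the existential;
  \<open>K\<close> has to bound the number of bits for every small cover. The program is verified
  from its end: each of the facts \<open>p1\<close>, \<open>p2\<close>, ... treats a longer final
  segment.\<close>

lemma runs_solve:
  assumes s: "s ''in'' = inp" "\<And>x. x \<noteq> ''in'' \<Longrightarrow> s x = (\<lambda>_. 0)"
    and pairs: "\<forall>(u, v) \<in> set pairs. u < n \<and> v < n"
    and loop_free: "\<And>i. i < n \<Longrightarrow> edge i i = 0"
    and K: "\<And>C. small_cover C \<Longrightarrow> card (reps C dist n) + min (inp 2) (card C) \<le> K"
  shows "runs solve s (2 ^ K * M ^ 14)
    (\<lambda>s'. \<exists>C. small_cover C \<and> s' ''out'' 0 = (if answer C then 1 else 0))"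
proof -
  define Q where "Q s' \<longleftrightarrow> (\<exists>C. small_cover C \<and> s' ''out'' 0 = (if answer C then 1 else 0))" for s' :: state
  define l where "l = For ''g'' ''pw'' trial"
  \<comment> \<open>At most \<open>2 ^ K\<close> rounds of \<open>M ^ 7 + 12 \<le> M ^ 8\<close>
    steps each, and 9 steps for entering and leaving the loop.\<close>
  define T where "T = 2 ^ K * M ^ 8 + 9"
  have p1: "runs l r T Q"
    if C: "small_cover C" and r: "ready C r" "r ''kk'' 0 = min (inp 2) (card C)" "r ''out'' = (\<lambda>_. 0)"
      "r ''pw'' 0 = 2 ^ (card (reps C dist n) + min (inp 2) (card C))" for C r
    unfolding l_def
  proof (rule runs_For[where T = "M ^ 7" and
      I = "\<lambda>j t. t ''out'' 0 = (if \<exists>g<j. accepts C dist n pairs (min (inp 2) (card C)) g then 1 else 0)"], goal_cases)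
    case (5 j t)
    have "ready C t" using r(1) by (rule ready_cong) (rule 5(4), auto)
    moreover have "t ''kk'' 0 = min (inp 2) (card C)" using 5(4)[of "''kk''"] r by simp
    ultimately have "runs trial t (M ^ 7) (\<lambda>s'. s' ''out'' 0 =
        (if accepts C dist n pairs (min (inp 2) (card C)) j then 1 else t ''out'' 0))"
      using 5(3) pairs by (intro runs_trial)
    moreover have "(\<exists>g<Suc j. P g) \<longleftrightarrow> P j \<or> (\<exists>g<j. P g)" for P by (auto simp: less_Suc_eq)
    ultimately show ?case by (elim runs_frame) (use 5(2) in \<open>simp_all split: if_splits\<close>)
  next
    case (6 t)
    then show ?case using C r(4) unfolding Q_def answer_def by auto
  next
    case 7
    have "r ''pw'' 0 \<le> 2 ^ K" using K[OF C] r(4) by (simp add: power_increasing)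
    moreover have "M ^ 7 + 12 \<le> M ^ 8" using add_time_le[of M 12 7, OF M(1)] by (simp add: add.commute)
    ultimately show ?case unfolding T_def by (simp add: mult_le_mono)
  qed (use r in simp_all)
  have p2: "runs (Seq two_power l) r (M ^ 4 + T) Q"
    if C: "small_cover C" and r: "ready C r" "r ''kk'' 0 = min (inp 2) (card C)" "r ''out'' = (\<lambda>_. 0)" for C r
  proof (rule runs_Seq[OF runs_two_power p1[OF C]])
    show "base r" "\<forall>v<n. r ''cl'' v = rep C dist v" using r(1) by (simp_all add: ready_def)
    show "r ''kk'' 0 = min (inp 2) (card C)" by fact
    have "card C \<le> n" using C card_mono[of "{..<n}" C] by (simp add: small_cover_def)
    then show "min (inp 2) (card C) \<le> M" using M_le(2) by simp
  next
    fix t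
    assume fr: "\<And>y. y \<notin> mods two_power \<Longrightarrow> t y = r y"
    show "ready C t" using r(1) by (rule ready_cong) (rule fr, auto)
    show "t ''kk'' 0 = min (inp 2) (card C)" "t ''out'' = (\<lambda>_. 0)" using fr r by simp_all
  qed simp_all
  have p3: "runs (Seq classes (Seq two_power l)) r (M ^ 12 + (M ^ 4 + T)) Q"
    if C: "small_cover C" and r: "base r" "matrix (r ''d'') dist" "r ''c'' = (\<lambda>i. of_bool (i \<in> C))"
      "r ''kk'' 0 = min (inp 2) (card C)" "r ''out'' = (\<lambda>_. 0)" for C r
  proof (rule runs_Seq[OF runs_classes p2[OF C]])
    show "base r" "matrix (r ''d'') dist" "r ''c'' = (\<lambda>i. of_bool (i \<in> C))" by fact+
    show "C \<subseteq> {..<n}" using C by (simp add: small_cover_def)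
  next
    fix t
    assume t: "\<forall>v<n. t ''cl'' v = rep C dist v" and fr: "\<And>y. y \<notin> mods classes \<Longrightarrow> t y = r y"
    have "base t" using r(1) by (rule base_cong) (rule fr, auto)
    then show "ready C t" using t r(2) fr by (simp add: ready_def)
    show "t ''kk'' 0 = min (inp 2) (card C)" "t ''out'' = (\<lambda>_. 0)" using fr r by simp_all
  qed simp
  \<comment> \<open>With truncated subtraction, \<open>a - (a - c)\<close> is
    \<open>min a c\<close>.\<close>
  define kk where "kk = Set ''kk'' (Minus (Cell ''in'' (N 2)) (Minus (Cell ''in'' (N 2)) (Var ''cc'')))"
  have p4: "runs (Seq kk (Seq classes (Seq two_power l))) r (10 + (M ^ 12 + (M ^ 4 + T))) Q"
    if C: "small_cover C" and r: "base r" "matrix (r ''d'') dist" "r ''c'' = (\<lambda>i. of_bool (i \<in> C))"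
      "r ''cc'' 0 = card C" "r ''out'' = (\<lambda>_. 0)" for C r
  proof (rule runs_Seq_denot[OF _ p3[OF C]])
    show "base (denot kk r)" using r(1) by (rule base_cong) (auto simp: kk_def)
    show "denot kk r ''kk'' 0 = min (inp 2) (card C)"
      using r base_simps(1)[OF r(1)] by (simp add: kk_def min_def)
  qed (use r in \<open>simp_all add: kk_def\<close>)
  have p5: "runs (Seq match_edges (Seq kk (Seq classes (Seq two_power l)))) r
      (M ^ 5 + (10 + (M ^ 12 + (M ^ 4 + T)))) Q"
    if r: "base r" "matrix (r ''w'') edge" "matrix (r ''d'') dist" "r ''c'' = (\<lambda>_. 0)" "r ''cc'' = (\<lambda>_. 0)"
      "r ''out'' = (\<lambda>_. 0)" for r
  proof (rule runs_Seq[OF runs_match_edges])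
    fix t
    assume "\<exists>C. small_cover C \<and> t ''c'' = (\<lambda>i. of_bool (i \<in> C)) \<and> t ''cc'' 0 = card C"
      and fr: "\<And>y. y \<notin> mods match_edges \<Longrightarrow> t y = r y"
    then obtain C where C: "small_cover C" "t ''c'' = (\<lambda>i. of_bool (i \<in> C))" "t ''cc'' 0 = card C" by blast
    show "runs (Seq kk (Seq classes (Seq two_power l))) t (10 + (M ^ 12 + (M ^ 4 + T))) Q"
    proof (rule p4[OF C(1)])
      show "base t" using r(1) by (rule base_cong) (rule fr, auto)
      show "matrix (t ''d'') dist" "t ''out'' = (\<lambda>_. 0)" using r fr by simp_all
    qed (use C in simp_all)
  qed (use r loop_free in simp_all)
  have p6: "runs (Seq floyd_warshall (Seq match_edges (Seq kk (Seq classes (Seq two_power l))))) r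
      (M ^ 7 + (M ^ 5 + (10 + (M ^ 12 + (M ^ 4 + T))))) Q"
    if r: "base r" "matrix (r ''w'') edge" "matrix (r ''d'') edge0" "r ''c'' = (\<lambda>_. 0)" "r ''cc'' = (\<lambda>_. 0)"
      "r ''out'' = (\<lambda>_. 0)" for r
  proof (rule runs_Seq[OF runs_floyd_warshall[OF r(1,3)] p5])
    fix t
    assume fr: "\<And>y. y \<notin> mods floyd_warshall \<Longrightarrow> t y = r y"
    show "base t" using r(1) by (rule base_cong) (rule fr, auto)
    show "matrix (t ''w'') edge" "t ''c'' = (\<lambda>_. 0)" "t ''cc'' = (\<lambda>_. 0)" "t ''out'' = (\<lambda>_. 0)"
      using r fr by simp_all
  qed simp_all
  have p7: "runs (Seq init_dist (Seq floyd_warshall (Seq match_edges (Seq kk (Seq classes (Seq two_power l)))))) r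
      (M ^ 5 + (M ^ 7 + (M ^ 5 + (10 + (M ^ 12 + (M ^ 4 + T)))))) Q"
    if r: "base r" "matrix (r ''w'') edge" "r ''big'' 0 = big" "r ''c'' = (\<lambda>_. 0)" "r ''cc'' = (\<lambda>_. 0)"
      "r ''out'' = (\<lambda>_. 0)" for r
  proof (rule runs_Seq[OF runs_init_dist[OF r(1-3)] p6])
    fix t
    assume fr: "\<And>y. y \<notin> mods init_dist \<Longrightarrow> t y = r y"
    show "base t" using r(1) by (rule base_cong) (rule fr, auto)
    show "matrix (t ''w'') edge" "t ''c'' = (\<lambda>_. 0)" "t ''cc'' = (\<lambda>_. 0)" "t ''out'' = (\<lambda>_. 0)"
      using r fr by simp_all
  qed simp_all
  define rest where "rest = Seq init_dist (Seq floyd_warshall (Seq match_edges (Seq kk (Seq classes (Seq two_power l)))))"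
  define U where "U = M ^ 5 + (M ^ 7 + (M ^ 5 + (10 + (M ^ 12 + (M ^ 4 + T)))))"
  have mods_sum: "mods sum_weights = {''p'', ''big''}" by (auto simp: sum_weights_def)
  have p8: "runs (Seq sum_weights rest) r (M ^ 3 + U) Q"
    if r: "base r" "\<forall>p < n * n. r ''w'' p = weights p" "r ''c'' = (\<lambda>_. 0)" "r ''cc'' = (\<lambda>_. 0)"
      "r ''out'' = (\<lambda>_. 0)" for r
    unfolding rest_def U_def
  proof (rule runs_Seq[OF runs_sum_weights[OF r(1,2)] p7])
    fix t
    assume fr: "\<And>y. y \<notin> mods sum_weights \<Longrightarrow> t y = r y"
    show "base t" using r(1) by (rule base_cong) (rule fr, auto simp: mods_sum)
    show "matrix (t ''w'') edge" using r(2) fr[of "''w''"] index_less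
      by (simp add: matrix_def edge_def mods_sum)
    show "t ''c'' = (\<lambda>_. 0)" "t ''cc'' = (\<lambda>_. 0)" "t ''out'' = (\<lambda>_. 0)"
      using r fr by (simp_all add: mods_sum)
  qed simp_all
  have p9: "runs (Seq scale (Seq sum_weights rest)) r (M ^ 6 + (M ^ 3 + U)) Q"
    if r: "base r" "r ''c'' = (\<lambda>_. 0)" "r ''cc'' = (\<lambda>_. 0)" "r ''out'' = (\<lambda>_. 0)" for r
  proof (rule runs_Seq[OF runs_scale[OF r(1)] p8])
    fix t
    assume fr: "\<And>y. y \<notin> mods scale \<Longrightarrow> t y = r y"
    show "base t" using r(1) by (rule base_cong) (rule fr, auto)
    show "t ''c'' = (\<lambda>_. 0)" "t ''cc'' = (\<lambda>_. 0)" "t ''out'' = (\<lambda>_. 0)"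
      using r fr by simp_all
  qed simp_all
  have pow: "M ^ i \<le> M ^ 13" if "i \<le> 13" for i using M(1) that by (intro power_increasing) simp_all
  have one: "1 \<le> M ^ 13" using M(1) by simp
  have "(1::nat) \<le> 2 ^ K" by simp
  have "M ^ 3 + (M ^ 6 + (M ^ 3 + U)) \<le> 2 ^ K * M ^ 8 + 30 * M ^ 13"
    using pow[of 3] pow[of 6] pow[of 5] pow[of 7] pow[of 12] pow[of 4] one
    unfolding U_def T_def by linarith
  also have "\<dots> \<le> 2 ^ K * M ^ 13 + 30 * (2 ^ K * M ^ 13)"
    using pow[of 8] by (intro add_mono mult_le_mono) simp_all
  also have "\<dots> = 31 * (2 ^ K * M ^ 13)" by simp
  also have "\<dots> \<le> M * (2 ^ K * M ^ 13)" using M(1) by (intro mult_le_mono1) simp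
  also have "\<dots> = 2 ^ K * M ^ 14" by (simp add: power_Suc[of M 13, simplified] mult.left_commute)
  finally have time: "M ^ 3 + (M ^ 6 + (M ^ 3 + U)) \<le> 2 ^ K * M ^ 14" .
  have "runs solve s (2 ^ K * M ^ 14) Q"
    unfolding solve_def l_def[symmetric] kk_def[symmetric] rest_def[symmetric]
  proof (rule runs_Seq[OF runs_prepare p9 time])
    fix t
    assume fr: "\<And>y. y \<notin> mods prepare \<Longrightarrow> t y = s y"
    show "t ''c'' = (\<lambda>_. 0)" "t ''cc'' = (\<lambda>_. 0)" "t ''out'' = (\<lambda>_. 0)"
      using s(2) fr by simp_all
  qed (use s in simp_all)
  then show ?thesis unfolding Q_def .
qed

end

section \<open>Reading the input\<close>

text \<open>Row-major addressing. For the matrix it is applied twice: to the rows, and to the two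
  numbers of each fraction.\<close>

lemma nth_concat_uniform:
  assumes "\<And>l. l \<in> set ls \<Longrightarrow> length l = c" "i < length ls" "j < c"
  shows "concat ls ! (i * c + j) = ls ! i ! j"
  using assms
proof (induction ls arbitrary: i)
  case (Cons l ls)
  then show ?case by (cases i) (auto simp: nth_append)
qed simp

lemma length_concat_uniform:
  "(\<And>l. l \<in> set ls \<Longrightarrow> length l = c) \<Longrightarrow> length (concat ls) = length ls * c"
  by (induction ls) auto

lemma length_le_input_size: "length xs \<le> input_size xs"
  by (induction xs) (auto simp: input_size_def)

lemma floorlog_le_input_size: "x \<in> set xs \<Longrightarrow> floorlog 2 x \<le> input_size xs"
  by (induction xs) (auto simp: input_size_def)

text \<open>The tail of every arc is among the vertices listed, so a repeated arc would repeat a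
  vertex. It allows the cost of a path to be written as a sum over a set of arcs.\<close>

lemma distinct_verts_imp_distinct: "distinct (pawalk_verts u p) \<Longrightarrow> distinct p"
proof -
  have fst_in: "fst e \<in> set (pawalk_verts u p)" if "e \<in> set p" for e :: "'a \<times> 'a" and u p
    using that by (induction p arbitrary: u) auto
  assume "distinct (pawalk_verts u p)"
  then show ?thesis by (induction p arbitrary: u) (auto dest: fst_in)
qed

text \<open>Names the witnesses hidden in \<open>wtms_encodes\<close>, so that one presentation of
  one instance can be studied.\<close>

locale encoded =
  fixes I :: "'a wtms" and vs :: "'a list" and nu de :: "nat \<Rightarrow> nat \<Rightarrow> nat"
    and ts :: "(nat \<times> nat) list" and xs :: "nat list"
  assumes inst: "wtms_instance I"
    and vs: "distinct vs" "set vs = pverts (network I)"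
    and nu_de: "\<And>i j. i < length vs \<Longrightarrow> j < length vs \<Longrightarrow> de i j > 0 \<and>
      real (nu i j) / real (de i j) =
        (if (vs ! i, vs ! j) \<in> parcs (network I) then weight I (vs ! i, vs ! j) else 0)"
    and ts_less: "\<And>i j. (i, j) \<in> set ts \<Longrightarrow> i < length vs \<and> j < length vs"
    and ts_terminals: "(\<lambda>(i, j). {vs ! i, vs ! j}) ` set ts = terminals I"
    and xs: "xs = [length vs, budget I, length ts]
      @ concat [[nu i j, de i j]. i \<leftarrow> [0..<length vs], j \<leftarrow> [0..<length vs]]
      @ concat [[i, j]. (i, j) \<leftarrow> ts]"
begin

lemma pair_graph: "pair_graph (network I)"
  using inst by (simp add: wtms_instance_def)

lemma weight_pos: "(u, v) \<in> parcs (network I) \<Longrightarrow> weight I (u, v) > 0"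
  and weight_sym: "(u, v) \<in> parcs (network I) \<Longrightarrow> weight I (u, v) = weight I (v, u)"
  using inst unfolding wtms_instance_def by auto

abbreviation inp :: "nat \<Rightarrow> nat" where "inp \<equiv> input_state xs ''in''"
abbreviation nv :: nat where "nv \<equiv> length vs"

lemma inp_Suc: "j < length xs \<Longrightarrow> inp (Suc j) = xs ! j"
  by (simp add: input_state_def)

definition matrix_part :: "nat list" where
  "matrix_part = concat [[nu i j, de i j]. i \<leftarrow> [0..<length vs], j \<leftarrow> [0..<length vs]]"

definition terminal_part :: "nat list" where
  "terminal_part = concat [[i, j]. (i, j) \<leftarrow> ts]"

lemma xs_eq: "xs = [nv, budget I, length ts] @ matrix_part @ terminal_part"
  using xs by (simp add: matrix_part_def terminal_part_def)

lemma matrix_part: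
  "length matrix_part = 2 * (nv * nv)"
  "i < nv \<Longrightarrow> j < nv \<Longrightarrow> matrix_part ! (2 * (i * nv + j)) = nu i j"
  "i < nv \<Longrightarrow> j < nv \<Longrightarrow> matrix_part ! (2 * (i * nv + j) + 1) = de i j"
proof -
  define R where "R = map (\<lambda>i. map (\<lambda>j. [nu i j, de i j]) [0..<nv]) [0..<nv]"
  have mp: "matrix_part = concat (concat R)" by (simp add: matrix_part_def R_def)
  have R: "length l = nv" if "l \<in> set R" for l using that by (auto simp: R_def)
  have R2: "length l = 2" if "l \<in> set (concat R)" for l using that by (auto simp: R_def)
  have len: "length (concat R) = nv * nv"
    using length_concat_uniform[of R nv, OF R] by (simp add: R_def)
  show "length matrix_part = 2 * (nv * nv)"
    using length_concat_uniform[of "concat R" 2, OF R2] len by (simp add: mp)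
  assume ij: "i < nv" "j < nv"
  have row: "concat R ! (i * nv + j) = [nu i j, de i j]"
    using nth_concat_uniform[of R nv i j, OF R] ij by (simp add: R_def)
  have "i * nv + j < length (concat R)" using index_less[OF ij] len by simp
  then have entry: "concat (concat R) ! ((i * nv + j) * 2 + e) = [nu i j, de i j] ! e" if "e < 2" for e
    using nth_concat_uniform[of "concat R" 2 "i * nv + j" e, OF R2] that row by simp
  show "matrix_part ! (2 * (i * nv + j)) = nu i j"
    using entry[of 0] by (simp add: mp mult.commute)
  show "matrix_part ! (2 * (i * nv + j) + 1) = de i j"
    using entry[of 1] by (simp add: mp mult.commute)
qed

lemma terminal_part:
  "length terminal_part = 2 * length ts"
  "q < length ts \<Longrightarrow> terminal_part ! (2 * q) = fst (ts ! q)"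
  "q < length ts \<Longrightarrow> terminal_part ! (2 * q + 1) = snd (ts ! q)"
proof -
  define R where "R = map (\<lambda>(i, j). [i, j]) ts"
  have tp: "terminal_part = concat R" by (simp add: terminal_part_def R_def)
  have R: "length l = 2" if "l \<in> set R" for l using that by (auto simp: R_def)
  show "length terminal_part = 2 * length ts"
    using length_concat_uniform[of R 2, OF R] by (simp add: tp R_def)
  assume q: "q < length ts"
  have entry: "concat R ! (q * 2 + e) = [fst (ts ! q), snd (ts ! q)] ! e" if "e < 2" for e
    using nth_concat_uniform[of R 2 q e, OF R] that q by (simp add: R_def split_beta)
  show "terminal_part ! (2 * q) = fst (ts ! q)"
    using entry[of 0] by (simp add: tp mult.commute)
  show "terminal_part ! (2 * q + 1) = snd (ts ! q)"
    using entry[of 1] by (simp add: tp mult.commute)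
qed

lemma length_xs: "length xs = 3 + 2 * (nv * nv) + 2 * length ts"
  by (simp add: xs_eq matrix_part terminal_part)

lemma inp_header: "inp 1 = nv" "inp 2 = budget I" "inp 3 = length ts"
  using inp_Suc[of 0] inp_Suc[of 1] inp_Suc[of 2] length_xs
  by (simp_all add: xs_eq numeral_2_eq_2 numeral_3_eq_3)

lemma inp_matrix: "r < 2 * (nv * nv) \<Longrightarrow> inp (4 + r) = matrix_part ! r"
  using inp_Suc[of "3 + r"] length_xs matrix_part(1)
  by (simp add: xs_eq nth_append numeral_eq_Suc)

lemma inp_terminal: "r < 2 * length ts \<Longrightarrow> inp (4 + 2 * (nv * nv) + r) = terminal_part ! r"
  using inp_Suc[of "3 + 2 * (nv * nv) + r"] length_xs matrix_part(1)
  by (simp add: xs_eq nth_append numeral_eq_Suc)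

lemma inp_nu: "i < nv \<Longrightarrow> j < nv \<Longrightarrow> inp (4 + 2 * (i * nv + j)) = nu i j"
  and inp_de: "i < nv \<Longrightarrow> j < nv \<Longrightarrow> inp (5 + 2 * (i * nv + j)) = de i j"
  using inp_matrix[of "2 * (i * nv + j)"] inp_matrix[of "2 * (i * nv + j) + 1"]
    index_less[of i nv j] matrix_part(2,3) by simp_all

lemma inp_ts: "q < length ts \<Longrightarrow>
    (inp (4 + 2 * (nv * nv) + 2 * q), inp (5 + 2 * (nv * nv) + 2 * q)) = ts ! q"
  using inp_terminal[of "2 * q"] inp_terminal[of "2 * q + 1"] terminal_part(2,3)
  by (simp add: prod_eq_iff add.assoc)

lemma size_ge: "3 \<le> input_size xs" "nv * nv \<le> input_size xs" "length ts \<le> input_size xs"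
  using length_le_input_size[of xs] length_xs by linarith+

text \<open>The header alone gives the input size 3, and 5 is the least exponent with
  \<open>3 ^ 5 \<ge> 100\<close>.\<close>

sublocale P: input inp "input_size xs ^ 5"
proof
  have "(3::nat) ^ 5 \<le> input_size xs ^ 5" using size_ge(1) by (rule power_mono) simp
  then show "100 \<le> input_size xs ^ 5" by simp
  have le: "input_size xs \<le> input_size xs ^ 5" using size_ge(1) by (intro self_le_power) simp_all
  show "inp 1 * inp 1 \<le> input_size xs ^ 5" "inp 3 \<le> input_size xs ^ 5"
    using size_ge le inp_header by simp_all
  fix p assume p: "p < inp 1 * inp 1"
  have "4 + 2 * p < length xs" using p unfolding inp_header by (simp add: length_xs)
  then have "inp (5 + 2 * p) \<in> set xs" using inp_Suc[of "4 + 2 * p"] by simp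
  then show "floorlog 2 (inp (5 + 2 * p)) \<le> input_size xs ^ 5"
    using floorlog_le_input_size le by (meson le_trans)
qed

lemma P_simps: "P.n = nv" "P.m = length ts" "P.pairs = ts"
proof -
  show nm: "P.n = nv" "P.m = length ts" by (simp_all only: P.n_def P.m_def inp_header)
  show "P.pairs = ts"
    by (rule nth_equalityI) (use inp_ts nm in \<open>simp_all add: P.pairs_def\<close>)
qed

section \<open>Scaled integer distances and real distances\<close>

definition scale_factor :: nat where "scale_factor = (\<Prod>p<nv * nv. P.den p)"

lemma den_pos: "p < nv * nv \<Longrightarrow> P.den p > 0"
  and num_den: "i < nv \<Longrightarrow> j < nv \<Longrightarrow> P.num (i * nv + j) = nu i j \<and> P.den (i * nv + j) = de i j"
proof -
  show nd: "P.num (i * nv + j) = nu i j \<and> P.den (i * nv + j) = de i j" if "i < nv" "j < nv" for i j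
    using that inp_nu inp_de by (simp add: P.num_def P.den_def)
  assume p: "p < nv * nv"
  then have "nv > 0" by (cases nv) auto
  then have "p div nv < nv" "p mod nv < nv" using p by (simp_all add: less_mult_imp_div_less)
  from nd[OF this] nu_de[OF this] show "P.den p > 0" by simp
qed

lemma scale_factor_pos: "scale_factor > 0"
  unfolding scale_factor_def using den_pos by (simp add: prod_pos)

lemma edge_eq:
  assumes "i < nv" "j < nv"
  shows "real (P.edge i j) = scale_factor *
    (if (vs ! i, vs ! j) \<in> parcs (network I) then weight I (vs ! i, vs ! j) else 0)"
proof -
  let ?p = "i * nv + j"
  have p: "?p < nv * nv" using index_less assms by simp
  then have "scale_factor = P.den ?p * (\<Prod>q\<in>{..<nv * nv} - {?p}. P.den q)"
    unfolding scale_factor_def by (intro prod.remove) simp_all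
  moreover have "P.edge i j = P.num ?p * (\<Prod>q\<in>{..<nv * nv} - {?p}. P.den q)"
    by (simp add: P.edge_def P.weights_def P_simps)
  ultimately have "real (P.edge i j) = scale_factor * (real (P.num ?p) / real (P.den ?p))"
    using den_pos[OF p] by (simp add: field_simps)
  then show ?thesis using nu_de[OF assms] num_den[OF assms] by simp
qed

lemma edge_iff:
  assumes "i < nv" "j < nv"
  shows "P.edge i j \<noteq> 0 \<longleftrightarrow> (vs ! i, vs ! j) \<in> parcs (network I)"
proof (cases "(vs ! i, vs ! j) \<in> parcs (network I)")
  case True
  then have "real (P.edge i j) > 0"
    using edge_eq[OF assms] weight_pos[OF True] scale_factor_pos by simp
  then show ?thesis using True by simp
next
  case False
  then show ?thesis using edge_eq[OF assms] by simp
qed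

lemma arcs_sym: "(u, v) \<in> parcs (network I) \<Longrightarrow> (v, u) \<in> parcs (network I)"
proof -
  interpret pair_graph "network I" by (rule pair_graph)
  show "(u, v) \<in> parcs (network I) \<Longrightarrow> (v, u) \<in> parcs (network I)" by (rule arcs_symmetric)
qed

lemma edge_sym: "i < nv \<Longrightarrow> j < nv \<Longrightarrow> P.edge i j = P.edge j i"
  using edge_eq[of i j] edge_eq[of j i] arcs_sym[of "vs ! i" "vs ! j"] arcs_sym[of "vs ! j" "vs ! i"]
    weight_sym[of "vs ! i" "vs ! j"] by (simp split: if_splits)

lemma edge_diag: "i < nv \<Longrightarrow> P.edge i i = 0"
proof -
  interpret pair_graph "network I" by (rule pair_graph)
  show "i < nv \<Longrightarrow> P.edge i i = 0" using edge_iff[of i i] no_loops'[of "vs ! i" "vs ! i"] by blast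
qed

lemma dist_diag: "P.dist i i = 0"
  unfolding P.dist_def by (rule fw_diag) (rule P.edge0_diag)

lemma dist_triangle: "x < nv \<Longrightarrow> P.dist i j \<le> P.dist i x + P.dist x j"
  unfolding P.dist_def by (rule fw_triangle) (simp_all add: P.edge0_diag P_simps)

lemma dist_sym: "i < nv \<Longrightarrow> j < nv \<Longrightarrow> P.dist i j = P.dist j i"
  unfolding P.dist_def
  by (rule fw_sym[of nv]) (auto simp: P.edge0_def edge_sym P_simps)

lemma index: "u \<in> pverts (network I) \<Longrightarrow> \<exists>i<nv. vs ! i = u"
  using vs(2) by (metis in_set_conv_nth)

lemma nth_in_verts: "i < nv \<Longrightarrow> vs ! i \<in> pverts (network I)"
  using vs(2) by (metis nth_mem)

abbreviation walk :: "nat \<Rightarrow> ('a \<times> 'a) list \<Rightarrow> nat \<Rightarrow> bool" where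
  "walk i p j \<equiv> pre_digraph.awalk (with_proj (network I)) (vs ! i) p (vs ! j)"

abbreviation cost :: "('a \<times> 'a) list \<Rightarrow> real" where
  "cost p \<equiv> sum_list (map (weight I) p)"

text \<open>Walks for the two parts of a detour are concatenated. A value below \<open>big\<close>
  cannot involve the placeholder for a missing edge, so in the base case it comes from an arc or
  from the empty walk.\<close>

lemma fw_imp_walk:
  assumes "k \<le> nv" "i < nv" "j < nv" "fw P.edge0 k i j < P.big"
  shows "\<exists>p. walk i p j \<and> scale_factor * cost p = fw P.edge0 k i j"
proof -
  interpret pair_graph "network I" by (rule pair_graph)
  show ?thesis
    using assms
  proof (induction k arbitrary: i j)
    case 0
    show ?case
    proof (cases "i = j")
      case True
      then show ?thesis using nth_in_verts[of i] 0
        by (intro exI[of _ "[]"]) (simp add: P.edge0_def awalk_Nil_iff)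
    next
      case False
      then have "P.edge i j \<noteq> 0" "fw P.edge0 0 i j = P.edge i j"
        using 0 by (auto simp: P.edge0_def split: if_splits)
      moreover from this have "(vs ! i, vs ! j) \<in> parcs (network I)" using edge_iff 0 by blast
      ultimately show ?thesis using edge_eq[of i j] 0 nth_in_verts
        by (intro exI[of _ "[(vs ! i, vs ! j)]"]) (simp add: awalk_Cons_iff awalk_Nil_iff)
    qed
  next
    case (Suc k)
    show ?case
    proof (cases "fw P.edge0 k i j \<le> fw P.edge0 k i k + fw P.edge0 k k j")
      case True
      then show ?thesis using Suc by (simp add: min_def)
    next
      case False
      then have eq: "fw P.edge0 (Suc k) i j = fw P.edge0 k i k + fw P.edge0 k k j" by simp
      then have "fw P.edge0 k i k < P.big" "fw P.edge0 k k j < P.big" using Suc.prems by simp_all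
      then obtain p q where p: "walk i p k" "scale_factor * cost p = fw P.edge0 k i k"
        and q: "walk k q j" "scale_factor * cost q = fw P.edge0 k k j"
        using Suc.IH[of i k] Suc.IH[of k j] Suc.prems by auto
      have "walk i (p @ q) j" using p(1) q(1) by (rule awalk_appendI)
      moreover have "scale_factor * cost (p @ q) = fw P.edge0 (Suc k) i j"
        using p(2) q(2) by (simp only: eq map_append sum_list_append distrib_left of_nat_add)
      ultimately show ?thesis by blast
    qed
  qed
qed

text \<open>Induction on the walk: the first arc costs at least the distance between its ends, and
  the triangle inequality adds the rest.\<close>

lemma dist_le_walk:
  assumes "walk i p j" "i < nv" "j < nv"
  shows "real (P.dist i j) \<le> scale_factor * cost p"
proof -
  interpret pair_graph "network I" by (rule pair_graph)
  show ?thesis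
    using assms
  proof (induction p arbitrary: i)
    case Nil
    then have "i = j" using vs(1) by (simp add: awalk_Nil_iff nth_eq_iff_index_eq)
    then show ?case by (simp add: dist_diag)
  next
    case (Cons e p)
    then have e: "e \<in> parcs (network I)" "fst e = vs ! i" "awalk (snd e) p (vs ! j)"
      by (auto simp: awalk_Cons_iff)
    obtain l where l: "l < nv" "vs ! l = snd e"
      using index[of "snd e"] e(1) arc_snd_in_verts by blast
    have el: "(vs ! i, vs ! l) = e" using e l by (simp add: prod_eq_iff)
    have "real (P.dist l j) \<le> scale_factor * cost p" using Cons.IH[of l] e l Cons.prems by simp
    moreover have "P.edge i l \<noteq> 0" using edge_iff[of i l] el e(1) l Cons.prems by simp
    then have "P.edge0 i l \<le> P.edge i l" by (simp add: P.edge0_def)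
    then have "P.dist i l \<le> P.edge i l"
      using fw_antimono[of 0 nv P.edge0 i l] by (simp add: P.dist_def P_simps)
    moreover have "real (P.edge i l) = scale_factor * weight I e"
      using edge_eq[of i l] el e(1) l Cons.prems by simp
    moreover have "P.dist i j \<le> P.dist i l + P.dist l j" using dist_triangle l by blast
    ultimately have "real (P.dist i j) \<le> scale_factor * weight I e + scale_factor * cost p"
      by linarith
    then show ?case by (simp add: distrib_left)
  qed
qed

text \<open>Justifies the choice of \<open>big\<close>. A walk can be shortened to a path, on which
  no arc occurs twice; its scaled cost is then a sum over distinct positions of the matrix, and
  \<open>big\<close> exceeds the sum over all positions.\<close>

lemma walk_imp_dist_less:
  assumes "walk i p j" "i < nv" "j < nv"
  shows "P.dist i j < P.big"
proof -
  interpret pair_graph "network I" by (rule pair_graph)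
  define q where "q = awalk_to_apath p"
  have q: "apath (vs ! i) q (vs ! j)" unfolding q_def using assms(1) by (rule apath_awalk_to_apath)
  then have w: "walk i q j" "distinct q" "set q \<subseteq> parcs (network I)"
    using distinct_verts_imp_distinct by (auto simp: apath_def awalk_def)
  define ix where "ix v = (SOME i. i < nv \<and> vs ! i = v)" for v
  have ix: "ix v < nv \<and> vs ! ix v = v" if "v \<in> pverts (network I)" for v
    unfolding ix_def using index[OF that] by (rule someI_ex)
  \<comment> \<open>The position of an arc in the matrix.\<close>
  define code where "code e = ix (fst e) * nv + ix (snd e)" for e
  have verts: "fst e \<in> pverts (network I)" "snd e \<in> pverts (network I)" if "e \<in> set q" for e
    using that w(3) arc_fst_in_verts arc_snd_in_verts by blast+
  have weight: "scale_factor * weight I e = real (P.weights (code e))" if "e \<in> set q" for e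
    using edge_eq[of "ix (fst e)" "ix (snd e)"] ix verts[OF that] w(3) that
    by (auto simp: P.edge_def code_def P_simps)
  have "inj_on code (set q)"
  proof (rule inj_onI)
    fix e e' assume e: "e \<in> set q" "e' \<in> set q" "code e = code e'"
    then have "ix (fst e) = ix (fst e')" "ix (snd e) = ix (snd e')"
      using ix verts index_eq_iff[of "ix (snd e)" nv "ix (snd e')" "ix (fst e)" "ix (fst e')"]
      by (auto simp: code_def)
    then show "e = e'" using ix verts e by (metis prod_eqI)
  qed
  moreover have "code ` set q \<subseteq> {..<nv * nv}"
    using ix verts index_less by (auto simp: code_def)
  ultimately have "(\<Sum>e\<in>set q. P.weights (code e)) \<le> (\<Sum>p<nv * nv. P.weights p)"
    by (metis (no_types, lifting) finite_lessThan sum.reindex_cong sum_mono2 zero_le)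
  then have "(\<Sum>e\<in>set q. P.weights (code e)) < P.big" by (simp add: P.big_def P_simps)
  moreover have "scale_factor * cost q = real (\<Sum>e\<in>set q. P.weights (code e))"
    using w(2) weight by (simp add: sum_list_distinct_conv_sum_set sum_distrib_left)
  ultimately show ?thesis using dist_le_walk[OF w(1) assms(2,3)] by linarith
qed

text \<open>The infimum over all walks is attained by the walk from \<open>fw_imp_walk\<close>. If
  the entry is \<open>big\<close> or more, there is no walk at all, and the infimum of the empty set
  is infinite.\<close>

lemma distance_eq:
  assumes "i < nv" "j < nv"
  shows "distance I (vs ! i) (vs ! j) =
    (if P.dist i j < P.big then ereal (P.dist i j / scale_factor) else \<infinity>)"
proof -
  interpret pair_graph "network I" by (rule pair_graph)
  have D: "real scale_factor > 0" using scale_factor_pos by simp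
  have dist: "distance I (vs ! i) (vs ! j) = (INF p\<in>{p. walk i p j}. ereal (cost p))"
    by (simp add: distance_def \<mu>_def awalk_cost_def)
  show ?thesis
  proof (cases "P.dist i j < P.big")
    case True
    then obtain p where p: "walk i p j" "scale_factor * cost p = P.dist i j"
      using fw_imp_walk[of nv i j] assms by (auto simp: P.dist_def P_simps)
    have "cost p = P.dist i j / scale_factor" using p(2) D by (simp add: field_simps)
    moreover have "P.dist i j / scale_factor \<le> cost q" if "walk i q j" for q
      using dist_le_walk[OF that assms] D by (simp add: field_simps)
    ultimately have "(INF p\<in>{p. walk i p j}. ereal (cost p)) = ereal (P.dist i j / scale_factor)"
      using p(1) by (intro antisym INF_greatest) (auto intro: INF_lower2)
    then show ?thesis using True dist by simp
  next
    case False
    then have "{p. walk i p j} = {}" using walk_imp_dist_less assms by blast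
    then show ?thesis using False dist by (simp add: top_ereal_def)
  qed
qed

end

section \<open>Equivalence of the instance and the search\<close>

context encoded
begin

lemma terminal_pair:
  assumes "(i, j) \<in> set ts"
  shows "i < nv" "j < nv" "i \<noteq> j" "P.dist i j < P.big"
proof -
  show ij: "i < nv" "j < nv" using ts_less assms by auto
  have "{vs ! i, vs ! j} \<in> terminals I" using assms ts_terminals by force
  then obtain u v where uv: "{vs ! i, vs ! j} = {u, v}" "u \<noteq> v" "distance I u v < \<infinity>"
    using inst unfolding wtms_instance_def by blast
  then show "i \<noteq> j" by auto
  \<comment> \<open>Terminal pairs are unordered, so the finite distance may be known in either
    direction; the symmetry of \<open>dist\<close> settles it.\<close>
  have "u = vs ! i \<and> v = vs ! j \<or> u = vs ! j \<and> v = vs ! i"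
    using uv(1) by (auto simp: doubleton_eq_iff)
  then have "P.dist i j < P.big \<or> P.dist j i < P.big"
    using uv(3) distance_eq ij by (auto split: if_splits)
  then show "P.dist i j < P.big" using dist_sym ij by simp
qed

text \<open>If a leg is infinite, both equations fail: the first because the pair is at finite
  distance, the second because that leg alone is at least \<open>big\<close>. Otherwise the scale
  factor cancels.\<close>

lemma hit_iff:
  assumes "i < nv" "j < nv" "w < nv" "P.dist i j < P.big"
  shows "distance I (vs ! i) (vs ! w) + distance I (vs ! w) (vs ! j) = distance I (vs ! i) (vs ! j)
    \<longleftrightarrow> P.dist i w + P.dist w j = P.dist i j"
proof (cases "P.dist i w < P.big \<and> P.dist w j < P.big")
  case True
  have D: "real scale_factor > 0" using scale_factor_pos by simp
  have "distance I (vs ! i) (vs ! w) + distance I (vs ! w) (vs ! j) = distance I (vs ! i) (vs ! j)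
    \<longleftrightarrow> P.dist i w / real scale_factor + P.dist w j / real scale_factor = P.dist i j / real scale_factor"
    using True assms distance_eq by simp
  also have "\<dots> \<longleftrightarrow> real (P.dist i w) + real (P.dist w j) = real (P.dist i j)"
    using D by (simp flip: add_divide_distrib)
  also have "\<dots> \<longleftrightarrow> P.dist i w + P.dist w j = P.dist i j" by linarith
  finally show ?thesis .
next
  case False
  then have "distance I (vs ! i) (vs ! w) + distance I (vs ! w) (vs ! j) = \<infinity>"
    using assms distance_eq by auto
  moreover have "distance I (vs ! i) (vs ! j) \<noteq> \<infinity>" using assms distance_eq by simp
  moreover have "P.dist i w + P.dist w j \<noteq> P.dist i j" using False assms(4) by auto
  ultimately show ?thesis by metis
qed

lemma hitting:
  assumes "P.small_cover C"
  shows "hitting nv P.dist (\<lambda>i j. P.edge i j \<noteq> 0) P.big C ts"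
proof
  show "P.dist i i = 0" for i by (rule dist_diag)
  show "P.dist i j = P.dist j i" if "i < nv" "j < nv" for i j using that by (rule dist_sym)
  show "P.dist i j \<le> P.dist i x + P.dist x j" if "x < nv" for x i j using that by (rule dist_triangle)
  show "\<exists>x<nv. P.edge x j \<noteq> 0 \<and> P.dist i x + P.dist x j \<le> P.dist i j"
    if "i < nv" "j < nv" "i \<noteq> j" "P.dist i j < P.big" for i j
  proof -
    have edge: "P.edge a b \<noteq> 0" if "a \<noteq> b" "P.edge0 a b < P.big" for a b
      using that by (auto simp: P.edge0_def split: if_splits)
    show ?thesis
      using fw_last_edge[of P.edge0 nv P.big "\<lambda>i j. P.edge i j \<noteq> 0" nv i j] P.edge0_diag edge that
      by (simp add: P.dist_def P_simps)
  qed
  show "C \<subseteq> {..<nv}" "\<And>x y. x < nv \<Longrightarrow> y < nv \<Longrightarrow> P.edge x y \<noteq> 0 \<Longrightarrow> x \<in> C \<or> y \<in> C"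
    using assms by (auto simp: P.small_cover_def P.cover_def P_simps)
  show "u < nv \<and> v < nv \<and> u \<noteq> v \<and> P.dist u v < P.big" if "(u, v) \<in> set ts" for u v
    using terminal_pair[OF that] by blast
qed

text \<open>As it holds for every small cover, the output does not depend on the one that the greedy
  matching happens to find.\<close>

lemma yes_iff_answer:
  assumes "P.small_cover C"
  shows "wtms_yes I \<longleftrightarrow> P.answer C"
proof -
  interpret H: hitting nv P.dist "\<lambda>i j. P.edge i j \<noteq> 0" P.big C ts using assms by (rule hitting)
  have nth_inj: "inj_on ((!) vs) {..<nv}" using vs(1) by (simp add: inj_on_nth)
  have "wtms_yes I \<longleftrightarrow> H.solvable (budget I)"
  proof
    assume "wtms_yes I"
    then obtain S where S: "S \<subseteq> pverts (network I)" "card S \<le> budget I"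
      and hit: "\<And>u v. {u, v} \<in> terminals I \<Longrightarrow> \<exists>w \<in> S. distance I u w + distance I w v = distance I u v"
      unfolding wtms_yes_def by blast
    define S' where "S' = {i. i < nv \<and> vs ! i \<in> S}"
    have "finite S" using S(1) vs(2) by (metis finite_set finite_subset)
    moreover have "(!) vs ` S' \<subseteq> S" by (auto simp: S'_def)
    moreover have "inj_on ((!) vs) S'" using nth_inj by (rule inj_on_subset) (auto simp: S'_def)
    ultimately have "card S' \<le> card S" by (metis card_inj_on_le)
    moreover have "H.hits S' u v" if uv: "(u, v) \<in> set ts" for u v
    proof -
      have "{vs ! u, vs ! v} \<in> terminals I" using uv ts_terminals by force
      then obtain w where w: "w \<in> S" "distance I (vs ! u) w + distance I w (vs ! v) = distance I (vs ! u) (vs ! v)"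
        using hit by blast
      then obtain i where "i < nv" "vs ! i = w" using index S(1) by blast
      then show ?thesis using w hit_iff[of u v i] terminal_pair[OF uv]
        by (auto simp: H.hits_def S'_def)
    qed
    ultimately show "H.solvable (budget I)" unfolding H.solvable_def using S(2)
      by (intro exI[of _ S']) (auto simp: S'_def)
  next
    assume "H.solvable (budget I)"
    then obtain S where S: "S \<subseteq> {..<nv}" "card S \<le> budget I" "\<forall>(u, v) \<in> set ts. H.hits S u v"
      unfolding H.solvable_def by blast
    have "finite S" using S(1) finite_subset by blast
    then have "card ((!) vs ` S) \<le> budget I" using S(2) card_image_le le_trans by blast
    moreover have "(!) vs ` S \<subseteq> pverts (network I)" using S(1) nth_in_verts by auto
    moreover have "\<exists>w \<in> (!) vs ` S. distance I u w + distance I w v = distance I u v"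
      if uv: "{u, v} \<in> terminals I" for u v
    proof -
      have "{u, v} \<in> (\<lambda>(i, j). {vs ! i, vs ! j}) ` set ts" using uv ts_terminals by simp
      then obtain i j where ij: "(i, j) \<in> set ts" "{u, v} = {vs ! i, vs ! j}" by auto
      obtain w where w: "w \<in> S" "P.dist i w + P.dist w j = P.dist i j"
        using S(3) ij(1) unfolding H.hits_def by blast
      have "w < nv" using w(1) S(1) by blast
      note t = terminal_pair[OF ij(1)]
      \<comment> \<open>\<open>wtms_yes\<close> asks for the equation in both orders of a pair,
        while \<open>ts\<close> may list only one of them.\<close>
      have "P.dist j i < P.big" "P.dist j w + P.dist w i = P.dist j i"
        using t w(2) dist_sym \<open>w < nv\<close> by (metis add.commute)+
      then have "distance I u (vs ! w) + distance I (vs ! w) v = distance I u v"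
        using ij(2) hit_iff[of i j w] hit_iff[of j i w] t w(2) \<open>w < nv\<close>
        by (auto simp: doubleton_eq_iff)
      then show ?thesis using w(1) by blast
    qed
    ultimately show "wtms_yes I" unfolding wtms_yes_def by blast
  qed
  also have "\<dots> \<longleftrightarrow> P.answer C"
    unfolding P.answer_def P_simps inp_header by (rule H.solvable_iff_accepts)
  finally show ?thesis .
qed

abbreviation t :: nat where "t \<equiv> vertex_cover_number (network I)"

text \<open>A minimum vertex cover of the graph is translated into indices, where
  \<open>small_cover\<close> applies to it.\<close>

lemma small_cover_card:
  assumes "P.small_cover C"
  shows "card C \<le> 2 * t"
proof -
  have fin: "finite (pverts (network I))" using vs(2) by (metis finite_set)
  have "{X. vertex_cover (network I) X} \<subseteq> Pow (pverts (network I))" by (auto simp: vertex_cover_def)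
  then have "finite (card ` {X. vertex_cover (network I) X})"
    using fin by (meson finite_Pow_iff finite_imageI finite_subset)
  moreover have "vertex_cover (network I) (pverts (network I))"
  proof -
    interpret pair_graph "network I" by (rule pair_graph)
    show ?thesis by (auto simp: vertex_cover_def dest: in_arcsD1)
  qed
  ultimately have "t \<in> card ` {X. vertex_cover (network I) X}"
    unfolding vertex_cover_number_def by (intro Min_in) auto
  then obtain X where X: "vertex_cover (network I) X" "card X = t" by auto
  define Y where "Y = {i. i < nv \<and> vs ! i \<in> X}"
  have "finite X" using X(1) fin finite_subset unfolding vertex_cover_def by blast
  moreover have "inj_on ((!) vs) Y" using vs(1) by (rule inj_on_nth) (simp add: Y_def)
  moreover have "(!) vs ` Y \<subseteq> X" by (auto simp: Y_def)
  ultimately have "card Y \<le> t" using X(2) by (metis card_inj_on_le)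
  moreover have "P.cover Y" unfolding P.cover_def P_simps
    using X(1) edge_iff by (fastforce simp: Y_def vertex_cover_def)
  moreover have "Y \<subseteq> {..<P.n}" by (auto simp: Y_def P_simps)
  ultimately have "card C \<le> 2 * card Y" "card Y \<le> t" using assms unfolding P.small_cover_def by blast+
  then show ?thesis by linarith
qed

text \<open>Cover vertices contribute at most \<open>2 * t\<close> classes, the other vertices
  \<open>2 ^ (2 * t * (2 * t)) = 16 ^ (t * t)\<close>, and the reduced budget allows
  \<open>2 * t\<close> branchings.\<close>

lemma number_of_bits:
  assumes "P.small_cover C"
  shows "card (reps C P.dist P.n) + min (inp 2) (card C) \<le> 4 * t + 16 ^ (t * t)"
proof -
  have C: "card C \<le> 2 * t" using assms by (rule small_cover_card)
  have "finite C" using assms finite_subset unfolding P.small_cover_def by blast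
  then have "card (reps C P.dist P.n) \<le> card C + 2 ^ (card C * card C)" by (rule card_reps_le)
  moreover have "card C * card C \<le> 4 * (t * t)" using mult_le_mono[OF C C] by simp
  then have "(2::nat) ^ (card C * card C) \<le> 2 ^ (4 * (t * t))" by (intro power_increasing) simp_all
  moreover have "(2::nat) ^ (4 * (t * t)) = 16 ^ (t * t)" by (simp add: power_mult)
  ultimately show ?thesis using C by linarith
qed

text \<open>The exponent 70 is 5 * 14: \<open>M\<close> is the fifth power of the input size, and
  \<open>runs_solve\<close> has \<open>M ^ 14\<close>.\<close>

lemma solve_correct:
  "\<exists>T. computes_in solve xs (if wtms_yes I then 1 else 0) T \<and>
     T \<le> 2 ^ (4 * t + 16 ^ (t * t)) * input_size xs ^ 70"
proof -
  have "runs solve (input_state xs) (2 ^ (4 * t + 16 ^ (t * t)) * (input_size xs ^ 5) ^ 14)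
    (\<lambda>s'. \<exists>C. P.small_cover C \<and> s' ''out'' 0 = (if P.answer C then 1 else 0))"
  proof (rule P.runs_solve)
    show "input_state xs x = (\<lambda>_. 0)" if "x \<noteq> ''in''" for x
      using that by (simp add: input_state_def)
    show "\<forall>(u, v) \<in> set P.pairs. u < P.n \<and> v < P.n" using ts_less by (auto simp: P_simps)
    show "P.edge i i = 0" if "i < P.n" for i using that edge_diag by (simp add: P_simps)
  qed (simp, rule number_of_bits)
  then obtain T s C where "exec solve (input_state xs) T s" "P.small_cover C"
    "T \<le> 2 ^ (4 * t + 16 ^ (t * t)) * (input_size xs ^ 5) ^ 14"
    "s ''out'' 0 = (if P.answer C then 1 else 0)"
    unfolding runs_def by blast
  moreover from this have "s ''out'' 0 = (if wtms_yes I then 1 else 0)" using yes_iff_answer by simp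
  moreover have "(input_size xs ^ 5) ^ 14 = input_size xs ^ 70" by (simp flip: power_mult)
  ultimately show ?thesis unfolding computes_in_def by metis
qed

end

section \<open>The bound on the running time\<close>

text \<open>Four doublings in each of the \<open>t * t\<close> rounds produce
  \<open>16 ^ (t * t)\<close>; after \<open>4 * t\<close> has been added, the value serves as the
  number of doublings of \<open>out\<close>.\<close>

definition tower :: com where
  "tower =
    Seq (Set ''n'' (Cell ''in'' (N 1)))
    (Seq (Set ''e'' (N 1))
    (Seq (For ''i'' ''n'' (For ''j'' ''n''
       (Seq (Set ''e'' (Plus (Var ''e'') (Var ''e'')))
       (Seq (Set ''e'' (Plus (Var ''e'') (Var ''e'')))
       (Seq (Set ''e'' (Plus (Var ''e'') (Var ''e'')))
            (Set ''e'' (Plus (Var ''e'') (Var ''e''))))))))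
    (Seq (Set ''e'' (Plus (Plus (Plus (Var ''n'') (Var ''n'')) (Plus (Var ''n'') (Var ''n''))) (Var ''e'')))
    (Seq (Set ''out'' (N 1))
    (For ''i'' ''e'' (Set ''out'' (Plus (Var ''out'') (Var ''out''))))))))"

lemma computable_tower: "computable (\<lambda>t. 2 ^ (4 * t + 16 ^ (t * t)))"
  unfolding computable_def
proof (rule exI[of _ tower], rule allI)
  fix t :: nat
  define s where "s = input_state [t]"
  have s: "s ''in'' 1 = t" by (simp add: s_def input_state_def)
  let ?quad = "Seq (Set ''e'' (Plus (Var ''e'') (Var ''e'')))
       (Seq (Set ''e'' (Plus (Var ''e'') (Var ''e'')))
       (Seq (Set ''e'' (Plus (Var ''e'') (Var ''e'')))
            (Set ''e'' (Plus (Var ''e'') (Var ''e'')))))"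
  let ?sum = "Set ''e'' (Plus (Plus (Plus (Var ''n'') (Var ''n'')) (Plus (Var ''n'') (Var ''n''))) (Var ''e''))"
  let ?double = "Set ''out'' (Plus (Var ''out'') (Var ''out''))"
  define K where "K = 4 * t + 16 ^ (t * t)"
  \<comment> \<open>\<open>computable\<close> asks for halting only; \<open>t + 100\<close> here and
    \<open>K + 100\<close> below are simple choices of \<open>M\<close> for the loop rules.\<close>
  have 1: "runs (For ''i'' ''n'' (For ''j'' ''n'' ?quad)) r ((t + 100) ^ (0 + 4)) (\<lambda>r'. r' ''e'' 0 = 16 ^ (t * t))"
    if r: "r ''n'' 0 = t" "r ''e'' 0 = 1" for r
  proof (rule runs_For2[where T = 50 and I = "\<lambda>a b r'. r' ''e'' 0 = 16 ^ (a * t + b)"], goal_cases)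
    case (11 a b r')
    then show ?case by (intro runs_denot) simp_all
  qed (use r in \<open>simp_all add: add.commute\<close>)
  have 2: "runs (For ''i'' ''e'' ?double) r ((K + 100) ^ (0 + 2)) (\<lambda>r'. r' ''out'' 0 = 2 ^ K)"
    if r: "r ''e'' 0 = K" "r ''out'' 0 = 1" for r
  proof (rule runs_For_poly[where T = 50 and I = "\<lambda>a r'. r' ''out'' 0 = 2 ^ a"], goal_cases)
    case (5 a r')
    show ?case using 5(2) by (intro runs_denot) simp_all
  qed (use r in simp_all)
  have 3: "runs (Seq ?sum (Seq (Set ''out'' (N 1)) (For ''i'' ''e'' ?double))) r (20 + (10 + (K + 100) ^ 2))
    (\<lambda>r'. r' ''out'' 0 = 2 ^ K)" if "r ''e'' 0 = 16 ^ (t * t)" "r ''n'' 0 = t" for r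
    by (rule runs_Seq_denot[where U = "10 + (K + 100) ^ 2"], simp,
        rule runs_Seq_denot[where U = "(K + 100) ^ (0 + 2)"], simp, rule 2)
      (use that in \<open>simp_all add: K_def power2_eq_square\<close>)
  have "runs tower s (10 + (10 + ((t + 100) ^ (0 + 4) + (20 + (10 + (K + 100) ^ 2))))) (\<lambda>r'. r' ''out'' 0 = 2 ^ K)"
    unfolding tower_def
  proof (rule runs_Seq_denot[where U = "10 + ((t + 100) ^ (0 + 4) + (20 + (10 + (K + 100) ^ 2)))",
        OF _ runs_Seq_denot[OF _ runs_Seq[OF 1 3 order_refl]]])
    fix r
    assume "\<And>y. y \<notin> mods (For ''i'' ''n'' (For ''j'' ''n'' ?quad)) \<Longrightarrow>
      r y = denot (Set ''e'' (N 1)) (denot (Set ''n'' (Cell ''in'' (N 1))) s) y"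
    from this[of "''n''"] show "r ''n'' 0 = t" using s by simp
  qed (use s in simp_all)
  then show "\<exists>T. computes_in tower [t] (2 ^ (4 * t + 16 ^ (t * t))) T"
    unfolding runs_def computes_in_def s_def K_def by blast
qed

theorem theorem4:
  shows "fixed_parameter_tractable (wtms_instance :: nat wtms \<Rightarrow> bool) wtms_encodes wtms_yes
           (\<lambda>I. vertex_cover_number (network I))"
  unfolding fixed_parameter_tractable_def
proof (rule exI[of _ solve], rule exI[of _ "\<lambda>t. 2 ^ (4 * t + 16 ^ (t * t))"], rule exI[of _ 70],
    intro conjI allI impI)
  show "computable (\<lambda>t. 2 ^ (4 * t + 16 ^ (t * t)))" by (rule computable_tower)
  fix I :: "nat wtms" and xs
  assume inst: "wtms_instance I" and "wtms_encodes I xs"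
  then obtain vs nu de ts where "encoded I vs nu de ts xs"
    unfolding wtms_encodes_def encoded_def by blast
  then show "\<exists>T. computes_in solve xs (if wtms_yes I then 1 else 0) T \<and>
      T \<le> 2 ^ (4 * vertex_cover_number (network I) +
        16 ^ (vertex_cover_number (network I) * vertex_cover_number (network I))) * input_size xs ^ 70"
    by (rule encoded.solve_correct)
qed

end
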